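(* Let $\gamma(u,t):S^1\times[0,T)\to\mathbb{R}^2$ be a family (in the parameter $t$) of smooth, simple, closed, strictly convex curves which solves the Minkowskian curvature flow, and let $L_{\mathcal{Q}}(t)$ and $A(t)$ be the $\mathcal{Q}$-length and the enclosed area of $\gamma(\cdot,t)$. If $\displaystyle\lim_{t\to T}A(t)=0$, then $$\lim_{t\to T}\frac{L_{\mathcal{Q}}^2(t)}{A(t)}=4A(\mathcal{P}).$$
   Context: $[\cdot,\cdot]$ denotes the determinant of two vectors of $\mathbb{R}^2$; $e_r=(\cos\theta,\sin\theta)$, $e_\theta=(-\sin\theta,\cos\theta)$; a prime denotes $d/d\theta$. $\mathcal{P}\subset\mathbb{R}^2$ is a strictly convex set, symmetric with respect to the origin, whose boundary is a $C^\infty$ curve $p(\theta)=a(\theta)e_r+a'(\theta)e_\theta$, where $a$ is the support function of $\mathcal{P}$; so $p'=(a+a'')e_\theta$ and $[p,p']=a(a+a'')$. It is assumed that $a+a''>0$ for all $\theta$. $A(\mathcal{P})$ is the usual area of $\mathcal{P}$. The dual unit ball $\mathcal{Q}$ has boundary $q(\theta)=p'(\theta)/[p(\theta),p'(\theta)]=\frac{1}{a(\theta)}e_\theta$. The Minkowskian curvature flow is $$\frac{\partial \gamma}{\partial u}(u,t)=v(u,t)\,q(\theta(u,t)),\qquad \frac{\partial \gamma}{\partial t}(u,t)=-k(u,t)\,p(\theta(u,t)),$$ where $v>0$, the curves are traversed counterclockwise, and $\theta(u,t)$ is such that the angle between the $x$-axis and $\partial\gamma/\partial u$ at $(u,t)$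 is $\theta(u,t)+\pi/2$. Here $ds=v\,du$ is the $\mathcal{Q}$-arclength element, $L_{\mathcal{Q}}(t)=\int v\,du$, and the Minkowskian curvature is $k=[p,p']\,\frac{\partial\theta}{\partial s}$ (positive for the strictly convex curves considered). *)

theory Defs
  imports "HOL-Complex_Analysis.Complex_Analysis"
begin

(* The plane R^2 is represented by the type complex, for which the library provides winding
   numbers and the Jordan curve theorem; only its real vector space structure, inner product
   and Lebesgue measure are used. *)

definition det2 :: "complex \<Rightarrow> complex \<Rightarrow> real" where
  "det2 x y = Re x * Im y - Im x * Re y"

definition e_r :: "real \<Rightarrow> complex" where
  "e_r \<theta> = Complex (cos \<theta>) (sin \<theta>)"

definition e_th :: "real \<Rightarrow> complex" where
  "e_th \<theta> = Complex (- sin \<theta>) (cos \<theta>)"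

(* Derivatives are taken within S. For the sets used here (the line, and the line times a
   half-open interval) they are uniquely determined, being one-sided at boundary points. *)
primrec Ck_on ::
  "nat \<Rightarrow> ('a::real_normed_vector \<Rightarrow> 'b::real_normed_vector) \<Rightarrow> 'a set \<Rightarrow> bool" where
  "Ck_on 0 f S \<longleftrightarrow> continuous_on S f"
| "Ck_on (Suc n) f S \<longleftrightarrow>
     (\<exists>f'. (\<forall>x\<in>S. (f has_derivative f' x) (at x within S)) \<and>
           (\<forall>h. Ck_on n (\<lambda>x. f' x h) S))"

definition smooth_on :: "('a::real_normed_vector \<Rightarrow> 'b::real_normed_vector) \<Rightarrow> 'a set \<Rightarrow> bool" where
  "smooth_on f S \<longleftrightarrow> (\<forall>n. Ck_on n f S)"

definition strictly_convex :: "'a::real_normed_vector set \<Rightarrow> bool" where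
  "strictly_convex S \<longleftrightarrow> (\<forall>x\<in>S. \<forall>y\<in>S. x \<noteq> y \<longrightarrow> open_segment x y \<subseteq> interior S)"

definition support_fun :: "complex set \<Rightarrow> real \<Rightarrow> real" where
  "support_fun P \<theta> = (SUP x\<in>P. x \<bullet> e_r \<theta>)"

definition p_curve :: "complex set \<Rightarrow> real \<Rightarrow> complex" where
  "p_curve P \<theta> = support_fun P \<theta> *\<^sub>R e_r \<theta> + deriv (support_fun P) \<theta> *\<^sub>R e_th \<theta>"

definition p_deriv :: "complex set \<Rightarrow> real \<Rightarrow> complex" where
  "p_deriv P \<theta> = vector_derivative (p_curve P) (at \<theta>)"

definition q_curve :: "complex set \<Rightarrow> real \<Rightarrow> complex" where
  "q_curve P \<theta> = p_deriv P \<theta> /\<^sub>R det2 (p_curve P \<theta>) (p_deriv P \<theta>)"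

definition minkowski_ball :: "complex set \<Rightarrow> bool" where
  "minkowski_ball P \<longleftrightarrow>
     compact P \<and> strictly_convex P \<and> (\<forall>x\<in>P. - x \<in> P) \<and>
     smooth_on (support_fun P) UNIV \<and>
     (\<forall>\<theta>. support_fun P \<theta> + deriv (deriv (support_fun P)) \<theta> > 0) \<and>
     frontier P = range (p_curve P)"

(* Here c is one period of a closed curve; strict convexity of the curve means strict convexity
   of the closed region it bounds. *)
definition strictly_convex_curve :: "(real \<Rightarrow> complex) \<Rightarrow> bool" where
  "strictly_convex_curve c \<longleftrightarrow> strictly_convex (path_image c \<union> inside (path_image c))"

definition counterclockwise :: "(real \<Rightarrow> complex) \<Rightarrow> bool" where
  "counterclockwise c \<longleftrightarrow> (\<forall>z\<in>inside (path_image c). winding_number c z = 1)"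

definition enclosed_area :: "(real \<Rightarrow> complex) \<Rightarrow> real" where
  "enclosed_area c = measure lebesgue (inside (path_image c))"

(* k = [p, p'] d(theta)/ds with ds = v du *)
definition mink_curvature ::
  "complex set \<Rightarrow> (real \<Rightarrow> real \<Rightarrow> real) \<Rightarrow> (real \<Rightarrow> real \<Rightarrow> real) \<Rightarrow> real \<Rightarrow> real \<Rightarrow> real" where
  "mink_curvature P v \<theta> u t =
     det2 (p_curve P (\<theta> u t)) (p_deriv P (\<theta> u t)) * (deriv (\<lambda>w. \<theta> w t) u / v u t)"

(* The Q-length of a curve at time t; S^1 is R/Z, so that u runs through [0,1]. *)
definition Q_length :: "(real \<Rightarrow> real \<Rightarrow> real) \<Rightarrow> real \<Rightarrow> real" where
  "Q_length v t = integral {0..1} (\<lambda>u. v u t)"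

(* gamma is 1-periodic in u. The angle theta is a real-valued lift, which is not itself
   required to be periodic. *)
definition minkowski_curvature_flow ::
  "complex set \<Rightarrow> real \<Rightarrow> (real \<Rightarrow> real \<Rightarrow> complex) \<Rightarrow> (real \<Rightarrow> real \<Rightarrow> real) \<Rightarrow>
   (real \<Rightarrow> real \<Rightarrow> real) \<Rightarrow> bool" where
  "minkowski_curvature_flow P T \<gamma> v \<theta> \<longleftrightarrow>
     smooth_on (\<lambda>(u, t). \<gamma> u t) (UNIV \<times> {0..<T}) \<and>
     smooth_on (\<lambda>(u, t). \<theta> u t) (UNIV \<times> {0..<T}) \<and>
     (\<forall>u. \<forall>t\<in>{0..<T}.
        \<gamma> (u + 1) t = \<gamma> u t \<and>
        v u t > 0 \<and>
        vector_derivative (\<lambda>w. \<gamma> w t) (at u) =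
          norm (vector_derivative (\<lambda>w. \<gamma> w t) (at u)) *\<^sub>R e_r (\<theta> u t + pi / 2) \<and>
        ((\<lambda>w. \<gamma> w t) has_vector_derivative v u t *\<^sub>R q_curve P (\<theta> u t)) (at u) \<and>
        ((\<lambda>\<tau>. \<gamma> u \<tau>) has_vector_derivative
           - (mink_curvature P v \<theta> u t *\<^sub>R p_curve P (\<theta> u t))) (at t within {0..<T}))"

end

theory Submission
  imports Defs
begin

text \<open>
The argument is that of Gage for the curve shortening flow, carried over to the geometry of
\<open>P\<close>, with a quantitative step in place of his compactness argument.  Write \<open>a\<close> for the support
function of \<open>P\<close>, \<open>\<omega> = a + a''\<close>, and describe a strictly convex curve by the function
\<open>h \<phi> = c \<phi> \<bullet> e_r \<phi>\<close> of its normal angle, so that \<open>\<rho> = h + h''\<close> is the Euclidean radius of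
curvature.  Then \<open>L = \<integral> h \<omega> = \<integral> a \<rho>\<close>, twice the area is \<open>\<integral> h \<rho>\<close>, and the curvature is
\<open>k = \<omega> / \<rho>\<close>.  Along the flow \<open>A' = - 2 A\<^sub>P\<close> and \<open>L' = - K\<close>, where \<open>A\<^sub>P\<close> is the area of \<open>P\<close> and
\<open>K = \<integral> k\<^sup>2 ds = \<integral> a \<omega>\<^sup>2 / \<rho>\<close> (lemma \<open>evolution\<close>).

Everything rests on the inequality \<open>K - A\<^sub>P L / A \<ge> \<kappa> (L\<^sup>2 - 4 A\<^sub>P A) / (L A)\<close> with a constant
\<open>\<kappa> > 0\<close> that depends on \<open>P\<close> only (lemma \<open>gage_stability\<close>, and \<open>gage_loop\<close> for curves).  It shows
that the deficit \<open>L\<^sup>2 / A - 4 A\<^sub>P\<close>, divided by the power \<open>A\<^sup>\<beta>\<close> with \<open>\<beta> = \<kappa> / A\<^sub>P\<close>, does not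
increase in time.  The deficit is nonnegative and is therefore \<open>O(A\<^sup>\<beta>)\<close>, so that it tends to \<open>0\<close>
together with \<open>A\<close> (lemma \<open>ratio_tendsto\<close>).

The inequality is proved on half periods.  Some chord that joins two points with parallel tangents
bisects the area; with its midpoint as the origin, the values of \<open>h\<close> and \<open>h'\<close> agree at the two ends
of each half (lemma \<open>area_bisecting_translate\<close>), and each half together with its reflection is a
centrally symmetric curve; let \<open>L\<close> and \<open>A\<close> belong to this curve now.  If \<open>r = h \<phi> / a \<phi>\<close>, the
function \<open>h - r a\<close> vanishes at \<open>\<phi>\<close>, and the Wirtinger inequality with this zero (lemma
\<open>wirtinger_half_period\<close>) is exactly the Bonnesen inequality \<open>r L - A - A\<^sub>P r\<^sup>2 \<ge> 0\<close>.
Combined with the inequality between arithmetic and geometric means it bounds \<open>K\<close> from below.  The remainder comes from the angles where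
\<open>r\<close> is near its mean value \<open>L / (2 A\<^sub>P)\<close>: there the Bonnesen inequality is strict by a fixed
proportion of the deficit, and they fill an interval of fixed length because, for the mean value
\<open>m\<close>, the integral of the square of \<open>(h - m a)'\<close> is bounded by a multiple of the deficit.

Two links to the geometric data are needed.  The area of a convex body is half the integral of
\<open>det2 c c'\<close> over its boundary, by the change of variables that contracts the boundary towards an
interior point (lemma \<open>area_of_convex_body\<close>); it is applied to \<open>P\<close> and to the moving curve.  Each
point of the curve maximises \<open>x \<bullet> e_r \<theta>\<close> over the enclosed region (lemma \<open>support\<close>), so by strict
convexity the angle grows by exactly \<open>2\<pi>\<close> along the curve (lemma \<open>\<theta>_shift\<close>) and can serve as the
parameter.
\<close>

section \<open>Primitives and periodic functions\<close>

lemma real_ftc: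
  fixes F f :: "real \<Rightarrow> real"
  assumes "a \<le> b" "\<And>x. x \<in> {a..b} \<Longrightarrow> (F has_real_derivative f x) (at x)"
  shows "(f has_integral (F b - F a)) {a..b}"
  by (rule fundamental_theorem_of_calculus[OF assms(1)])
     (use assms(2) in \<open>auto simp: has_real_derivative_iff_has_vector_derivative[symmetric]
        intro: has_field_derivative_at_within\<close>)

lemma deriv_continuous_on:
  fixes f :: "real \<Rightarrow> real"
  assumes "\<And>x. (f has_real_derivative f' x) (at x)"
  shows "continuous_on A f"
  using assms DERIV_isCont continuous_at_imp_continuous_on by blast

lemma antiderivative_exists:
  fixes f :: "real \<Rightarrow> real"
  assumes "continuous_on UNIV f"
  shows "\<exists>F. \<forall>x. (F has_real_derivative f x) (at x)"
proof -
  define F where "F = (\<lambda>x. integral {0..x} f - integral {x..0} f)"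
  have int: "f integrable_on {x..y}" for x y
    by (rule integrable_continuous_real[OF continuous_on_subset[OF assms subset_UNIV]])
  have "(F has_real_derivative f x) (at x)" for x
  proof -
    define n where "n = \<bar>x\<bar> + 1"
    have F_eq: "integral {-n..y} f - integral {-n..0} f = F y" if "y \<in> {-n<..<n}" for y
    proof (cases "y \<ge> 0")
      case True
      then show ?thesis using Henstock_Kurzweil_Integration.integral_combine[of "-n" 0 y f] int that by (cases "y = 0") (auto simp: F_def)
    next
      case False
      then show ?thesis using Henstock_Kurzweil_Integration.integral_combine[of "-n" y 0 f] int that by (auto simp: F_def)
    qed
    have "((\<lambda>y. integral {-n..y} f) has_real_derivative f x) (at x within {-n..n})"
      by (rule integral_has_real_derivative[OF continuous_on_subset[OF assms subset_UNIV]]) (auto simp: n_def)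
    then have "((\<lambda>y. integral {-n..y} f) has_real_derivative f x) (at x)"
      by (simp add: n_def at_within_Icc_at)
    from DERIV_diff[OF this DERIV_const]
    have "((\<lambda>y. integral {-n..y} f - integral {-n..0} f) has_real_derivative f x) (at x)" by simp
    then show ?thesis
      by (rule has_field_derivative_transform_within_open[where S = "{-n<..<n}"])
        (use F_eq in \<open>auto simp: n_def\<close>)
  qed
  then show ?thesis by blast
qed

lemma integral_period_shift:
  fixes f :: "real \<Rightarrow> real"
  assumes c: "continuous_on UNIV f" and per: "\<And>x. f (x + q) = f x" and q: "q \<ge> 0"
  shows "integral {x..x + q} f = integral {0..q} f"
proof -
  obtain F where F: "\<And>x. (F has_real_derivative f x) (at x)" using antiderivative_exists[OF c] by blast
  have I: "integral {x..x + q} f = F (x + q) - F x" for x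
    by (rule integral_unique, rule real_ftc) (use q F in auto)
  have "((\<lambda>x. F (x + q) - F x) has_real_derivative f (x + q) - f x) (at x)" for x
    using DERIV_diff[OF DERIV_shift[THEN iffD1, OF F[of "x + q"]] F[of x]] by simp
  then have "F (x + q) - F x = F (0 + q) - F 0"
    using per by (intro DERIV_isconst_all) auto
  then show ?thesis using I[of 0] I[of x] by simp
qed

lemma periodic_bounded:
  fixes f :: "real \<Rightarrow> real"
  assumes c: "continuous_on UNIV f" and per: "\<And>x. f (x + q) = f x" and q: "q > 0"
  shows "\<exists>l u. l \<in> range f \<and> (\<forall>x. l \<le> f x \<and> f x \<le> u)"
proof -
  interpret periodic_fun_simple f q by unfold_locales (rule per)
  have red: "\<exists>y\<in>{0..q}. f x = f y" for x
  proof
    have "x = q * (x / q)" using q by simp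
    then have "q * real_of_int \<lfloor>x / q\<rfloor> \<le> x" "x \<le> q * (real_of_int \<lfloor>x / q\<rfloor> + 1)"
      using q mult_left_mono[of "real_of_int \<lfloor>x / q\<rfloor>" "x/q" q] mult_left_mono[of "x/q" "real_of_int \<lfloor>x / q\<rfloor> + 1" q]
      by (auto intro: less_imp_le)
    then show "x - of_int \<lfloor>x / q\<rfloor> * q \<in> {0..q}" by (simp add: algebra_simps)
    show "f x = f (x - of_int \<lfloor>x / q\<rfloor> * q)" by (simp add: minus_of_int)
  qed
  have c': "continuous_on {0..q} f" using c continuous_on_subset by blast
  obtain y where y: "\<forall>x\<in>{0..q}. f y \<le> f x"
    using continuous_attains_inf[OF compact_Icc _ c'] q by auto
  obtain z where z: "\<forall>x\<in>{0..q}. f x \<le> f z"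
    using continuous_attains_sup[OF compact_Icc _ c'] q by auto
  have "f y \<le> f x \<and> f x \<le> f z" for x
    using red[of x] y z by auto
  then show ?thesis by blast
qed

text \<open>
Cauchy--Schwarz, read off from \<open>\<integral> (w' - s)\<^sup>2 \<ge> 0\<close> for the mean slope \<open>s\<close>.
\<close>
lemma increment_sq_le:
  fixes w w' :: "real \<Rightarrow> real"
  assumes D: "\<And>x. (w has_real_derivative w' x) (at x)"
    and cont: "continuous_on UNIV w'" and xy: "x \<le> y"
  shows "(w y - w x)\<^sup>2 \<le> (y - x) * integral {x..y} (\<lambda>t. (w' t)\<^sup>2)"
proof (cases "x = y")
  case False
  with xy have l: "y - x > 0" by simp
  define s where "s = (w y - w x) / (y - x)"
  have 1: "(w' has_integral (w y - w x)) {x..y}" by (rule real_ftc[OF xy D])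
  have 2: "((\<lambda>t. (w' t)\<^sup>2) has_integral integral {x..y} (\<lambda>t. (w' t)\<^sup>2)) {x..y}"
    by (intro integrable_integral integrable_continuous_real continuous_intros
        continuous_on_subset[OF cont]) auto
  have 3: "((\<lambda>t. s\<^sup>2) has_integral (s\<^sup>2 * (y - x))) {x..y}"
    using has_integral_const_real[of "s\<^sup>2" x y] xy by (simp add: mult.commute)
  have "((\<lambda>t. (w' t)\<^sup>2 - 2 * s * w' t + s\<^sup>2) has_integral
      (integral {x..y} (\<lambda>t. (w' t)\<^sup>2) - 2 * s * (w y - w x) + s\<^sup>2 * (y - x))) {x..y}"
    by (intro has_integral_add has_integral_diff has_integral_mult_right 1 2 3)
  then have "0 \<le> integral {x..y} (\<lambda>t. (w' t)\<^sup>2) - 2 * s * (w y - w x) + s\<^sup>2 * (y - x)"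
  proof (rule has_integral_nonneg)
    fix t show "0 \<le> (w' t)\<^sup>2 - 2 * s * w' t + s\<^sup>2"
      using zero_le_power2[of "w' t - s"] by (simp add: power2_diff algebra_simps)
  qed
  also have "\<dots> = integral {x..y} (\<lambda>t. (w' t)\<^sup>2) - (w y - w x)\<^sup>2 / (y - x)"
  proof -
    have "s * (w y - w x) = (w y - w x)\<^sup>2 / (y - x)" by (simp add: s_def power2_eq_square)
    moreover have "s\<^sup>2 * (y - x) = (w y - w x)\<^sup>2 / (y - x)"
      using l by (simp add: s_def power2_eq_square)
    ultimately show ?thesis by (simp add: algebra_simps)
  qed
  finally show ?thesis using l by (simp add: field_simps)
qed simp

text \<open>
The boundary terms of the integration by parts cancel, so that \<open>\<integral> f (g + g'')\<close> equals
\<open>\<integral> (f g - f' g')\<close>, which is symmetric in \<open>f\<close> and \<open>g\<close>.  This gives the symmetry of mixed areas.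
\<close>
lemma integral_by_parts_period:
  fixes f f' g g' g'' :: "real \<Rightarrow> real"
  assumes "\<And>x. (f has_real_derivative f' x) (at x)" "\<And>x. (g' has_real_derivative g'' x) (at x)"
    and "\<alpha> \<le> \<beta>" "f \<beta> = f \<alpha>" "g' \<beta> = g' \<alpha>"
  shows "((\<lambda>x. f x * (g x + g'' x) - (f x * g x - f' x * g' x)) has_integral 0) {\<alpha>..\<beta>}"
proof -
  have "((\<lambda>x. f' x * g' x + g'' x * f x) has_integral (f \<beta> * g' \<beta> - f \<alpha> * g' \<alpha>)) {\<alpha>..\<beta>}"
    by (rule real_ftc[OF assms(3)]) (rule DERIV_mult[OF assms(1,2)])
  then show ?thesis using assms(4,5) by (simp add: algebra_simps)
qed

section \<open>The Wirtinger inequality over half a period\<close>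

text \<open>
Off the zero of \<open>w\<close>, the function \<open>w'\<^sup>2 - w\<^sup>2\<close> is the derivative of \<open>w\<^sup>2 cot (x - \<phi>)\<close> plus the
square \<open>(w' - w cot (x - \<phi>))\<^sup>2\<close>.
\<close>
lemma wirtinger_right:
  fixes w w' :: "real \<Rightarrow> real"
  assumes D: "\<And>x. (w has_real_derivative w' x) (at x)"
    and cont: "continuous_on UNIV w'"
    and 0: "w \<phi> = 0" and b: "\<phi> < b" "b < \<phi> + pi"
  shows "(w b)\<^sup>2 * cot (b - \<phi>) \<le> integral {\<phi>..b} (\<lambda>x. (w' x)\<^sup>2 - (w x)\<^sup>2)"
proof -
  \<comment> \<open>Since \<open>w\<close> has a zero and the cotangent a simple pole at \<open>\<phi>\<close>, the value \<open>0\<close> there makes the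
    primitive continuous.\<close>
  define Z where "Z = (\<lambda>x. if x = \<phi> then 0 else (w x)\<^sup>2 * cot (x - \<phi>))"
  define z where "z = (\<lambda>x. 2 * w x * w' x * cot (x - \<phi>) - (w x)\<^sup>2 / (sin (x - \<phi>))\<^sup>2)"
  have sin_pos: "sin (x - \<phi>) > 0" if "x \<in> {\<phi><..b}" for x
    using that b by (intro sin_gt_zero) auto
  have cw: "continuous_on A w" for A
    by (meson D DERIV_isCont continuous_at_imp_continuous_on)
  have Zd: "(Z has_real_derivative z x) (at x)" if x: "x \<in> {\<phi><..b}" for x
  proof -
    have "((\<lambda>x. (w x)\<^sup>2 * cot (x - \<phi>)) has_real_derivative z x) (at x)"
    proof -
      have s: "sin (x - \<phi>) \<noteq> 0" using sin_pos[OF x] by simp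
      have cot': "((\<lambda>x. cos (x - \<phi>) / sin (x - \<phi>)) has_real_derivative - 1 / (sin (x - \<phi>))\<^sup>2) (at x)"
      proof (rule DERIV_cong)
        show "((\<lambda>x. cos (x - \<phi>) / sin (x - \<phi>)) has_real_derivative
           ((- sin (x - \<phi>)) * sin (x - \<phi>) - cos (x - \<phi>) * cos (x - \<phi>)) / (sin (x - \<phi>) * sin (x - \<phi>))) (at x)"
        proof (rule DERIV_divide)
          show "((\<lambda>x. cos (x - \<phi>)) has_real_derivative - sin (x - \<phi>)) (at x)"
            by (auto intro!: derivative_eq_intros)
          show "((\<lambda>x. sin (x - \<phi>)) has_real_derivative cos (x - \<phi>)) (at x)"
            by (auto intro!: derivative_eq_intros)
        qed (rule s)
        have "(- sin (x - \<phi>)) * sin (x - \<phi>) - cos (x - \<phi>) * cos (x - \<phi>) = - 1"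
          using sin_cos_squared_add[of "x - \<phi>"] unfolding power2_eq_square by linarith
        then show "((- sin (x - \<phi>)) * sin (x - \<phi>) - cos (x - \<phi>) * cos (x - \<phi>)) / (sin (x - \<phi>) * sin (x - \<phi>)) = - 1 / (sin (x - \<phi>))\<^sup>2"
          by (simp only: power2_eq_square)
      qed
      have "((\<lambda>x. (w x)\<^sup>2 * (cos (x - \<phi>) / sin (x - \<phi>))) has_real_derivative z x) (at x)"
        by (rule DERIV_cong[OF DERIV_mult[OF DERIV_power[OF D[of x], of 2] cot']])
          (simp add: z_def cot_def)
      then show ?thesis by (simp only: cot_def)
    qed
    then show ?thesis
      by (rule has_field_derivative_transform_within_open[where S = "{\<phi><..}"])
        (use x in \<open>auto simp: Z_def\<close>)
  qed
  have ZC: "continuous_on {\<phi>..b} Z"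
  proof -
    have "isCont Z x" if "x \<in> {\<phi><..b}" for x using Zd[OF that] DERIV_isCont by blast
    moreover have "(Z \<longlongrightarrow> Z \<phi>) (at \<phi>)"
    proof -
      have 1: "((\<lambda>x. w x / (x - \<phi>)) \<longlongrightarrow> w' \<phi>) (at \<phi>)"
        using D[of \<phi>] 0 by (simp add: has_field_derivative_iff)
      have "(sin has_real_derivative cos 0) (at 0)" by (rule DERIV_sin)
      then have "((\<lambda>h. sin h / h) \<longlongrightarrow> 1) (at (0::real))"
        by (simp add: has_field_derivative_iff)
      then have 2: "((\<lambda>x. sin (x - \<phi>) / (x - \<phi>)) \<longlongrightarrow> 1) (at \<phi>)"
        by (subst at_to_0) (simp add: filterlim_filtermap)
      have 3: "(w \<longlongrightarrow> 0) (at \<phi>)" using DERIV_isCont[OF D[of \<phi>]] 0 by (simp add: isCont_def)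
      have 4: "((\<lambda>x. w x * (w x / (x - \<phi>)) / (sin (x - \<phi>) / (x - \<phi>)) * cos (x - \<phi>)) \<longlongrightarrow> 0 * w' \<phi> / 1 * cos (\<phi> - \<phi>)) (at \<phi>)"
        by (intro tendsto_intros 1 2 3) auto
      have "((\<lambda>x. Z x) \<longlongrightarrow> 0) (at \<phi>)"
        by (rule Lim_transform_eventually[OF 4[simplified]])
          (auto simp: eventually_at_filter Z_def cot_def power2_eq_square)
      then show ?thesis by (simp add: Z_def)
    qed
    ultimately show ?thesis
      by (smt (verit, ccfv_SIG) atLeastAtMost_iff continuous_at_imp_continuous_on greaterThanAtMost_iff isCont_def)
  qed
  have I: "(z has_integral (Z b - Z \<phi>)) {\<phi>..b}"
    by (rule fundamental_theorem_of_calculus_interior)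
      (use b ZC Zd in \<open>auto simp: has_real_derivative_iff_has_vector_derivative[symmetric]\<close>)
  have J: "((\<lambda>x. (w' x)\<^sup>2 - (w x)\<^sup>2) has_integral integral {\<phi>..b} (\<lambda>x. (w' x)\<^sup>2 - (w x)\<^sup>2)) {\<phi>..b}"
    by (intro integrable_integral integrable_continuous_real continuous_intros cw
        continuous_on_subset[OF cont]) auto
  have "Z b - Z \<phi> \<le> integral {\<phi>..b} (\<lambda>x. (w' x)\<^sup>2 - (w x)\<^sup>2)"
  proof (rule has_integral_le[OF I J])
    fix x assume x: "x \<in> {\<phi>..b}"
    show "z x \<le> (w' x)\<^sup>2 - (w x)\<^sup>2"
    proof (cases "x = \<phi>")
      case False
      with x sin_pos[of x] have s: "sin (x - \<phi>) > 0" by auto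
      have "(w x)\<^sup>2 / (sin (x - \<phi>))\<^sup>2 = (w x)\<^sup>2 * (1 + (cot (x - \<phi>))\<^sup>2)"
      proof -
        have "1 + (cot (x - \<phi>))\<^sup>2 = ((sin (x - \<phi>))\<^sup>2 + (cos (x - \<phi>))\<^sup>2) / (sin (x - \<phi>))\<^sup>2"
          using s by (subst add_divide_distrib) (simp add: cot_def power_divide)
        also have "\<dots> = 1 / (sin (x - \<phi>))\<^sup>2" by simp
        finally show ?thesis by (simp only: times_divide_eq_right mult_1_right)
      qed
      then have "(w' x)\<^sup>2 - (w x)\<^sup>2 - z x = (w' x - w x * cot (x - \<phi>))\<^sup>2"
        by (simp add: z_def power2_eq_square algebra_simps)
      then show ?thesis using zero_le_power2[of "w' x - w x * cot (x - \<phi>)"] by linarith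
    qed (simp add: z_def 0)
  qed
  then show ?thesis using b by (auto simp: Z_def)
qed

lemma wirtinger_left:
  fixes w w' :: "real \<Rightarrow> real"
  assumes D: "\<And>x. (w has_real_derivative w' x) (at x)"
    and cont: "continuous_on UNIV w'"
    and 0: "w \<phi> = 0" and b: "\<phi> - pi < b" "b < \<phi>"
  shows "(w b)\<^sup>2 * cot (\<phi> - b) \<le> integral {b..\<phi>} (\<lambda>x. (w' x)\<^sup>2 - (w x)\<^sup>2)"
proof -
  have "(w (- (-b)))\<^sup>2 * cot (- b - (- \<phi>)) \<le> integral {-\<phi>..-b} (\<lambda>x. (- w' (- x))\<^sup>2 - (w (- x))\<^sup>2)"
  proof (rule wirtinger_right)
    show "((\<lambda>x. w (- x)) has_real_derivative - w' (- x)) (at x)" for x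
      using DERIV_chain'[OF DERIV_minus[OF DERIV_ident] D[of "-x"]] by (simp add: DERIV_mirror)
    show "continuous_on UNIV (\<lambda>x. - w' (- x))"
      by (intro continuous_intros continuous_on_compose2[OF cont]) auto
  qed (use 0 b in auto)
  also have "integral {-\<phi>..-b} (\<lambda>x. (- w' (- x))\<^sup>2 - (w (- x))\<^sup>2) = integral {b..\<phi>} (\<lambda>x. (w' x)\<^sup>2 - (w x)\<^sup>2)"
    using Henstock_Kurzweil_Integration.integral_reflect_real[of \<phi> b "\<lambda>x. (w' x)\<^sup>2 - (w x)\<^sup>2"]
    by (simp only: power2_minus)
  finally show ?thesis by simp
qed

text \<open>
The boundary terms at the two ends of the half period cancel, because the cotangent has period
\<open>\<pi>\<close>.  If \<open>w\<close> vanishes at the ends, these serve as the zeros, and the half period is cut at its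
midpoint, where both cotangents are \<open>0\<close>.
\<close>
lemma wirtinger_half_period:
  fixes w w' :: "real \<Rightarrow> real"
  assumes D: "\<And>x. (w has_real_derivative w' x) (at x)"
    and cont: "continuous_on UNIV w'"
    and 0: "w \<phi> = 0" "\<phi> \<in> {\<alpha>..\<alpha> + pi}" and per: "w (\<alpha> + pi) = w \<alpha>"
  shows "0 \<le> integral {\<alpha>..\<alpha> + pi} (\<lambda>x. (w' x)\<^sup>2 - (w x)\<^sup>2)" (is "0 \<le> integral _ ?f")
proof -
  have cw: "continuous_on A w" for A
    by (meson D DERIV_isCont continuous_at_imp_continuous_on)
  have int: "?f integrable_on A" if "A = {x..y}" for A x y
    unfolding that by (intro integrable_continuous_real continuous_intros cw
        continuous_on_subset[OF cont]) auto
  have split: "integral {\<alpha>..\<alpha>+pi} ?f = integral {\<alpha>..x} ?f + integral {x..\<alpha>+pi} ?f"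
    if "x \<in> {\<alpha>..\<alpha> + pi}" for x
    using that Henstock_Kurzweil_Integration.integral_combine[of \<alpha> x "\<alpha>+pi" ?f] int by auto
  show ?thesis
  proof (cases "w \<alpha> = 0")
    case True
    have "integral {\<alpha>..\<alpha> + pi/2} ?f \<ge> 0"
      using wirtinger_right[OF D cont True, of "\<alpha> + pi/2"] by (simp add: cot_def)
    moreover have "integral {\<alpha> + pi/2..\<alpha> + pi} ?f \<ge> 0"
      using wirtinger_left[OF D cont, of "\<alpha> + pi" "\<alpha> + pi/2"] True per by (simp add: cot_def)
    ultimately show ?thesis using split[of "\<alpha> + pi/2"] by (simp add: cot_def)
  next
    case False
    with 0 per have \<phi>: "\<alpha> < \<phi>" "\<phi> < \<alpha> + pi" by (metis atLeastAtMost_iff less_eq_real_def)+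
    have "cot (\<alpha> + pi - \<phi>) = - cot (\<phi> - \<alpha>)"
    proof -
      have "\<alpha> + pi - \<phi> = pi - (\<phi> - \<alpha>)" by simp
      then show ?thesis by (simp only: cot_def sin_pi_minus cos_pi_minus minus_divide_left)
    qed
    then show ?thesis
      using wirtinger_right[OF D cont 0(1), of "\<alpha> + pi"] wirtinger_left[OF D cont 0(1), of \<alpha>] \<phi> per
        split[of \<phi>] by simp
  qed
qed

section \<open>The inequality of Gage with a remainder\<close>

text \<open>
Gage's inequality for a half period with matching ends, with a remainder proportional to the
isoperimetric deficit \<open>l\<^sup>2 - p S\<close>.  The number \<open>\<delta>\<close> is the length of an interval of angles on which
\<open>h / a\<close> is certain to stay near its mean value \<open>l / p\<close>; the last hypothesis makes it short enough
for this to follow from \<open>increment_sq_le\<close>.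
\<close>
lemma gage_half_period:
  fixes a a' a'' h h' h'' :: "real \<Rightarrow> real" and b M \<mu> \<alpha> :: real
  assumes a: "\<And>x. (a has_real_derivative a' x) (at x)" "\<And>x. (a' has_real_derivative a'' x) (at x)"
      "continuous_on UNIV a''" "a (\<alpha> + pi) = a \<alpha>" "a' (\<alpha> + pi) = a' \<alpha>"
    and b: "b > 0" "\<And>x. b \<le> a x" "\<And>x. a x \<le> M"
    and \<mu>: "\<mu> > 0" "\<And>x. \<mu> \<le> a x + a'' x"
    and h: "\<And>x. (h has_real_derivative h' x) (at x)" "\<And>x. (h' has_real_derivative h'' x) (at x)"
      "continuous_on UNIV h''" "h (\<alpha> + pi) = h \<alpha>" "h' (\<alpha> + pi) = h' \<alpha>"
    and \<rho>: "\<And>x. h x + h'' x > 0"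
  defines "I \<equiv> {\<alpha>..\<alpha> + pi}"
  defines "p \<equiv> integral I (\<lambda>x. a x * (a x + a'' x))"
    and "S \<equiv> integral I (\<lambda>x. h x * (h x + h'' x))"
    and "l \<equiv> integral I (\<lambda>x. h x * (a x + a'' x))"
  assumes S: "S > 0"
    and \<delta>: "\<delta> > 0" "\<delta> \<le> pi / 2" "4 * \<delta> * (p + pi * M\<^sup>2) \<le> b\<^sup>2"
  shows "l > 0" "p * S \<le> l\<^sup>2"
    "(3/8 * b * \<mu> * \<delta>) * ((l\<^sup>2 - p * S) / (l * S)) \<le>
       integral I (\<lambda>x. a x * (a x + a'' x)\<^sup>2 / (h x + h'' x)) - p * l / S"
proof -
  let ?\<omega> = "\<lambda>x. a x + a'' x" and ?\<rho> = "\<lambda>x. h x + h'' x"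
  have ca: "continuous_on A a" "continuous_on A a'" "continuous_on A a''" for A
    using a continuous_on_subset by (blast intro: DERIV_isCont continuous_at_imp_continuous_on)+
  have ch: "continuous_on A h" "continuous_on A h'" "continuous_on A h''" for A
    using h continuous_on_subset by (blast intro: DERIV_isCont continuous_at_imp_continuous_on)+
  have pos: "a x > 0" "?\<omega> x > 0" "a x \<noteq> 0" "?\<rho> x \<noteq> 0" for x
    using b(1) b(2)[of x] \<mu>(1) \<mu>(2)[of x] \<rho>[of x] by auto
  have b\<mu>_le: "b * \<mu> \<le> a x * ?\<omega> x" for x
    using b(1) b(2)[of x] \<mu>(1) \<mu>(2)[of x] by (intro mult_mono) auto
  note ci = continuous_intros ca ch
  have int: "f integrable_on I" if "continuous_on I f" for f :: "real \<Rightarrow> real"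
    using that by (simp add: I_def integrable_continuous_real)
  have hp: "((\<lambda>x. a x * ?\<omega> x) has_integral p) I"
    and hS: "((\<lambda>x. h x * ?\<rho> x) has_integral S) I"
    and hl: "((\<lambda>x. h x * ?\<omega> x) has_integral l) I"
    unfolding p_def S_def l_def by (intro integrable_integral int ci)+
  have hl': "((\<lambda>x. a x * ?\<rho> x) has_integral l) I"
  proof -
    have "((\<lambda>x. a x * ?\<rho> x - (a x * h x - a' x * h' x)) has_integral 0) I"
      unfolding I_def by (rule integral_by_parts_period) (use a h in auto)
    moreover have "((\<lambda>x. h x * ?\<omega> x - (h x * a x - h' x * a' x)) has_integral 0) I"
      unfolding I_def by (rule integral_by_parts_period) (use a h in auto)
    ultimately have "((\<lambda>x. h x * ?\<omega> x + ((a x * ?\<rho> x - (a x * h x - a' x * h' x)) -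
        (h x * ?\<omega> x - (h x * a x - h' x * a' x)))) has_integral (l + (0 - 0))) I"
      by (intro has_integral_add has_integral_diff hl)
    then show ?thesis by (simp add: algebra_simps)
  qed
  \<comment> \<open>This is \<open>- \<integral> w (w + w'')\<close> for \<open>w = h - r a\<close>, expanded in \<open>r\<close>.\<close>
  have quad: "((\<lambda>x. (h' x - r * a' x)\<^sup>2 - (h x - r * a x)\<^sup>2) has_integral (2 * r * l - S - r\<^sup>2 * p)) I" for r
  proof -
    have "((\<lambda>x. (h x - r * a x) * ((h x - r * a x) + (h'' x - r * a'' x)) -
        ((h x - r * a x) * (h x - r * a x) - (h' x - r * a' x) * (h' x - r * a' x))) has_integral 0) I"
      unfolding I_def
      by (rule integral_by_parts_period) (use a h in \<open>auto intro!: DERIV_diff DERIV_cmult\<close>)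
    then have "((\<lambda>x. ((h x - r * a x) * ((h x - r * a x) + (h'' x - r * a'' x)) -
        ((h x - r * a x) * (h x - r * a x) - (h' x - r * a' x) * (h' x - r * a' x)))
         - (h x * ?\<rho> x - r * (h x * ?\<omega> x) - r * (a x * ?\<rho> x) + r\<^sup>2 * (a x * ?\<omega> x)))
       has_integral (0 - (S - r * l - r * l + r\<^sup>2 * p))) I"
      by (intro has_integral_add has_integral_diff has_integral_mult_right hp hS hl hl')
    then show ?thesis by (simp add: algebra_simps power2_eq_square)
  qed
  define B where "B = (\<lambda>g. 2 * g * l - S - g\<^sup>2 * p)"
  have bonnesen: "0 \<le> B (h x / a x)" if "x \<in> I" for x
  proof -
    let ?r = "h x / a x"
    have "0 \<le> integral {\<alpha>..\<alpha>+pi} (\<lambda>x. (h' x - ?r * a' x)\<^sup>2 - (h x - ?r * a x)\<^sup>2)"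
    proof (rule wirtinger_half_period)
      show "((\<lambda>x. h x - ?r * a x) has_real_derivative h' x - ?r * a' x) (at x)" for x
        by (intro DERIV_diff DERIV_cmult a h)
      show "continuous_on UNIV (\<lambda>x. h' x - ?r * a' x)" by (intro ci)
      show "h x - ?r * a x = 0" using pos(3)[of x] by simp
    qed (use that a h in \<open>auto simp: I_def\<close>)
    then show ?thesis using integral_unique[OF quad[of ?r]] by (simp add: B_def I_def)
  qed
  have p_pos: "p > 0"
  proof -
    have "((\<lambda>x. b * \<mu>) has_integral (pi * (b * \<mu>))) I"
      using has_integral_const_real[of "b * \<mu>" \<alpha> "\<alpha> + pi"] by (simp add: I_def)
    then have "pi * (b * \<mu>) \<le> p"
      by (rule has_integral_le[OF _ hp]) (rule b\<mu>_le)
    moreover have "pi * (b * \<mu>) > 0" using b \<mu> by simp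
    ultimately show ?thesis by linarith
  qed
  have "l \<ge> 0"
    by (rule has_integral_nonneg[OF hl']) (use pos \<rho> in \<open>auto intro!: mult_nonneg_nonneg less_imp_le\<close>)
  moreover have "l \<noteq> 0"
  proof
    assume "l = 0"
    then have "B (h \<alpha> / a \<alpha>) = - S - (h \<alpha> / a \<alpha>)\<^sup>2 * p" by (simp add: B_def)
    moreover have "(h \<alpha> / a \<alpha>)\<^sup>2 * p \<ge> 0" using p_pos by (intro mult_nonneg_nonneg) auto
    ultimately have "B (h \<alpha> / a \<alpha>) < 0" using S by linarith
    then show False using bonnesen[of \<alpha>] by (simp add: I_def)
  qed
  ultimately show l_pos: "l > 0" by simp
  \<comment> \<open>\<open>B\<close> is a concave quadratic with vertex \<open>m\<close>, the mean of \<open>h / a\<close> with respect to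
    \<open>a (a + a'')\<close>; by Bonnesen, \<open>h / a\<close> stays within \<open>sqrt d2\<close> of \<open>m\<close>.\<close>
  define m where "m = l / p"
  define d2 where "d2 = m\<^sup>2 - S / p"
  have B_eq: "B g = p * (d2 - (g - m)\<^sup>2)" for g
    using p_pos by (simp add: B_def d2_def m_def power2_eq_square field_simps)
  obtain z where z: "z \<in> I" "h z = m * a z"
  proof -
    let ?f = "\<lambda>x. h x * ?\<omega> x - m * (a x * ?\<omega> x)"
    \<comment> \<open>Rolle for the primitive: the integral of \<open>?f\<close> over the half period is \<open>0\<close>.\<close>
    let ?F = "\<lambda>y. integral {\<alpha>..y} ?f"
    have cf: "continuous_on A ?f" for A by (intro ci)
    have Fd: "(?F has_real_derivative ?f x) (at x)" if "\<alpha> < x" "x < \<alpha> + pi" for x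
    proof -
      have "(?F has_real_derivative ?f x) (at x within {\<alpha>..\<alpha>+pi})"
        by (rule integral_has_real_derivative[OF cf]) (use that in auto)
      then show ?thesis using that by (simp add: at_within_Icc_at)
    qed
    have "?F (\<alpha> + pi) = 0"
      using integral_unique[OF has_integral_diff[OF hl has_integral_mult_right[OF hp, of m]]] p_pos
      by (simp add: m_def I_def)
    moreover have "?F \<alpha> = 0" by simp
    moreover have "continuous_on {\<alpha>..\<alpha>+pi} ?F"
      by (rule indefinite_integral_continuous_1) (use int[OF cf] in \<open>simp add: I_def\<close>)
    ultimately have "\<exists>z. \<alpha> < z \<and> z < \<alpha> + pi \<and> (?F has_real_derivative 0) (at z)"
      using Rolle[of \<alpha> "\<alpha> + pi" ?F] Fd by (force simp: real_differentiable_def)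
    then obtain z where z: "\<alpha> < z" "z < \<alpha> + pi" "(?F has_real_derivative 0) (at z)" by blast
    have "?f z = 0" using DERIV_unique[OF Fd[OF z(1,2)] z(3)] .
    then have "(h z - m * a z) * ?\<omega> z = 0" by (simp add: algebra_simps)
    then have "h z = m * a z" using pos(2)[of z] by simp
    then show ?thesis using that[of z] z by (simp add: I_def)
  qed
  have d2: "d2 \<ge> 0"
  proof -
    have "h z / a z = m" using z(2) pos(3)[of z] by simp
    then show ?thesis using bonnesen[OF z(1)] p_pos by (simp add: B_eq zero_le_mult_iff)
  qed
  have pd2: "p\<^sup>2 * d2 = l\<^sup>2 - p * S"
    using p_pos by (simp add: d2_def m_def power2_eq_square field_simps)
  show "p * S \<le> l\<^sup>2" using pd2 d2 mult_nonneg_nonneg[of "p\<^sup>2" d2] by simp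
  let ?w = "\<lambda>x. h x - m * a x" and ?w' = "\<lambda>x. h' x - m * a' x"
  have w_eq: "(?w x)\<^sup>2 = (a x)\<^sup>2 * (h x / a x - m)\<^sup>2" for x
    using pos(3)[of x] by (simp add: power_mult_distrib[symmetric] algebra_simps)
  have wle: "(?w x)\<^sup>2 \<le> M\<^sup>2 * d2" if "x \<in> I" for x
  proof -
    have "(h x / a x - m)\<^sup>2 \<le> d2" using bonnesen[OF that] p_pos by (simp add: B_eq zero_le_mult_iff)
    moreover have "(a x)\<^sup>2 \<le> M\<^sup>2" using pos(1)[of x] b(3)[of x] by (simp add: power_mono)
    ultimately show ?thesis unfolding w_eq by (intro mult_mono) auto
  qed
  have w'int: "(\<lambda>x. (?w' x)\<^sup>2) integrable_on {x..y}" for x y by (intro integrable_continuous_real ci)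
  have w'le: "integral I (\<lambda>x. (?w' x)\<^sup>2) \<le> (p + pi * M\<^sup>2) * d2"
  proof -
    have 1: "((\<lambda>x. (?w' x)\<^sup>2) has_integral integral I (\<lambda>x. (?w' x)\<^sup>2)) I"
      using w'int by (simp add: I_def integrable_integral)
    have 2: "((\<lambda>x. M\<^sup>2 * d2) has_integral (pi * (M\<^sup>2 * d2))) I"
      using has_integral_const_real[of "M\<^sup>2 * d2" \<alpha> "\<alpha> + pi"] by (simp add: I_def)
    have 3: "2 * m * l - S - m\<^sup>2 * p = p * d2"
      using p_pos by (simp add: m_def d2_def power2_eq_square field_simps)
    have "integral I (\<lambda>x. (?w' x)\<^sup>2) \<le> (2 * m * l - S - m\<^sup>2 * p) + pi * (M\<^sup>2 * d2)"
      by (rule has_integral_le[OF 1 has_integral_add[OF quad[of m] 2]]) (use wle in auto)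
    then show ?thesis unfolding 3 by (simp add: algebra_simps)
  qed
  \<comment> \<open>The interval starts or ends at \<open>z\<close>, whichever leaves it inside the half period.\<close>
  obtain x0 where x0: "{x0..x0+\<delta>} \<subseteq> I" "z = x0 \<or> z = x0 + \<delta>"
  proof (cases "z \<le> \<alpha> + pi / 2")
    case True
    then show ?thesis using that[of z] z(1) \<delta> by (auto simp: I_def)
  next
    case False
    then show ?thesis using that[of "z - \<delta>"] z(1) \<delta> by (auto simp: I_def)
  qed
  have w_small: "(?w x)\<^sup>2 \<le> b\<^sup>2 * d2 / 4" if x: "x \<in> {x0..x0+\<delta>}" for x
  proof -
    define u v where "u = min x z" and "v = max x z"
    have uv: "u \<le> v" "v - u \<le> \<delta>" "{u..v} \<subseteq> I"
      using x x0 z(1) \<delta> by (auto simp: u_def v_def I_def)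
    have wz: "?w z = 0" using z by simp
    have "(?w v - ?w u)\<^sup>2 \<le> (v - u) * integral {u..v} (\<lambda>t. (?w' t)\<^sup>2)"
      by (rule increment_sq_le) (intro DERIV_diff DERIV_cmult a h ci uv)+
    moreover have "(?w v - ?w u)\<^sup>2 = (?w x)\<^sup>2"
      using wz by (cases "x \<le> z") (auto simp: u_def v_def power2_commute)
    moreover have "integral {u..v} (\<lambda>t. (?w' t)\<^sup>2) \<le> integral I (\<lambda>t. (?w' t)\<^sup>2)"
      using w'int uv by (intro integral_subset_le) (auto simp: I_def)
    moreover have "integral {u..v} (\<lambda>t. (?w' t)\<^sup>2) \<ge> 0"
      by (rule integral_nonneg[OF w'int]) auto
    ultimately have "(?w x)\<^sup>2 \<le> \<delta> * ((p + pi * M\<^sup>2) * d2)"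
      using w'le uv \<delta> by (smt (verit) mult_mono)
    also have "\<dots> \<le> b\<^sup>2 * d2 / 4"
      using mult_right_mono[OF \<delta>(3) d2] by (simp add: algebra_simps)
    finally show ?thesis .
  qed
  have B_cont: "continuous_on A (\<lambda>x. B (h x / a x) * (a x * ?\<omega> x))" for A
    unfolding B_def using pos by (intro ci) auto
  have Q: "integral I (\<lambda>x. B (h x / a x) * (a x * ?\<omega> x)) \<ge> 3/4 * p * d2 * (b * \<mu>) * \<delta>"
  proof -
    have "3/4 * p * d2 * (b * \<mu>) * \<delta> = integral {x0..x0+\<delta>} (\<lambda>x. 3/4 * p * d2 * (b * \<mu>))"
      using \<delta> by simp
    also have "\<dots> \<le> integral {x0..x0+\<delta>} (\<lambda>x. B (h x / a x) * (a x * ?\<omega> x))"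
    proof (rule integral_le)
      fix x assume x: "x \<in> {x0..x0+\<delta>}"
      have "b\<^sup>2 * (h x / a x - m)\<^sup>2 \<le> (?w x)\<^sup>2"
        unfolding w_eq using b(1) b(2)[of x] by (intro mult_right_mono power_mono) auto
      then have "b\<^sup>2 * (h x / a x - m)\<^sup>2 \<le> b\<^sup>2 * (d2 / 4)" using w_small[OF x] by simp
      then have "(h x / a x - m)\<^sup>2 \<le> d2 / 4" using b(1) by simp
      then have "p * (3/4 * d2) \<le> B (h x / a x)"
        unfolding B_eq using p_pos by (intro mult_left_mono) auto
      moreover have "0 \<le> B (h x / a x)" by (rule bonnesen) (use x x0 in auto)
      ultimately have "(p * (3/4 * d2)) * (b * \<mu>) \<le> B (h x / a x) * (a x * ?\<omega> x)"
        using b(1) \<mu>(1) p_pos d2 by (intro mult_mono b\<mu>_le) auto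
      then show "3/4 * p * d2 * (b * \<mu>) \<le> B (h x / a x) * (a x * ?\<omega> x)" by (simp add: algebra_simps)
    qed (auto intro!: integrable_continuous_real B_cont)
    also have "\<dots> \<le> integral I (\<lambda>x. B (h x / a x) * (a x * ?\<omega> x))"
      using x0(1) bonnesen pos
      by (intro integral_subset_le int B_cont integrable_continuous_real)
        (auto intro!: mult_nonneg_nonneg simp: less_imp_le)
    finally show ?thesis .
  qed
  define K where "K = integral I (\<lambda>x. a x * (?\<omega> x)\<^sup>2 / ?\<rho> x)"
  define q where "q = integral I (\<lambda>x. B (h x / a x) * (a x * ?\<omega> x))"
  have hK: "((\<lambda>x. a x * (?\<omega> x)\<^sup>2 / ?\<rho> x) has_integral K) I"
    unfolding K_def using pos by (intro integrable_integral int ci) auto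
  have hq: "((\<lambda>x. B (h x / a x) * (a x * ?\<omega> x)) has_integral q) I"
    unfolding q_def by (intro integrable_integral int B_cont)
  have "2 / S * (p * l + p / (4 * l) * q) \<le> K + p / S\<^sup>2 * (2 * l * S - S * l)"
  proof (rule has_integral_le)
    show "((\<lambda>x. 2 / S * (p * (h x * ?\<omega> x) + p / (4 * l) * (B (h x / a x) * (a x * ?\<omega> x))))
       has_integral 2 / S * (p * l + p / (4 * l) * q)) I"
      by (intro has_integral_add has_integral_mult_right hl hq)
    show "((\<lambda>x. a x * (?\<omega> x)\<^sup>2 / ?\<rho> x + p / S\<^sup>2 * (2 * l * (h x * ?\<rho> x) - S * (a x * ?\<rho> x)))
       has_integral K + p / S\<^sup>2 * (2 * l * S - S * l)) I"
      by (intro has_integral_add has_integral_diff has_integral_mult_right hl' hS hK)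
    fix x assume x: "x \<in> I"
    define g where "g = h x / a x"
    have hg: "h x = g * a x" using pos(3)[of x] by (simp add: g_def)
    have Bg: "0 \<le> B g" using bonnesen[OF x] by (simp add: g_def)
    \<comment> \<open>The inequality of the means would give the root of \<open>p (2 l g - S) = (p g)\<^sup>2 + p B g\<close>.  Its
      lower bound \<open>X\<close> has the part \<open>p g\<close>, which yields Gage's inequality, and a part linear in \<open>B g\<close>,
      which yields the remainder.\<close>
    define X where "X = p * g + p * B g / (4 * l)"
    have g_pos: "g > 0"
    proof -
      have "0 \<le> g\<^sup>2 * p" using p_pos by (intro mult_nonneg_nonneg) auto
      then have "2 * g * l > 0" using Bg S unfolding B_def by linarith
      then show ?thesis using l_pos by (simp add: zero_less_mult_iff)
    qed
    have X2: "X\<^sup>2 \<le> p * (2 * l * g - S)"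
    proof -
      define y where "y = p * g / (2 * l)"
      have y0: "y > 0" using g_pos p_pos l_pos by (simp add: y_def)
      have pBle: "p * B g \<le> 4 * l\<^sup>2 * (y * (1 - y))"
      proof -
        have "4 * l\<^sup>2 * (y * (1 - y)) = p * (2 * g * l - g\<^sup>2 * p)"
          using l_pos by (simp add: y_def power2_eq_square field_simps)
        moreover have "B g \<le> 2 * g * l - g\<^sup>2 * p" using S by (simp add: B_def)
        ultimately show ?thesis using p_pos by (simp only: mult_left_mono less_imp_le)
      qed
      then have "0 \<le> 4 * l\<^sup>2 * (y * (1 - y))" using Bg p_pos by (smt (verit) mult_nonneg_nonneg)
      then have y1: "y \<le> 1" using y0 l_pos by (simp add: zero_le_mult_iff)
      have "p * B g / (16 * l\<^sup>2) \<le> y * (1 - y) / 4" using pBle l_pos by (simp add: field_simps)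
      also have "\<dots> \<le> 1 - y" using y0 y1 mult_right_mono[of y 1 "1 - y"] by simp
      finally have "y + p * B g / (16 * l\<^sup>2) \<le> 1" by simp
      then have "p * B g * (y + p * B g / (16 * l\<^sup>2)) \<le> p * B g * 1"
        using Bg p_pos by (intro mult_left_mono) auto
      moreover have "X\<^sup>2 = (p * g)\<^sup>2 + p * B g * (y + p * B g / (16 * l\<^sup>2))"
        using l_pos by (simp add: X_def y_def power2_eq_square field_simps)
      moreover have "p * (2 * l * g - S) = (p * g)\<^sup>2 + p * B g * 1"
        by (simp add: B_def power2_eq_square algebra_simps)
      ultimately show ?thesis by linarith
    qed
    have "2 / S * (p * (h x * ?\<omega> x) + p / (4 * l) * (B (h x / a x) * (a x * ?\<omega> x)))
        = 2 * (X / S) * (a x * ?\<omega> x)"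
      by (simp add: X_def g_def[symmetric] hg algebra_simps add_divide_distrib)
    also have "\<dots> \<le> a x * (?\<omega> x)\<^sup>2 / ?\<rho> x + (X / S)\<^sup>2 * (a x * ?\<rho> x)"
    proof -
      have "0 \<le> a x / ?\<rho> x * (?\<omega> x - X / S * ?\<rho> x)\<^sup>2"
        using pos(1)[of x] \<rho>[of x] by (intro mult_nonneg_nonneg) auto
      also have "\<dots> = a x * (?\<omega> x)\<^sup>2 / ?\<rho> x + (X / S)\<^sup>2 * (a x * ?\<rho> x) - 2 * (X / S) * (a x * ?\<omega> x)"
      proof -
        have "a / r * (w - X / S * r)\<^sup>2 = a * w\<^sup>2 / r + (X / S)\<^sup>2 * (a * r) - 2 * (X / S) * (a * w)"
          if "r > 0" for a r w :: real using that S by (simp add: power2_eq_square field_simps)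
        then show ?thesis using \<rho>[of x] by blast
      qed
      finally show ?thesis by simp
    qed
    also have "\<dots> \<le> a x * (?\<omega> x)\<^sup>2 / ?\<rho> x + p / S\<^sup>2 * (2 * l * (h x * ?\<rho> x) - S * (a x * ?\<rho> x))"
    proof -
      have "(X / S)\<^sup>2 * (a x * ?\<rho> x) \<le> p * (2 * l * g - S) / S\<^sup>2 * (a x * ?\<rho> x)"
        using X2 S pos(1)[of x] \<rho>[of x] by (intro mult_right_mono) (auto simp: power_divide divide_right_mono)
      also have "\<dots> = p / S\<^sup>2 * (2 * l * (h x * ?\<rho> x) - S * (a x * ?\<rho> x))"
      proof -
        have "2 * l * (h x * ?\<rho> x) - S * (a x * ?\<rho> x) = (2 * l * g - S) * (a x * ?\<rho> x)"
          using hg by (simp only: left_diff_distrib mult.assoc)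
        then show ?thesis by (simp only: times_divide_eq_left times_divide_eq_right mult.assoc)
      qed
      finally show ?thesis by simp
    qed
    finally show "2 / S * (p * (h x * ?\<omega> x) + p / (4 * l) * (B (h x / a x) * (a x * ?\<omega> x)))
      \<le> a x * (?\<omega> x)\<^sup>2 / ?\<rho> x + p / S\<^sup>2 * (2 * l * (h x * ?\<rho> x) - S * (a x * ?\<rho> x))" .
  qed
  also have "p / S\<^sup>2 * (2 * l * S - S * l) = p * l / S" using S by (simp add: power2_eq_square)
  finally have "2 / S * (p * l + p / (4 * l) * q) \<le> K + p * l / S" .
  moreover have "2 / S * (p * l + p / (4 * l) * q) = 2 * (p * l / S) + p / (2 * l * S) * q"
    using S l_pos by (simp add: field_simps)
  ultimately have main: "p / (2 * l * S) * q \<le> K - p * l / S" by linarith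
  have "(3/8 * b * \<mu> * \<delta>) * ((l\<^sup>2 - p * S) / (l * S)) = p / (2 * l * S) * (3/4 * p * d2 * (b * \<mu>) * \<delta>)"
    unfolding pd2[symmetric] using S l_pos by (simp add: field_simps power2_eq_square)
  also have "\<dots> \<le> p / (2 * l * S) * q"
    using Q p_pos l_pos S unfolding q_def by (intro mult_left_mono) auto
  finally show "(3/8 * b * \<mu> * \<delta>) * ((l\<^sup>2 - p * S) / (l * S)) \<le>
       integral I (\<lambda>x. a x * (a x + a'' x)\<^sup>2 / (h x + h'' x)) - p * l / S"
    using main K_def by linarith
qed

text \<open>
The function \<open>l - q / l\<close> increases, so the half with the larger length alone accounts for the
deficit of the whole curve; the deficit of the other half is nonnegative.
\<close>
lemma deficit_of_two_halves:
  fixes l1 l2 q :: real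
  assumes "l1 > 0" "l2 > 0" "q > 0" "q \<le> l1\<^sup>2" "q \<le> l2\<^sup>2"
  shows "4 * q \<le> (l1 + l2)\<^sup>2"
    "((l1 + l2)\<^sup>2 - 4 * q) / (2 * (l1 + l2)) \<le> (l1\<^sup>2 - q) / l1 + (l2\<^sup>2 - q) / l2"
proof -
  have main: "((l1 + l2)\<^sup>2 - 4 * q) / (2 * (l1 + l2)) \<le> (l1\<^sup>2 - q) / l1 + (l2\<^sup>2 - q) / l2"
    if "l2 \<le> l1" "l1 > 0" "l2 > 0" "q \<le> l1\<^sup>2" "q \<le> l2\<^sup>2" for l1 l2
  proof -
    have "((l1 + l2)\<^sup>2 - 4 * q) / (2 * (l1 + l2)) = (l1 + l2) / 2 - q / ((l1 + l2) / 2)"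
      using that by (simp add: power2_eq_square field_simps)
    also have "\<dots> \<le> l1 - q / l1"
      using that assms(3) by (intro diff_mono divide_left_mono) auto
    also have "\<dots> = (l1\<^sup>2 - q) / l1" using that by (simp add: power2_eq_square field_simps)
    also have "\<dots> \<le> (l1\<^sup>2 - q) / l1 + (l2\<^sup>2 - q) / l2" using that by simp
    finally show ?thesis .
  qed
  show "((l1 + l2)\<^sup>2 - 4 * q) / (2 * (l1 + l2)) \<le> (l1\<^sup>2 - q) / l1 + (l2\<^sup>2 - q) / l2"
    using main[of l1 l2] main[of l2 l1] assms by (cases "l2 \<le> l1") (auto simp: add.commute)
  have "q\<^sup>2 \<le> (l1 * l2)\<^sup>2"
    using mult_mono[OF assms(4,5)] assms(3) by (simp add: power2_eq_square algebra_simps)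
  then have "q \<le> l1 * l2" using assms by (intro power2_le_imp_le[of q]) auto
  then show "4 * q \<le> (l1 + l2)\<^sup>2"
    using zero_le_power2[of "l1 - l2"] by (simp add: power2_eq_square algebra_simps)
qed

text \<open>
Subtracting \<open>X cos + Y sin\<close> from \<open>h\<close> moves the origin to \<open>(X, Y)\<close>.  The midpoint of the chord between
the points with normal angles \<open>\<alpha>\<close> and \<open>\<alpha> + \<pi>\<close> makes the ends match for every \<open>\<alpha>\<close>, and the
difference of the two half areas changes its sign when \<open>\<alpha>\<close> moves on by \<open>\<pi>\<close>, so it has a zero.
\<close>
lemma area_bisecting_translate:
  fixes h h' h'' :: "real \<Rightarrow> real"
  assumes h: "\<And>x. (h has_real_derivative h' x) (at x)" "\<And>x. (h' has_real_derivative h'' x) (at x)"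
      "continuous_on UNIV h''" "\<And>x. h (x + 2 * pi) = h x"
  obtains \<alpha> X Y :: real where
    "h (\<alpha> + pi) - (X * cos (\<alpha> + pi) + Y * sin (\<alpha> + pi)) = h \<alpha> - (X * cos \<alpha> + Y * sin \<alpha>)"
    "h' (\<alpha> + pi) - (Y * cos (\<alpha> + pi) - X * sin (\<alpha> + pi)) = h' \<alpha> - (Y * cos \<alpha> - X * sin \<alpha>)"
    "integral {\<alpha>..\<alpha>+pi} (\<lambda>x. (h x - (X * cos x + Y * sin x)) * (h x + h'' x)) =
     integral {\<alpha>+pi..\<alpha>+2*pi} (\<lambda>x. (h x - (X * cos x + Y * sin x)) * (h x + h'' x))"
proof -
  have h'per: "h' (x + 2 * pi) = h' x" for x
    using DERIV_unique[OF h(1)[of x]] DERIV_shift[THEN iffD1, OF h(1)[of "x + 2*pi"]] by (simp add: h(4))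
  have h''per: "h'' (x + 2 * pi) = h'' x" for x
    using DERIV_unique[OF h(2)[of x]] DERIV_shift[THEN iffD1, OF h(2)[of "x + 2*pi"]] by (simp add: h'per)
  have ch: "continuous_on A h" "continuous_on A h'" "continuous_on A h''" for A
    by (rule deriv_continuous_on, rule h(1), rule deriv_continuous_on, rule h(2), rule continuous_on_subset[OF h(3) subset_UNIV])
  let ?\<rho> = "\<lambda>x. h x + h'' x"
  \<comment> \<open>The coordinates of the boundary point with normal angle \<open>x\<close>.\<close>
  define cx cy where "cx = (\<lambda>x. h x * cos x - h' x * sin x)" and "cy = (\<lambda>x. h x * sin x + h' x * cos x)"
  have cxd: "(cx has_real_derivative - ?\<rho> x * sin x) (at x)" for x
    unfolding cx_def by (auto intro!: derivative_eq_intros h simp: algebra_simps)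
  have cyd: "(cy has_real_derivative ?\<rho> x * cos x) (at x)" for x
    unfolding cy_def by (auto intro!: derivative_eq_intros h simp: algebra_simps)
  have ccx: "continuous_on A cx" "continuous_on A cy" for A
    unfolding cx_def cy_def by (intro continuous_intros ch)+
  have cper: "cx (x + 2 * pi) = cx x" "cy (x + 2 * pi) = cy x" for x
    by (simp_all add: cx_def cy_def h h'per)
  obtain G where G: "\<And>x. (G has_real_derivative h x * ?\<rho> x) (at x)"
  proof -
    have "continuous_on UNIV (\<lambda>x. h x * ?\<rho> x)" by (intro continuous_intros ch)
    from antiderivative_exists[OF this] show ?thesis using that by blast
  qed
  have cG: "continuous_on A G" for A by (rule deriv_continuous_on) (rule G)
  define X Y where "X = (\<lambda>\<alpha>. (cx \<alpha> + cx (\<alpha> + pi)) / 2)" and "Y = (\<lambda>\<alpha>. (cy \<alpha> + cy (\<alpha> + pi)) / 2)"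
  define half where "half = (\<lambda>\<alpha> X Y. G (\<alpha> + pi) - G \<alpha> - X * (cy (\<alpha> + pi) - cy \<alpha>) + Y * (cx (\<alpha> + pi) - cx \<alpha>))"
  have half: "integral {\<alpha>..\<alpha>+pi} (\<lambda>x. (h x - (X * cos x + Y * sin x)) * ?\<rho> x) = half \<alpha> X Y" for \<alpha> X Y
  proof (rule integral_unique)
    have 1: "((\<lambda>x. h x * ?\<rho> x) has_integral (G (\<alpha> + pi) - G \<alpha>)) {\<alpha>..\<alpha>+pi}" by (rule real_ftc) (use G in auto)
    have 2: "((\<lambda>x. - ?\<rho> x * sin x) has_integral (cx (\<alpha> + pi) - cx \<alpha>)) {\<alpha>..\<alpha>+pi}" by (rule real_ftc) (use cxd in auto)
    have 3: "((\<lambda>x. ?\<rho> x * cos x) has_integral (cy (\<alpha> + pi) - cy \<alpha>)) {\<alpha>..\<alpha>+pi}" by (rule real_ftc) (use cyd in auto)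
    have "((\<lambda>x. h x * ?\<rho> x - X * (?\<rho> x * cos x) + Y * (- ?\<rho> x * sin x)) has_integral half \<alpha> X Y) {\<alpha>..\<alpha>+pi}"
      unfolding half_def by (intro has_integral_add has_integral_diff has_integral_mult_right 1 2 3)
    then show "((\<lambda>x. (h x - (X * cos x + Y * sin x)) * ?\<rho> x) has_integral half \<alpha> X Y) {\<alpha>..\<alpha>+pi}"
      by (simp add: algebra_simps)
  qed
  define \<Delta> where "\<Delta> = (\<lambda>\<alpha>. half \<alpha> (X \<alpha>) (Y \<alpha>) - half (\<alpha> + pi) (X \<alpha>) (Y \<alpha>))"
  have c\<Delta>: "continuous_on A \<Delta>" for A
    unfolding \<Delta>_def half_def X_def Y_def
    by (intro continuous_intros continuous_on_compose2[OF cG[of UNIV]] continuous_on_compose2[OF ccx(1)[of UNIV]]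
       continuous_on_compose2[OF ccx(2)[of UNIV]]) auto
  have Gshift: "G (x + 2 * pi) - G x = G (0 + 2 * pi) - G 0" for x
  proof (rule DERIV_isconst_all[of "\<lambda>x. G (x + 2 * pi) - G x", rule_format])
    show "((\<lambda>x. G (x + 2 * pi) - G x) has_real_derivative 0) (at x)" for x
      using DERIV_diff[OF DERIV_shift[THEN iffD1, OF G[of "x + 2 * pi"]] G[of x]] by (simp add: h(4) h''per)
  qed
  have shift: "half (x + 2 * pi) u v = half x u v" for x u v
    using Gshift[of x] Gshift[of "x + pi"] cper[of x] cper[of "x + pi"]
    by (simp add: half_def add.assoc add.commute[of "2 * pi"])
  have \<Delta>pi: "\<Delta> pi = - \<Delta> 0"
    using shift[of 0] cper[of 0] by (simp add: \<Delta>_def X_def Y_def add.commute)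
  obtain \<alpha> where \<alpha>: "\<Delta> \<alpha> = 0"
  proof (cases "\<Delta> 0 \<le> 0")
    case True then show ?thesis using IVT'[of \<Delta> 0 0 pi] \<Delta>pi c\<Delta> that by auto
  next
    case False then show ?thesis using IVT2'[of \<Delta> pi 0 0] \<Delta>pi c\<Delta> that by auto
  qed
  have sc: "sin t * sin t = 1 - cos t * cos t" for t :: real
    using sin_cos_squared_add[of t] by (simp add: power2_eq_square)
  have id: "cx t * cos t + cy t * sin t = h t" "cy t * cos t - cx t * sin t = h' t" for t
  proof -
    have "cx t * cos t + cy t * sin t = h t * ((sin t)\<^sup>2 + (cos t)\<^sup>2)"
      unfolding cx_def cy_def power2_eq_square by algebra
    then show "cx t * cos t + cy t * sin t = h t" by simp
    have "cy t * cos t - cx t * sin t = h' t * ((sin t)\<^sup>2 + (cos t)\<^sup>2)"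
      unfolding cx_def cy_def power2_eq_square by algebra
    then show "cy t * cos t - cx t * sin t = h' t" by simp
  qed
  have XY: "2 * X \<alpha> = cx \<alpha> + cx (\<alpha> + pi)" "2 * Y \<alpha> = cy \<alpha> + cy (\<alpha> + pi)"
    by (simp_all add: X_def Y_def)
  show ?thesis
  proof (rule that[of \<alpha> "X \<alpha>" "Y \<alpha>"])
    have "2 * (X \<alpha> * cos \<alpha> + Y \<alpha> * sin \<alpha>) = (2 * X \<alpha>) * cos \<alpha> + (2 * Y \<alpha>) * sin \<alpha>" by (simp add: algebra_simps)
    also have "\<dots> = (cx \<alpha> * cos \<alpha> + cy \<alpha> * sin \<alpha>) - (cx (\<alpha> + pi) * cos (\<alpha> + pi) + cy (\<alpha> + pi) * sin (\<alpha> + pi))"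
      unfolding XY by (simp add: algebra_simps)
    also have "\<dots> = h \<alpha> - h (\<alpha> + pi)" by (simp only: id)
    finally have "2 * (X \<alpha> * cos \<alpha> + Y \<alpha> * sin \<alpha>) = h \<alpha> - h (\<alpha> + pi)" .
    then show "h (\<alpha> + pi) - (X \<alpha> * cos (\<alpha> + pi) + Y \<alpha> * sin (\<alpha> + pi)) = h \<alpha> - (X \<alpha> * cos \<alpha> + Y \<alpha> * sin \<alpha>)"
      unfolding cos_periodic_pi sin_periodic_pi by algebra
    have "2 * (Y \<alpha> * cos \<alpha> - X \<alpha> * sin \<alpha>) = (2 * Y \<alpha>) * cos \<alpha> - (2 * X \<alpha>) * sin \<alpha>" by (simp add: algebra_simps)
    also have "\<dots> = (cy \<alpha> * cos \<alpha> - cx \<alpha> * sin \<alpha>) - (cy (\<alpha> + pi) * cos (\<alpha> + pi) - cx (\<alpha> + pi) * sin (\<alpha> + pi))"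
      unfolding XY by (simp add: algebra_simps)
    also have "\<dots> = h' \<alpha> - h' (\<alpha> + pi)" by (simp only: id)
    finally have "2 * (Y \<alpha> * cos \<alpha> - X \<alpha> * sin \<alpha>) = h' \<alpha> - h' (\<alpha> + pi)" .
    then show "h' (\<alpha> + pi) - (Y \<alpha> * cos (\<alpha> + pi) - X \<alpha> * sin (\<alpha> + pi)) = h' \<alpha> - (Y \<alpha> * cos \<alpha> - X \<alpha> * sin \<alpha>)"
      unfolding cos_periodic_pi sin_periodic_pi by algebra
    show "integral {\<alpha>..\<alpha>+pi} (\<lambda>x. (h x - (X \<alpha> * cos x + Y \<alpha> * sin x)) * ?\<rho> x) =
     integral {\<alpha>+pi..\<alpha>+2*pi} (\<lambda>x. (h x - (X \<alpha> * cos x + Y \<alpha> * sin x)) * ?\<rho> x)"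
      using \<alpha> half[of \<alpha> "X \<alpha>" "Y \<alpha>"] half[of "\<alpha> + pi" "X \<alpha>" "Y \<alpha>"] by (simp add: \<Delta>_def algebra_simps)
  qed
qed

text \<open>
Both halves of the curve have the area \<open>S\<close> and the same integral of \<open>a (a + a'')\<close>, so the
inequalities for the two halves have the same coefficients and can be added.
\<close>
lemma gage_stability:
  fixes a a' a'' :: "real \<Rightarrow> real"
  assumes a: "\<And>x. (a has_real_derivative a' x) (at x)" "\<And>x. (a' has_real_derivative a'' x) (at x)"
      "continuous_on UNIV a''" "\<And>x. a (x + pi) = a x"
    and pos: "\<And>x. a x > 0" "\<And>x. a x + a'' x > 0"
  obtains c where "c > 0"
    "\<And>h h' h'' S l. \<lbrakk>\<And>x. (h has_real_derivative h' x) (at x); \<And>x. (h' has_real_derivative h'' x) (at x);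
       continuous_on UNIV h''; \<And>x. h (x + 2 * pi) = h x; \<And>x. h x + h'' x > 0;
       ((\<lambda>x. h x * (h x + h'' x)) has_integral 2 * S) {0..2*pi}; S > 0;
       ((\<lambda>x. h x * (a x + a'' x)) has_integral l) {0..2*pi};
       ((\<lambda>x. a x * (a x + a'' x)) has_integral 2 * p) {0..2*pi}\<rbrakk> \<Longrightarrow>
      l > 0 \<and> 4 * p * S \<le> l\<^sup>2 \<and>
      c * ((l\<^sup>2 - 4 * p * S) / (l * S)) \<le>
        integral {0..2*pi} (\<lambda>x. a x * (a x + a'' x)\<^sup>2 / (h x + h'' x)) - p * l / S"
proof -
  have a'per: "a' (x + pi) = a' x" for x
    using DERIV_unique[OF a(1)[of x]] DERIV_shift[THEN iffD1, OF a(1)[of "x + pi"]] by (simp add: a(4))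
  have a''per: "a'' (x + pi) = a'' x" for x
    using DERIV_unique[OF a(2)[of x]] DERIV_shift[THEN iffD1, OF a(2)[of "x + pi"]] by (simp add: a'per)
  have ca: "continuous_on A a" "continuous_on A a'" "continuous_on A a''" for A
    by (rule deriv_continuous_on, rule a(1), rule deriv_continuous_on, rule a(2), rule continuous_on_subset[OF a(3) subset_UNIV])
  obtain b M where b: "b \<in> range a" "\<And>x. b \<le> a x" "\<And>x. a x \<le> M"
    using periodic_bounded[OF ca(1) a(4) pi_gt_zero] by blast
  define \<omega> where "\<omega> = (\<lambda>x. a x + a'' x)"
  have c\<omega>: "continuous_on A \<omega>" for A unfolding \<omega>_def by (intro continuous_intros ca)
  have \<omega>per: "\<omega> (x + pi) = \<omega> x" for x by (simp add: \<omega>_def a(4) a''per)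
  obtain \<mu> U where \<mu>: "\<mu> \<in> range \<omega>" "\<And>x. \<mu> \<le> \<omega> x" "\<And>x. \<omega> x \<le> U"
    using periodic_bounded[OF c\<omega> \<omega>per pi_gt_zero] by blast
  have b0: "b > 0" and \<mu>0: "\<mu> > 0" using b(1) \<mu>(1) pos by (auto simp: \<omega>_def)
  define P where "P = integral {0..pi} (\<lambda>x. a x * \<omega> x)"
  have P: "integral {\<alpha>..\<alpha>+pi} (\<lambda>x. a x * \<omega> x) = P" for \<alpha>
    unfolding P_def by (rule integral_period_shift) (auto intro!: continuous_intros ca c\<omega> simp: a a''per \<omega>_def)
  have P0: "P \<ge> 0" unfolding P_def
    by (rule integral_nonneg) (use pos in \<open>auto intro!: integrable_continuous_real continuous_intros ca c\<omega> mult_nonneg_nonneg less_imp_le simp: \<omega>_def\<close>)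
  define C where "C = P + pi * M\<^sup>2"
  have "M > 0" using b0 b(2)[of 0] b(3)[of 0] by simp
  then have C0: "C > 0" using P0 by (simp add: C_def add_nonneg_pos)
  define \<delta> where "\<delta> = min (pi / 2) (b\<^sup>2 / (4 * C))"
  have \<delta>: "\<delta> > 0" "\<delta> \<le> pi / 2" using C0 b0 by (auto simp: \<delta>_def)
  have "\<delta> \<le> b\<^sup>2 / (4 * C)" by (simp add: \<delta>_def)
  then have \<delta>3: "4 * \<delta> * (P + pi * M\<^sup>2) \<le> b\<^sup>2" using C0 by (simp add: C_def[symmetric] field_simps)
  define c where "c = 3/8 * b * \<mu> * \<delta>"
  have c0: "c > 0" using b0 \<mu>0 \<delta> by (simp add: c_def)
  show ?thesis
  proof (rule that[of "c / 2"])
    show "c / 2 > 0" using c0 by simp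
    fix h h' h'' S l
    assume h: "\<And>x. (h has_real_derivative h' x) (at x)" "\<And>x. (h' has_real_derivative h'' x) (at x)"
       "continuous_on UNIV h''" "\<And>x. h (x + 2 * pi) = h x" and \<rho>: "\<And>x. h x + h'' x > 0"
     and hS: "((\<lambda>x. h x * (h x + h'' x)) has_integral 2 * S) {0..2*pi}" and S0: "S > 0"
     and hl: "((\<lambda>x. h x * (a x + a'' x)) has_integral l) {0..2*pi}"
     and hp: "((\<lambda>x. a x * (a x + a'' x)) has_integral 2 * p) {0..2*pi}"
    have per: "a (x + 2 * pi) = a x" "a' (x + 2 * pi) = a' x" "a'' (x + 2 * pi) = a'' x"
      "h' (x + 2 * pi) = h' x" "h'' (x + 2 * pi) = h'' x" for x
    proof -
      have "x + 2 * pi = x + pi + pi" by simp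
      then show "a (x + 2 * pi) = a x" "a' (x + 2 * pi) = a' x" "a'' (x + 2 * pi) = a'' x"
        by (simp_all only: a(4) a'per a''per)
      have *: "h' (x + 2 * pi) = h' x" for x
        using DERIV_unique[OF h(1)[of x]] DERIV_shift[THEN iffD1, OF h(1)[of "x + 2*pi"]] by (simp add: h(4))
      then show "h' (x + 2 * pi) = h' x" .
      show "h'' (x + 2 * pi) = h'' x"
        using DERIV_unique[OF h(2)[of x]] DERIV_shift[THEN iffD1, OF h(2)[of "x + 2*pi"]] by (simp add: *)
    qed
    have ch: "continuous_on A h" "continuous_on A h'" "continuous_on A h''" for A
      by (rule deriv_continuous_on, rule h(1), rule deriv_continuous_on, rule h(2), rule continuous_on_subset[OF h(3) subset_UNIV])
    obtain \<alpha> X Y where bal: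
      "h (\<alpha> + pi) - (X * cos (\<alpha> + pi) + Y * sin (\<alpha> + pi)) = h \<alpha> - (X * cos \<alpha> + Y * sin \<alpha>)"
      "h' (\<alpha> + pi) - (Y * cos (\<alpha> + pi) - X * sin (\<alpha> + pi)) = h' \<alpha> - (Y * cos \<alpha> - X * sin \<alpha>)"
      "integral {\<alpha>..\<alpha>+pi} (\<lambda>x. (h x - (X * cos x + Y * sin x)) * (h x + h'' x)) =
       integral {\<alpha>+pi..\<alpha>+2*pi} (\<lambda>x. (h x - (X * cos x + Y * sin x)) * (h x + h'' x))"
      using area_bisecting_translate[OF h] by blast
    define k where "k = (\<lambda>x. h x - (X * cos x + Y * sin x))"
    define k' where "k' = (\<lambda>x. h' x - (Y * cos x - X * sin x))"
    define k'' where "k'' = (\<lambda>x. h'' x + (X * cos x + Y * sin x))"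
    define \<rho> where "\<rho> = (\<lambda>x. k x + k'' x)"
    have \<rho>h: "h x + h'' x = \<rho> x" for x by (simp add: \<rho>_def k_def k''_def)
    have kd: "(k has_real_derivative k' x) (at x)" "(k' has_real_derivative k'' x) (at x)" for x
      unfolding k_def k'_def k''_def by (auto intro!: derivative_eq_intros h)
    have ck: "continuous_on A k" "continuous_on A k'" "continuous_on A k''" for A
      unfolding k_def k'_def k''_def by (intro continuous_intros ch)+
    have c\<rho>: "continuous_on A \<rho>" for A unfolding \<rho>_def by (intro continuous_intros ck)
    have kper: "k (x + 2 * pi) = k x" "k' (x + 2 * pi) = k' x" "\<rho> (x + 2 * pi) = \<rho> x" "\<omega> (x + 2 * pi) = \<omega> x" for x
      by (simp_all add: k_def k'_def k''_def \<rho>_def \<omega>_def per h)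
    have kbal: "k (\<alpha> + pi) = k \<alpha>" "k' (\<alpha> + pi) = k' \<alpha>" using bal by (auto simp: k_def k'_def)
    have kbal2: "k (\<alpha> + pi + pi) = k (\<alpha> + pi)" "k' (\<alpha> + pi + pi) = k' (\<alpha> + pi)"
      using kbal kper[of \<alpha>] by (simp_all add: algebra_simps)
    define I1 I2 where "I1 = {\<alpha>..\<alpha>+pi}" and "I2 = {\<alpha>+pi..\<alpha>+pi+pi}"
    have halves: "integral {0..2*pi} f = integral I1 f + integral I2 f"
      if "continuous_on UNIV f" "\<And>x. f (x + 2 * pi) = f x" for f :: "real \<Rightarrow> real"
    proof -
      have "integral {0..2*pi} f = integral {\<alpha>..\<alpha> + 2*pi} f"
        by (rule integral_period_shift[symmetric]) (use that in auto)
      also have "\<dots> = integral I1 f + integral I2 f"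
        unfolding I1_def I2_def
        using Henstock_Kurzweil_Integration.integral_combine[of \<alpha> "\<alpha>+pi" "\<alpha>+2*pi" f] that(1)
        by (simp add: integrable_continuous_real continuous_on_subset algebra_simps)
      finally show ?thesis .
    qed
    have \<rho>0: "\<rho> x \<noteq> 0" for x using \<open>\<And>x. h x + h'' x > 0\<close>[of x] by (simp add: \<rho>h)
    \<comment> \<open>Neither the length nor the area depends on the origin.\<close>
    have zero: "((\<lambda>x. (X * cos x + Y * sin x) * (f x + f'' x)) has_integral 0) {0..2*pi}"
      if f: "\<And>x. (f has_real_derivative f' x) (at x)" "\<And>x. (f' has_real_derivative f'' x) (at x)"
        "f (2 * pi) = f 0" "f' (2 * pi) = f' 0" for f f' f''
    proof -
      let ?t = "\<lambda>x. X * cos x + Y * sin x" and ?t' = "\<lambda>x. Y * cos x - X * sin x"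
      have t: "(?t has_real_derivative ?t' x) (at x)" "(?t' has_real_derivative - ?t x) (at x)" for x
        by (auto intro!: derivative_eq_intros)
      have 1: "((\<lambda>x. ?t x * (f x + f'' x) - (?t x * f x - ?t' x * f' x)) has_integral 0) {0..2*pi}"
        by (rule integral_by_parts_period[OF t(1) f(2)]) (use f in auto)
      have 2: "((\<lambda>x. f x * (?t x + - ?t x) - (f x * ?t x - f' x * ?t' x)) has_integral 0) {0..2*pi}"
        by (rule integral_by_parts_period[OF f(1) t(2)]) (use f in auto)
      show ?thesis using has_integral_diff[OF 1 2] by (simp add: algebra_simps)
    qed
    have kS: "((\<lambda>x. k x * \<rho> x) has_integral 2 * S) {0..2*pi}"
      using has_integral_diff[OF hS zero[OF h(1,2)]] h(4)[of 0] per(4)[of 0]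
      by (simp add: \<rho>h[symmetric] k_def left_diff_distrib)
    have kl: "((\<lambda>x. k x * \<omega> x) has_integral l) {0..2*pi}"
      using has_integral_diff[OF hl zero[OF a(1,2)]] per(1,2)[of 0]
      by (simp add: \<omega>_def k_def left_diff_distrib)
    have S: "integral I1 (\<lambda>x. k x * \<rho> x) = S" "integral I2 (\<lambda>x. k x * \<rho> x) = S"
    proof -
      have "integral I1 (\<lambda>x. k x * \<rho> x) = integral I2 (\<lambda>x. k x * \<rho> x)"
      proof -
        have e: "\<alpha> + pi + pi = \<alpha> + 2 * pi" by simp
        show ?thesis using bal(3) unfolding I1_def I2_def e \<rho>h k_def .
      qed
      moreover have "2 * S = integral I1 (\<lambda>x. k x * \<rho> x) + integral I2 (\<lambda>x. k x * \<rho> x)"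
        unfolding integral_unique[OF kS, symmetric] by (rule halves) (auto intro!: continuous_intros ck c\<rho> simp: kper)
      ultimately show "integral I1 (\<lambda>x. k x * \<rho> x) = S" "integral I2 (\<lambda>x. k x * \<rho> x) = S" by auto
    qed
    have p: "p = P"
    proof -
      have hp': "((\<lambda>x. a x * \<omega> x) has_integral 2 * p) {0..2*pi}" using hp by (simp add: \<omega>_def)
      have "2 * p = integral I1 (\<lambda>x. a x * \<omega> x) + integral I2 (\<lambda>x. a x * \<omega> x)"
        unfolding integral_unique[OF hp', symmetric]
        by (rule halves) (auto intro!: continuous_intros ca c\<omega> simp: per kper)
      then show ?thesis unfolding I1_def I2_def P by simp
    qed
    define l1 l2 where "l1 = integral I1 (\<lambda>x. k x * \<omega> x)" and "l2 = integral I2 (\<lambda>x. k x * \<omega> x)"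
    have l: "l = l1 + l2" unfolding integral_unique[OF kl, symmetric] l1_def l2_def
      by (rule halves) (auto intro!: continuous_intros ck c\<omega> simp: kper)
    define K1 K2 where "K1 = integral I1 (\<lambda>x. a x * (\<omega> x)\<^sup>2 / \<rho> x)" and "K2 = integral I2 (\<lambda>x. a x * (\<omega> x)\<^sup>2 / \<rho> x)"
    have K: "integral {0..2*pi} (\<lambda>x. a x * (\<omega> x)\<^sup>2 / \<rho> x) = K1 + K2" unfolding K1_def K2_def
      by (rule halves) (use \<rho>0 in \<open>auto intro!: continuous_intros ca c\<rho> c\<omega> simp: kper per\<close>)
    have \<rho>pos: "k x + k'' x > 0" for x using \<open>\<And>x. h x + h'' x > 0\<close>[of x] by (simp add: \<rho>h \<rho>_def)
    have half: "0 < L \<and> P * S \<le> L\<^sup>2 \<and> c * ((L\<^sup>2 - P * S) / (L * S)) \<le> K - P * L / S"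
      if kb: "k (\<beta> + pi) = k \<beta>" "k' (\<beta> + pi) = k' \<beta>"
        and "integral {\<beta>..\<beta>+pi} (\<lambda>x. k x * \<rho> x) = S"
        and "integral {\<beta>..\<beta>+pi} (\<lambda>x. k x * \<omega> x) = L"
        and "integral {\<beta>..\<beta>+pi} (\<lambda>x. a x * (\<omega> x)\<^sup>2 / \<rho> x) = K" for \<beta> L K
    proof -
      note vals = P[of \<beta>, unfolded \<omega>_def] that(3-5)[unfolded \<omega>_def \<rho>_def]
      note g = gage_half_period[of a a' a'' \<beta> b M \<mu> k k' k'' \<delta>, unfolded vals, folded c_def]
      note \<mu>' = \<mu>[unfolded \<omega>_def]
      show ?thesis
        by (intro conjI; rule g) (use a a'per b b0 \<mu>' \<mu>0 kd ck kb \<rho>pos S0 \<delta> \<delta>3 in simp_all)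
    qed
    have "0 < l1 \<and> P * S \<le> l1\<^sup>2 \<and> c * ((l1\<^sup>2 - P * S) / (l1 * S)) \<le> K1 - P * l1 / S"
      by (rule half[OF kbal]) (simp_all only: S[unfolded I1_def] l1_def K1_def I1_def)
    then have G1: "l1 > 0" "P * S \<le> l1\<^sup>2" "c * ((l1\<^sup>2 - P * S) / (l1 * S)) \<le> K1 - P * l1 / S" by auto
    have "0 < l2 \<and> P * S \<le> l2\<^sup>2 \<and> c * ((l2\<^sup>2 - P * S) / (l2 * S)) \<le> K2 - P * l2 / S"
      by (rule half[OF kbal2]) (simp_all only: S[unfolded I2_def] l2_def K2_def I2_def)
    then have G2: "l2 > 0" "P * S \<le> l2\<^sup>2" "c * ((l2\<^sup>2 - P * S) / (l2 * S)) \<le> K2 - P * l2 / S" by auto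
    have q0: "P * S > 0"
    proof -
      have "P \<noteq> 0"
      proof
        assume "P = 0"
        then have "integral {0..pi} (\<lambda>x. a x * \<omega> x) = 0" by (simp add: P_def)
        then have "\<forall>x\<in>{0..pi}. a x * \<omega> x = 0"
          by (subst (asm) integral_eq_0_iff)
            (auto intro!: continuous_intros ca c\<omega> mult_nonneg_nonneg simp: \<omega>_def pos less_imp_le)
        then have "a 0 * \<omega> 0 = 0" by simp
        then show False using pos[of 0] by (simp add: \<omega>_def)
      qed
      then show ?thesis using P0 S0 by simp
    qed
    note arith = deficit_of_two_halves[OF G1(1) G2(1) q0 G1(2) G2(2), folded l]
    have l0: "l > 0" using G1(1) G2(1) l by simp
    have "c / 2 * ((l\<^sup>2 - 4 * P * S) / (l * S)) = c / S * ((l\<^sup>2 - 4 * (P * S)) / (2 * l))"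
      using l0 S0 by (simp add: field_simps)
    also have "\<dots> \<le> c / S * ((l1\<^sup>2 - P * S) / l1 + (l2\<^sup>2 - P * S) / l2)"
      using arith(2) c0 S0 by (intro mult_left_mono) auto
    also have "\<dots> = c * ((l1\<^sup>2 - P * S) / (l1 * S)) + c * ((l2\<^sup>2 - P * S) / (l2 * S))"
      using G1(1) G2(1) S0 by (simp add: field_simps)
    also have "\<dots> \<le> (K1 + K2) - P * l / S"
      using G1(3) G2(3) by (simp add: l distrib_left add_divide_distrib)
    finally show "l > 0 \<and> 4 * p * S \<le> l\<^sup>2 \<and> c / 2 * ((l\<^sup>2 - 4 * p * S) / (l * S)) \<le>
        integral {0..2*pi} (\<lambda>x. a x * (a x + a'' x)\<^sup>2 / (h x + h'' x)) - p * l / S"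
      using arith(1) l0 K by (simp add: p \<rho>h \<omega>_def mult.assoc)
  qed
qed

section \<open>The area of a convex body from a boundary parametrisation\<close>

\<comment> \<open>The dollar sign denotes vector components below.\<close>
no_notation fps_nth (infixl "$" 75)

text \<open>
The isometry with \<open>real^2\<close>, where the change of variables is carried out.
\<close>
definition vec2 :: "complex \<Rightarrow> real^2" where
  "vec2 z = vector [Re z, Im z]"

lemma vec2_nth [simp]: "vec2 z $ 1 = Re z" "vec2 z $ 2 = Im z"
  by (simp_all add: vec2_def)

lemma inj_vec2: "inj vec2"
  by (rule injI) (metis complex_eq_iff vec2_nth)

lemma bounded_linear_vec2: "bounded_linear vec2"
proof -
  have "linear vec2"
    by (rule linearI) (simp_all add: vec2_def vec_eq_iff forall_2)
  then show ?thesis by (rule linear_conv_bounded_linear[THEN iffD1])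
qed

text \<open>
Boxes correspond to boxes of the same content, so gauge integrals, in particular those of indicator
functions, are transported unchanged.
\<close>
lemma measure_vec2_image:
  assumes "compact S"
  shows "measure lebesgue (vec2 ` S) = measure lebesgue S"
proof -
  define g :: "real^2 \<Rightarrow> complex" where "g = (\<lambda>x. Complex (x$1) (x$2))"
  have vg: "vec2 (g x) = x" for x by (simp add: g_def vec_eq_iff forall_2)
  have gv: "g (vec2 z) = z" for z by (simp add: g_def)
  have gimage: "g ` cbox u v = cbox (g u) (g v)" for u v
  proof
    show "g ` cbox u v \<subseteq> cbox (g u) (g v)"
      by (auto simp: mem_box_cart forall_2 g_def in_cbox_complex_iff)
    show "cbox (g u) (g v) \<subseteq> g ` cbox u v"
    proof
      fix z assume "z \<in> cbox (g u) (g v)"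
      then have "vec2 z \<in> cbox u v" by (auto simp: mem_box_cart forall_2 g_def in_cbox_complex_iff)
      then show "z \<in> g ` cbox u v" by (metis gv imageI)
    qed
  qed
  have vimage: "vec2 ` cbox u v = cbox (vec2 u) (vec2 v)" for u v
  proof -
    have "vec2 ` cbox u v = vec2 ` (g ` cbox (vec2 u) (vec2 v))" by (simp add: gimage gv)
    then show ?thesis by (simp add: image_image vg)
  qed
  have cg: "continuous (at x) g" for x
  proof -
    have "linear g" by (rule linearI) (simp_all add: g_def complex_eq_iff)
    then show ?thesis by (simp add: linear_continuous_at linear_conv_bounded_linear)
  qed
  have content: "measure lborel (g ` cbox u v) = 1 * measure lborel (cbox u v)" for u v :: "real^2"
  proof (cases "cbox u v = {}")
    case False
    then have "cbox (g u) (g v) \<noteq> {}" using gimage[of u v] by (metis image_is_empty)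
    then have "measure lborel (cbox (g u) (g v)) = (v$1 - u$1) * (v$2 - u$2)"
      by (subst content_cbox') (simp_all add: Basis_complex_def g_def)
    moreover have "measure lborel (cbox u v) = (v$1 - u$1) * (v$2 - u$2)"
      using False by (subst content_cbox_cart) (simp_all add: UNIV_2)
    ultimately show ?thesis by (simp add: gimage)
  qed simp
  obtain a b where ab: "S \<subseteq> cbox a b"
    using bounded_subset_cbox_symmetric compact_imp_bounded[OF assms] by metis
  have S: "((\<lambda>x. 1) has_integral measure lebesgue S) S"
    using lmeasurable_compact[OF assms] lmeasurable_iff_integrable_on lmeasure_integral
    by (metis integrable_integral)
  have "((\<lambda>z. if z \<in> S then 1 else 0) has_integral measure lebesgue S) (cbox a b)"
    using S ab by (subst has_integral_restrict) auto
  moreover have "\<exists>w z. g ` cbox u v = cbox w z" "\<exists>w z. vec2 ` cbox u' v' = cbox w z" for u v u' v'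
    using gimage vimage by blast+
  ultimately have "((\<lambda>x. if g x \<in> S then 1 else 0) has_integral (1 / 1) *\<^sub>R measure lebesgue S) (vec2 ` cbox a b)"
    by (intro has_integral_twiddle[OF _ vg gv cg _ _ content]) auto
  then
  have "((\<lambda>x. if g x \<in> S then 1 else 0) has_integral measure lebesgue S) (vec2 ` cbox a b)"
    by simp
  moreover have "(\<lambda>x. if g x \<in> S then 1 else 0 :: real) = (\<lambda>x. if x \<in> vec2 ` S then 1 else 0)"
    using gv vg by (auto simp: fun_eq_iff image_iff) metis+
  ultimately have "((\<lambda>x. if x \<in> vec2 ` S then 1 else 0) has_integral measure lebesgue S) (vec2 ` cbox a b)"
    by simp
  then have "((\<lambda>x. 1) has_integral measure lebesgue S) (vec2 ` S)"
    using ab by (subst (asm) has_integral_restrict) auto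
  moreover have "vec2 ` S \<in> lmeasurable"
    by (intro lmeasurable_compact compact_continuous_image assms
        linear_continuous_on bounded_linear_vec2)
  ultimately show ?thesis by (simp add: lmeasure_integral integral_unique)
qed

text \<open>
Fubini on \<open>real^2\<close>, by transport to the product type.
\<close>
lemma integral_product_square:
  fixes f g :: "real \<Rightarrow> real"
  assumes f: "continuous_on {0..1} f" and g: "continuous_on {0..1} g"
  shows "((\<lambda>x::real^2. f (x$1) * g (x$2)) has_integral (integral {0..1} f * integral {0..1} g)) (cbox 0 1)"
proof -
  define p :: "real^2 \<Rightarrow> real \<times> real" where "p = (\<lambda>x. (x$1, x$2))"
  define q :: "real \<times> real \<Rightarrow> real^2" where "q = (\<lambda>z. vector [fst z, snd z])"
  have qp: "q (p x) = x" for x by (simp add: p_def q_def vec_eq_iff forall_2)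
  have pq: "p (q z) = z" for z by (simp add: p_def q_def)
  have pimage: "p ` cbox u v = cbox (p u) (p v)" for u v
  proof
    show "p ` cbox u v \<subseteq> cbox (p u) (p v)"
      by (auto simp: mem_box_cart forall_2 p_def cbox_Pair_eq)
    show "cbox (p u) (p v) \<subseteq> p ` cbox u v"
    proof
      fix z assume "z \<in> cbox (p u) (p v)"
      then have "q z \<in> cbox u v" by (auto simp: mem_box_cart forall_2 p_def q_def cbox_Pair_eq)
      then show "z \<in> p ` cbox u v" by (metis pq imageI)
    qed
  qed
  have qimage: "q ` cbox u v = cbox (q u) (q v)" for u v
  proof -
    have "q ` cbox u v = q ` (p ` cbox (q u) (q v))" by (simp add: pimage pq)
    then show ?thesis by (simp add: image_image qp)
  qed
  have cp: "continuous (at x) p" for x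
    unfolding p_def by (intro continuous_intros)
  have content: "measure lborel (p ` cbox u v) = 1 * measure lborel (cbox u v)" for u v :: "real^2"
  proof (cases "cbox u v = {}")
    case False
    then have "u$1 \<le> v$1" "u$2 \<le> v$2" by (auto simp: interval_ne_empty_cart forall_2)
    then have "measure lborel (cbox (p u) (p v)) = (v$1 - u$1) * (v$2 - u$2)"
      by (simp add: p_def content_Pair)
    moreover have "measure lborel (cbox u v) = (v$1 - u$1) * (v$2 - u$2)"
      using False by (subst content_cbox_cart) (simp_all add: UNIV_2)
    ultimately show ?thesis by (simp add: pimage)
  qed simp
  have cont: "continuous_on (cbox (0,0) (1,1)) (\<lambda>z. f (fst z) * g (snd z))"
    by (intro continuous_intros continuous_on_compose2[OF f] continuous_on_compose2[OF g])
      (auto simp: cbox_Pair_eq)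
  have "integral (cbox (0,0) (1,1)) (\<lambda>z. f (fst z) * g (snd z)) = integral {0..1} f * integral {0..1} g"
    using integral_prod_continuous[OF cont] by simp
  then have "((\<lambda>z. f (fst z) * g (snd z)) has_integral (integral {0..1} f * integral {0..1} g)) (cbox (0,0) (1,1))"
    using integrable_continuous[OF cont] by (simp add: has_integral_iff)
  moreover have "\<exists>w z. p ` cbox u v = cbox w z" "\<exists>w z. q ` cbox u' v' = cbox w z" for u v u' v'
    using pimage qimage by blast+
  ultimately have "((\<lambda>x. f (fst (p x)) * g (snd (p x))) has_integral (1 / 1) *\<^sub>R (integral {0..1} f * integral {0..1} g)) (q ` cbox (0,0) (1,1))"
    by (intro has_integral_twiddle[OF _ qp pq cp _ _ content]) auto
  then
  have "((\<lambda>x. f (fst (p x)) * g (snd (p x))) has_integral (integral {0..1} f * integral {0..1} g)) (q ` cbox (0,0) (1,1))"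
    by simp
  moreover have "q ` cbox (0,0) (1,1) = cbox 0 1"
  proof -
    have "q (0,0) = 0" "q (1,1) = 1" by (simp_all add: q_def vec_eq_iff forall_2)
    then show ?thesis unfolding qimage by simp
  qed
  ultimately show ?thesis by (simp add: p_def)
qed

text \<open>
The segments from the interior point \<open>z\<close> to the points \<open>c u\<close> of the frontier fill the body, and only
\<open>z\<close> lies on more than one of them.  In the coordinates \<open>(s, u)\<close> of the point \<open>z + s (c u - z)\<close> the
Jacobian is \<open>s det2 (c u - z) (c' u)\<close>, and \<open>s\<close> contributes the factor \<open>1/2\<close>.
\<close>
lemma area_of_convex_body:
  fixes c c' :: "real \<Rightarrow> complex"
  assumes K: "compact K" "convex K" and z: "z \<in> interior K"
    and c: "\<And>u. (c has_vector_derivative c' u) (at u)" "continuous_on UNIV c'"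
    and inj: "inj_on c {0..<1}" and front: "c ` {0..<1} = frontier K"
    and nonneg: "\<And>u. det2 (c u - z) (c' u) \<ge> 0"
  shows "measure lebesgue K = integral {0..1} (\<lambda>u. det2 (c u - z) (c' u)) / 2"
proof -
  define D where "D = (\<lambda>u. det2 (c u - z) (c' u))"
  have cc: "continuous_on A c" for A
    using c(1) by (meson continuous_at_imp_continuous_on has_vector_derivative_continuous)
  have cc': "continuous_on A c'" for A using c(2) continuous_on_subset by blast
  have cD: "continuous_on A D" for A
    unfolding D_def det2_def by (intro continuous_intros cc cc')
  define \<Phi> where "\<Phi> = (\<lambda>x::real^2. z + (x$1) *\<^sub>R (c (x$2) - z))"
  define \<Phi>' where "\<Phi>' = (\<lambda>(x::real^2) (h::real^2). (h$1) *\<^sub>R (c (x$2) - z) + (x$1 * h$2) *\<^sub>R c' (x$2))"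
  \<comment> \<open>Half-open in both coordinates, so that \<open>z\<close> is left out and \<open>c 0 = c 1\<close> is counted once.\<close>
  define S where "S = {x::real^2. 0 < x$1} \<inter> {x. x$1 \<le> 1} \<inter> {x. 0 \<le> x$2} \<inter> {x. x$2 < 1}"
  have frontK: "c u \<in> frontier K" if "u \<in> {0..<1}" for u using front that by blast
  have clK: "closure K = K" "frontier K \<subseteq> K"
    using K(1) by (auto simp: compact_imp_closed frontier_subset_closed)
  have not_front: "w \<notin> interior K" if "w \<in> frontier K" for w
    using that by (simp add: frontier_def)
  have seg: "z + t *\<^sub>R (w - z) \<in> interior K" if "w \<in> K" "w \<noteq> z" "0 < t" "t < 1" for w t
  proof -
    have "z + t *\<^sub>R (w - z) \<in> open_segment z w"
      using that by (auto simp: in_segment algebra_simps intro!: exI[of _ t])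
    then show ?thesis using in_interior_closure_convex_segment[OF K(2) z, of w] clK that by auto
  qed
  have S: "S \<in> sets lebesgue"
    unfolding S_def
    by (intro sets.Int sets_completionI_sets)
      (auto intro: borel_open borel_closed open_halfspace_component_gt_cart open_halfspace_component_lt_cart
         closed_halfspace_component_le_cart closed_halfspace_component_ge_cart)
  have \<Phi>d: "(\<Phi> has_derivative \<Phi>' x) (at x within S)" if "x \<in> S" for x
  proof -
    have c_d: "(c has_derivative (\<lambda>h. h *\<^sub>R c' u)) (at u)" for u
      using c(1)[of u] by (simp add: has_vector_derivative_def)
    have "((\<lambda>x::real^2. c (x$2)) has_derivative (\<lambda>h. (h$2) *\<^sub>R c' (x$2))) (at x within S)"
      by (rule has_derivative_in_compose2[where t = UNIV and g = c and f = "\<lambda>x::real^2. x$2"])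
        (auto intro!: derivative_eq_intros c_d bounded_linear_imp_has_derivative bounded_linear_vec_nth that)
    then show ?thesis
      unfolding \<Phi>_def \<Phi>'_def
      by (auto intro!: derivative_eq_intros bounded_linear_imp_has_derivative[OF bounded_linear_vec_nth]
         simp: algebra_simps)
  qed
  have det: "det (matrix (\<lambda>h. vec2 (\<Phi>' x h))) = x$1 * D (x$2)" for x
    by (simp add: det_2 matrix_def \<Phi>'_def D_def det2_def axis_def algebra_simps)
  have inj\<Phi>: "inj_on \<Phi> S"
  proof (rule inj_onI)
    fix x y assume xy: "x \<in> S" "y \<in> S" "\<Phi> x = \<Phi> y"
    have le: "\<not> x$1 < y$1" if xy: "x \<in> S" "y \<in> S" "\<Phi> x = \<Phi> y" for x y :: "real^2"
    proof
      assume lt: "x$1 < y$1"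
      let ?t = "x$1 / y$1"
      have t: "0 < ?t" "?t < 1" using lt xy by (auto simp: S_def)
      have "c (y$2) - z = (1 / y$1) *\<^sub>R (x$1 *\<^sub>R (c (x$2) - z))"
        using xy by (simp add: \<Phi>_def S_def)
      then have "c (y$2) = z + ?t *\<^sub>R (c (x$2) - z)" by (simp add: algebra_simps)
      moreover have "c (x$2) \<noteq> z" using not_front[OF frontK[of "x$2"]] z xy by (auto simp: S_def)
      moreover have "c (x$2) \<in> K" using clK frontK[of "x$2"] xy by (auto simp: S_def)
      ultimately have "c (y$2) \<in> interior K" using seg t by metis
      then show False using not_front frontK[of "y$2"] xy by (auto simp: S_def)
    qed
    have e: "x$1 = y$1" using le[OF xy] le[OF xy(2,1)] xy(3) by simp
    then have "c (x$2) = c (y$2)" using xy by (simp add: \<Phi>_def S_def)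
    then have "x$2 = y$2" using inj xy by (auto simp: S_def inj_on_def)
    with e show "x = y" by (simp add: vec_eq_iff forall_2)
  qed
  have img: "\<Phi> ` S = K - {z}"
  proof
    show "\<Phi> ` S \<subseteq> K - {z}"
    proof
      fix w assume "w \<in> \<Phi> ` S"
      then obtain x where x: "x \<in> S" "w = \<Phi> x" by blast
      have cK: "c (x$2) \<in> K" using clK frontK[of "x$2"] x by (auto simp: S_def)
      have "w = (1 - x$1) *\<^sub>R z + (x$1) *\<^sub>R c (x$2)" by (simp add: x \<Phi>_def algebra_simps)
      then have "w \<in> K"
        using convexD_alt[OF K(2) _ cK, of z "x$1"] z interior_subset x by (auto simp: S_def)
      moreover have "c (x$2) \<noteq> z" using not_front[OF frontK[of "x$2"]] z x by (auto simp: S_def)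
      then have "w \<noteq> z" using x by (auto simp: \<Phi>_def S_def)
      ultimately show "w \<in> K - {z}" by simp
    qed
    show "K - {z} \<subseteq> \<Phi> ` S"
    proof
      fix w assume w: "w \<in> K - {z}"
      obtain d where d: "0 < d" "z + d *\<^sub>R (w - z) \<in> frontier K"
        using ray_to_frontier[OF compact_imp_bounded[OF K(1)] z, of "w - z"] w by auto
      have d1: "d \<ge> 1"
        using seg[of w d] not_front[OF d(2)] w d(1) by force
      obtain u where u: "u \<in> {0..<1}" "c u = z + d *\<^sub>R (w - z)" using d(2) front by (metis imageE)
      have "vector [1/d, u] \<in> S" using d1 u by (simp add: S_def)
      moreover have "\<Phi> (vector [1/d, u]) = w" using d1 by (simp add: \<Phi>_def u)
      ultimately show "w \<in> \<Phi> ` S" by (metis imageI)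
    qed
  qed
  have int: "((\<lambda>x::real^2. x$1 * D (x$2)) has_integral (integral {0..1} (\<lambda>s::real. s) * integral {0..1} D)) S"
  proof (rule has_integral_spike_set_eq[THEN iffD1, OF _ _ integral_product_square[OF continuous_on_id cD]])
    have "negligible {x::real^2. x$1 = 0}" "negligible {x::real^2. x$2 = 1}"
      using negligible_standard_hyperplane[of "axis 1 1 :: real^2" 0] negligible_standard_hyperplane[of "axis 2 1 :: real^2" 1]
      by (auto simp: inner_axis axis_in_Basis_iff)
    then have neg: "negligible ({x::real^2. x$1 = 0} \<union> {x. x$2 = 1})" by (rule negligible_Un)
    show "negligible {x \<in> cbox 0 1 - S. x$1 * D (x$2) \<noteq> 0}"
      by (rule negligible_subset[OF neg]) (auto simp: S_def mem_box_cart forall_2)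
    show "negligible {x \<in> S - cbox 0 1. x$1 * D (x$2) \<noteq> 0}"
      by (rule negligible_subset[OF neg]) (auto simp: S_def mem_box_cart forall_2)
  qed
  have half: "integral {0..1} (\<lambda>s::real. s) = 1/2"
    using ident_has_integral[of 0 "1::real"] by (simp add: integral_unique)
  have abs: "\<bar>det (matrix (\<lambda>h. vec2 (\<Phi>' x h)))\<bar> = x$1 * D (x$2)" if "x \<in> S" for x
    using that nonneg[of "x$2"] by (simp add: det S_def D_def)
  have "measure lebesgue ((\<lambda>x. vec2 (\<Phi> x)) ` S) = integral S (\<lambda>x. \<bar>det (matrix (\<lambda>h. vec2 (\<Phi>' x h)))\<bar>)"
  proof (rule measure_differentiable_image_eq[OF S])
    show "((\<lambda>x. vec2 (\<Phi> x)) has_derivative (\<lambda>h. vec2 (\<Phi>' x h))) (at x within S)" if "x \<in> S" for x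
      by (rule bounded_linear.has_derivative[OF bounded_linear_vec2 \<Phi>d[OF that]])
    show "inj_on (\<lambda>x. vec2 (\<Phi> x)) S"
      using inj\<Phi> inj_vec2 by (auto simp: inj_on_def)
    have "(\<lambda>x. x$1 * D (x$2)) integrable_on S" using int by blast
    then show "(\<lambda>x. \<bar>det (matrix (\<lambda>h. vec2 (\<Phi>' x h)))\<bar>) integrable_on S"
      by (rule integrable_eq) (simp add: abs)
  qed
  also have "\<dots> = integral S (\<lambda>x. x$1 * D (x$2))" by (rule integral_cong) (rule abs)
  also have "\<dots> = integral {0..1} D / 2" using int half by (simp add: integral_unique)
  finally have m: "measure lebesgue ((\<lambda>x. vec2 (\<Phi> x)) ` S) = integral {0..1} D / 2" .
  have "(\<lambda>x. vec2 (\<Phi> x)) ` S = vec2 ` (\<Phi> ` S)" by (rule image_image[symmetric])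
  also have "\<dots> = vec2 ` K - vec2 ` {z}" unfolding img by (rule image_set_diff[OF inj_vec2])
  finally have "(\<lambda>x. vec2 (\<Phi> x)) ` S = vec2 ` K - {vec2 z}" by (simp only: image_insert image_empty)
  moreover have "measure lebesgue (vec2 ` K) = measure lebesgue (vec2 ` K - {vec2 z})"
  proof (rule measure_negligible_symdiff)
    have "vec2 ` K \<in> lmeasurable"
      by (intro lmeasurable_compact compact_continuous_image K linear_continuous_on bounded_linear_vec2)
    then show "vec2 ` K - {vec2 z} \<in> lmeasurable" by (intro fmeasurable.Diff) (auto intro: lmeasurable_compact)
    show "negligible (vec2 ` K - {vec2 z} - vec2 ` K \<union> (vec2 ` K - (vec2 ` K - {vec2 z})))"
      by (rule negligible_subset[of "{vec2 z}"]) auto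
  qed
  ultimately have "measure lebesgue (vec2 ` K) = integral {0..1} D / 2" using m by simp
  then show ?thesis using measure_vec2_image[OF K(1)] by (simp add: D_def)
qed

section \<open>The moving frame and strict convexity\<close>

lemma inner_e_r: "x \<bullet> e_r \<theta> = Re x * cos \<theta> + Im x * sin \<theta>"
  by (simp add: inner_complex_def e_r_def)

lemma inner_e_th: "x \<bullet> e_th \<theta> = - Re x * sin \<theta> + Im x * cos \<theta>"
  by (simp add: inner_complex_def e_th_def)

lemma det2_e_th: "det2 x (r *\<^sub>R e_th \<theta>) = r * (x \<bullet> e_r \<theta>)"
  by (simp add: det2_def e_th_def inner_e_r algebra_simps)

lemma frame_inner [simp]: "e_r \<theta> \<bullet> e_r \<theta> = 1" "e_th \<theta> \<bullet> e_r \<theta> = 0" "e_r \<theta> \<bullet> e_th \<theta> = 0" "e_th \<theta> \<bullet> e_th \<theta> = 1"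
  by (auto simp: inner_e_r inner_e_th) (simp_all add: e_r_def e_th_def power2_eq_square[symmetric])

lemma frame_shift: "e_r (\<theta> + pi) = - e_r \<theta>" "e_r (\<theta> + 2 * pi) = e_r \<theta>" "e_th (\<theta> + 2 * pi) = e_th \<theta>"
  by (simp_all add: e_r_def e_th_def complex_eq_iff cos_add sin_add)

lemma e_r_deriv: "(e_r has_vector_derivative e_th \<theta>) (at \<theta>)"
  unfolding e_r_def[abs_def] e_th_def has_vector_derivative_complex_iff
  by (auto intro!: derivative_eq_intros)

lemma e_th_deriv: "(e_th has_vector_derivative - e_r \<theta>) (at \<theta>)"
  unfolding e_r_def e_th_def[abs_def] has_vector_derivative_complex_iff
  by (auto intro!: derivative_eq_intros)

lemma norm_e_th [simp]: "norm (e_th \<theta>) = 1"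
  by (simp add: norm_eq_sqrt_inner)

lemma strictly_convex_imp_convex:
  assumes "strictly_convex S" shows "convex S"
proof (rule convexI)
  fix x y and u v :: real assume a: "x \<in> S" "y \<in> S" "0 \<le> u" "0 \<le> v" "u + v = 1"
  show "u *\<^sub>R x + v *\<^sub>R y \<in> S"
  proof (cases "x = y \<or> u = 0 \<or> v = 0")
    case True then show ?thesis using a by (auto simp: scaleR_add_left[symmetric])
  next
    case False
    then have "u *\<^sub>R x + v *\<^sub>R y \<in> open_segment x y"
      using a by (auto simp: in_segment intro!: exI[of _ v])
    then show ?thesis using assms a False interior_subset unfolding strictly_convex_def by blast
  qed
qed

lemma smooth_on_line_derivs:
  fixes f :: "real \<Rightarrow> real"
  assumes "smooth_on f UNIV"
  shows "(f has_real_derivative deriv f x) (at x)"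
    "(deriv f has_real_derivative deriv (deriv f) x) (at x)"
    "continuous_on UNIV (deriv (deriv f))"
proof -
  have "Ck_on (Suc (Suc 0)) f UNIV" using assms unfolding smooth_on_def by blast
  from Ck_on.simps(2)[THEN iffD1, OF this]
  obtain f' where f': "\<And>x. (f has_derivative f' x) (at x)" "Ck_on (Suc 0) (\<lambda>x. f' x 1) UNIV"
    by blast
  from Ck_on.simps(2)[THEN iffD1, OF f'(2)]
  obtain f'' where f'': "\<And>x. ((\<lambda>x. f' x 1) has_derivative f'' x) (at x)" "continuous_on UNIV (\<lambda>x. f'' x 1)"
    unfolding Ck_on.simps(1) by blast
  have real: "(g has_real_derivative g' 1) (at x)" if g: "(g has_derivative g') (at x)" for g g' and x :: real
  proof -
    have "g' = (*) (g' 1)"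
    proof -
      have "g' h = h * g' 1" for h
        using linear_cmul[OF has_derivative_linear[OF g], of h 1] unfolding real_scaleR_def mult_1_right .
      then show ?thesis by (intro ext) (rule trans[OF _ mult.commute])
    qed
    then show ?thesis unfolding has_field_derivative_def using g by simp
  qed
  have d1: "deriv f = (\<lambda>x. f' x 1)"
    by (rule ext, rule DERIV_imp_deriv, rule real, rule f'(1))
  have d2: "deriv (deriv f) = (\<lambda>x. f'' x 1)"
    unfolding d1 by (rule ext, rule DERIV_imp_deriv, rule real, rule f''(1))
  show "(f has_real_derivative deriv f x) (at x)"
    unfolding d1 by (rule real, rule f'(1))
  show "(deriv f has_real_derivative deriv (deriv f) x) (at x)"
    unfolding d2 unfolding d1 by (rule real, rule f''(1))
  show "continuous_on UNIV (deriv (deriv f))"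
    unfolding d2 by (rule f''(2))
qed

lemma interior_inner_less:
  assumes "z \<in> interior K" "\<And>x. x \<in> K \<Longrightarrow> x \<bullet> e_r \<theta> \<le> m"
  shows "z \<bullet> e_r \<theta> < m"
proof -
  obtain e where e: "e > 0" "cball z e \<subseteq> K" using assms(1) by (auto simp: mem_interior_cball)
  have "norm (e_r \<theta>) = 1" by (simp add: norm_eq_sqrt_inner)
  then have "z + e *\<^sub>R e_r \<theta> \<in> K" using e by (auto simp: dist_norm subset_iff)
  from assms(2)[OF this] show ?thesis using e by (simp add: inner_add_left)
qed

section \<open>The unit ball\<close>

text \<open>
The unit ball \<open>P\<close> with its support function \<open>a\<close> and the radius of curvature \<open>\<omega>\<close> of its boundary.
\<close>
locale minkowski_plane =
  fixes P :: "complex set"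
  assumes ball: "minkowski_ball P"
begin

definition a where "a = support_fun P"
definition a' where "a' = deriv a"
definition a'' where "a'' = deriv a'"
definition \<omega> where "\<omega> x = a x + a'' x"

lemma a_smooth: "smooth_on (support_fun P) UNIV"
  using ball unfolding minkowski_ball_def by blast

lemma a_deriv: "(a has_real_derivative a' x) (at x)" and a'_deriv: "(a' has_real_derivative a'' x) (at x)"
  and a''_cont: "continuous_on UNIV a''"
  unfolding a_def a'_def a''_def by (rule smooth_on_line_derivs[OF a_smooth])+

lemma \<omega>_pos: "\<omega> x > 0"
  using ball unfolding minkowski_ball_def \<omega>_def a_def a'_def a''_def by blast

lemma P_compact: "compact P"
  using ball unfolding minkowski_ball_def by blast

lemma P_strictly_convex: "strictly_convex P"
  using ball unfolding minkowski_ball_def by blast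

lemma P_sym: "x \<in> P \<Longrightarrow> - x \<in> P"
  using ball unfolding minkowski_ball_def by blast

lemma P_frontier: "frontier P = range (p_curve P)"
  using ball unfolding minkowski_ball_def by blast

lemma p_eq: "p_curve P \<theta> = a \<theta> *\<^sub>R e_r \<theta> + a' \<theta> *\<^sub>R e_th \<theta>"
  by (simp add: p_curve_def a_def a'_def)

lemma p_deriv: "(p_curve P has_vector_derivative \<omega> \<theta> *\<^sub>R e_th \<theta>) (at \<theta>)"
proof -
  have "((\<lambda>\<theta>. a \<theta> *\<^sub>R e_r \<theta> + a' \<theta> *\<^sub>R e_th \<theta>) has_vector_derivative
     ((a \<theta> *\<^sub>R e_th \<theta> + a' \<theta> *\<^sub>R e_r \<theta>) + (a' \<theta> *\<^sub>R - e_r \<theta> + a'' \<theta> *\<^sub>R e_th \<theta>))) (at \<theta>)"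
    by (intro has_vector_derivative_add has_vector_derivative_scaleR e_r_deriv e_th_deriv a_deriv a'_deriv)
  moreover have "p_curve P = (\<lambda>\<theta>. a \<theta> *\<^sub>R e_r \<theta> + a' \<theta> *\<^sub>R e_th \<theta>)" by (rule ext) (rule p_eq)
  ultimately show ?thesis by (simp add: \<omega>_def scaleR_add_left add.commute)
qed

lemma p_deriv_eq: "p_deriv P \<theta> = \<omega> \<theta> *\<^sub>R e_th \<theta>"
  unfolding p_deriv_def by (rule vector_derivative_at[OF p_deriv])

lemma p_inner: "p_curve P \<theta> \<bullet> e_r \<theta> = a \<theta>" "p_curve P \<theta> \<bullet> e_th \<theta> = a' \<theta>"
  by (simp_all add: p_eq inner_add_left)

lemma det_p: "det2 (p_curve P \<theta>) (p_deriv P \<theta>) = a \<theta> * \<omega> \<theta>"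
  by (simp add: p_deriv_eq det2_e_th p_inner)

lemma a_shift_pi: "a (\<theta> + pi) = a \<theta>"
proof -
  have "uminus ` P \<subseteq> P" by (rule image_subsetI) (rule P_sym)
  moreover have "P \<subseteq> uminus ` P"
  proof (rule subsetI)
    fix x assume "x \<in> P"
    then have "- (- x) \<in> uminus ` P" by (intro imageI P_sym)
    then show "x \<in> uminus ` P" by (simp only: minus_minus)
  qed
  ultimately have P: "P = uminus ` P" by (rule subset_antisym[rotated])
  have "(\<lambda>x. x \<bullet> e_r (\<theta> + pi)) ` P = (\<lambda>x. x \<bullet> e_r \<theta>) ` P"
  proof -
    have "(\<lambda>x. x \<bullet> e_r (\<theta> + pi)) ` P = (\<lambda>x. x \<bullet> e_r \<theta>) ` (uminus ` P)"
      unfolding image_image frame_shift by simp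
    then show ?thesis by (simp only: P[symmetric])
  qed
  then show ?thesis by (simp add: a_def support_fun_def)
qed

lemma P_inner_le: "x \<in> P \<Longrightarrow> x \<bullet> e_r \<theta> \<le> a \<theta>"
proof -
  have "compact ((\<lambda>x. x \<bullet> e_r \<theta>) ` P)"
    by (intro compact_continuous_image P_compact continuous_intros)
  then have "bdd_above ((\<lambda>x. x \<bullet> e_r \<theta>) ` P)"
    by (rule bounded_imp_bdd_above[OF compact_imp_bounded])
  then show "x \<in> P \<Longrightarrow> x \<bullet> e_r \<theta> \<le> a \<theta>"
    unfolding a_def support_fun_def by (rule cSUP_upper[rotated])
qed

lemma p_in_P: "p_curve P \<theta> \<in> P"
  using frontier_subset_closed[OF compact_imp_closed[OF P_compact]] unfolding P_frontier by (rule subsetD) (rule rangeI)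

lemma zero_in_interior: "0 \<in> interior P"
proof -
  have "\<exists>x\<in>P. x \<noteq> 0"
  proof (rule ccontr)
    assume "\<not> ?thesis"
    then have "P \<subseteq> {0}" by blast
    from subset_singletonD[OF this] p_in_P[of 0] have P0: "P = {0}" by auto
    have a0: "a = (\<lambda>x. 0)" unfolding a_def support_fun_def by (simp add: P0)
    have "\<omega> 0 = 0" unfolding \<omega>_def a''_def a'_def a0 by simp
    then show False using \<omega>_pos[of 0] by simp
  qed
  then obtain x where x: "x \<in> P" "x \<noteq> 0" by blast
  have xm: "x \<noteq> - x"
  proof
    assume "x = - x"
    then have "2 *\<^sub>R x = 0" by (simp add: scaleR_2 eq_neg_iff_add_eq_0)
    then show False using x(2) by simp
  qed
  have "open_segment x (- x) \<subseteq> interior P"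
    using P_strictly_convex[unfolded strictly_convex_def, rule_format, OF x(1) P_sym[OF x(1)] xm] .
  moreover have "0 \<in> open_segment x (- x)"
    using xm by (auto simp: in_segment intro!: exI[of _ "1/2"])
  ultimately show ?thesis by blast
qed

lemma a_pos: "a \<theta> > 0"
  using interior_inner_less[OF zero_in_interior P_inner_le] by simp

lemma q_eq: "q_curve P \<theta> = (1 / a \<theta>) *\<^sub>R e_th \<theta>"
  unfolding q_curve_def det_p unfolding p_deriv_eq
  using a_pos[of \<theta>] \<omega>_pos[of \<theta>] by (simp add: divide_inverse)

lemma a_shift_2pi: "a (\<theta> + 2 * pi) = a \<theta>"
  using a_shift_pi[of "\<theta> + pi"] a_shift_pi[of \<theta>] by (simp add: algebra_simps)

lemma a'_shift_2pi: "a' (\<theta> + 2 * pi) = a' \<theta>"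
  using DERIV_unique[OF a_deriv[of \<theta>]] DERIV_shift[THEN iffD1, OF a_deriv[of "\<theta> + 2*pi"]]
  by (simp add: a_shift_2pi)

lemma p_shift_2pi: "p_curve P (\<theta> + 2 * pi) = p_curve P \<theta>"
  by (simp add: p_eq a_shift_2pi a'_shift_2pi frame_shift)

lemma a_cont: "continuous_on A a" "continuous_on A a'" "continuous_on A a''" "continuous_on A \<omega>"
proof -
  show c: "continuous_on A a" "continuous_on A a'" "continuous_on A a''" for A
    by (rule deriv_continuous_on, rule a_deriv, rule deriv_continuous_on, rule a'_deriv,
        rule continuous_on_subset[OF a''_cont subset_UNIV])
  show "continuous_on A \<omega>" unfolding \<omega>_def[abs_def] by (intro continuous_intros c)
qed

text \<open>
If \<open>P\<close> had two supporting lines at one point \<open>x\<close>, the function \<open>w = a - x \<bullet> e_r\<close> and its derivative would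
vanish at both angles.  The derivative of \<open>w' sin (t - \<theta>) - w cos (t - \<theta>)\<close> is \<open>\<omega> sin (t - \<theta>)\<close>,
positive between angles at most \<open>\<pi>\<close> apart, which contradicts equal values at the ends.
\<close>
lemma p_inj:
  assumes "p_curve P \<theta> = p_curve P \<phi>" "\<theta> < \<phi>" "\<phi> \<le> \<theta> + pi"
  shows False
proof -
  define x where "x = p_curve P \<theta>"
  define w where "w = (\<lambda>t. a t - x \<bullet> e_r t)"
  define w' where "w' = (\<lambda>t. a' t - x \<bullet> e_th t)"
  define F where "F = (\<lambda>t. w' t * sin (t - \<theta>) - w t * cos (t - \<theta>))"
  have wd: "(w has_real_derivative w' t) (at t)" for t
    unfolding w_def w'_def inner_e_r inner_e_th by (auto intro!: derivative_eq_intros a_deriv)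
  have w'd: "(w' has_real_derivative (\<omega> t - w t)) (at t)" for t
    unfolding w_def w'_def inner_e_r inner_e_th \<omega>_def by (auto intro!: derivative_eq_intros a'_deriv)
  have Fd: "(F has_real_derivative (\<omega> t * sin (t - \<theta>))) (at t)" for t
    unfolding F_def by (auto intro!: derivative_eq_intros wd w'd simp: algebra_simps)
  have z: "w \<theta> = 0" "w \<phi> = 0" "w' \<phi> = 0"
    using p_inner[of \<theta>] p_inner[of \<phi>] assms(1) by (simp_all add: w_def w'_def x_def)
  have "F \<theta> < F \<phi>"
  proof (rule DERIV_pos_imp_increasing_open[OF assms(2)])
    fix t assume t: "\<theta> < t" "t < \<phi>"
    have "sin (t - \<theta>) > 0" using t assms by (intro sin_gt_zero) auto
    then show "\<exists>y. (F has_real_derivative y) (at t) \<and> y > 0"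
      using Fd[of t] \<omega>_pos[of t] by (intro exI[of _ "\<omega> t * sin (t - \<theta>)"]) simp
  qed (rule deriv_continuous_on[OF Fd])
  then show False by (simp add: F_def z)
qed

lemma p_inj_on: "inj_on (\<lambda>u. p_curve P (2 * pi * u)) {0..<1}"
proof -
  have lt: False if "p_curve P \<theta> = p_curve P \<phi>" "\<theta> < \<phi>" "\<phi> < \<theta> + 2 * pi" for \<theta> \<phi>
  proof (cases "\<phi> \<le> \<theta> + pi")
    case True then show ?thesis using p_inj that by blast
  next
    case False
    then show ?thesis using p_inj[of \<phi> "\<theta> + 2 * pi"] that by (simp add: p_shift_2pi)
  qed
  have no: "\<not> u < v" if "p_curve P (2 * pi * u) = p_curve P (2 * pi * v)" "u \<in> {0..<1}" "v \<in> {0..<1}" for u v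
  proof
    assume "u < v"
    then have 1: "2 * pi * u < 2 * pi * v" by simp
    have "2 * pi * v < 2 * pi * (u + 1)" using that by (intro mult_strict_left_mono) auto
    then have "2 * pi * v < 2 * pi * u + 2 * pi" by (simp add: distrib_left)
    from lt[OF that(1) 1 this] show False .
  qed
  show ?thesis
  proof (rule inj_onI)
    fix u v assume uv: "u \<in> {0..<1}" "v \<in> {0..<1}" "p_curve P (2 * pi * u) = p_curve P (2 * pi * v)"
    show "u = v" using no[OF uv(3,1,2)] no[OF uv(3)[symmetric] uv(2,1)] by simp
  qed
qed

lemma p_range: "(\<lambda>u. p_curve P (2 * pi * u)) ` {0..<1} = frontier P"
proof -
  interpret p: periodic_fun_simple "p_curve P" "2 * pi" by unfold_locales (rule p_shift_2pi)
  have "p_curve P \<theta> \<in> (\<lambda>u. p_curve P (2 * pi * u)) ` {0..<1}" for \<theta>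
  proof
    have "2 * pi * frac (\<theta> / (2 * pi)) = \<theta> - of_int \<lfloor>\<theta> / (2 * pi)\<rfloor> * (2 * pi)"
      by (simp add: frac_def algebra_simps)
    then show "p_curve P \<theta> = p_curve P (2 * pi * frac (\<theta> / (2 * pi)))" by (simp add: p.minus_of_int)
    show "frac (\<theta> / (2 * pi)) \<in> {0..<1}" by (simp add: frac_lt_1)
  qed
  then show ?thesis unfolding P_frontier by auto
qed

lemma area_P: "((\<lambda>x. a x * \<omega> x) has_integral 2 * measure lebesgue P) {0..2*pi}"
proof -
  have "measure lebesgue P = integral {0..1} (\<lambda>u. det2 (p_curve P (2 * pi * u) - 0) ((2 * pi * \<omega> (2 * pi * u)) *\<^sub>R e_th (2 * pi * u))) / 2"
  proof (rule area_of_convex_body[OF P_compact strictly_convex_imp_convex[OF P_strictly_convex] zero_in_interior _ _ p_inj_on p_range])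
    show "((\<lambda>u. p_curve P (2 * pi * u)) has_vector_derivative (2 * pi * \<omega> (2 * pi * u)) *\<^sub>R e_th (2 * pi * u)) (at u)" for u
      using vector_diff_chain_at[of "\<lambda>u. 2 * pi * u" "2 * pi" u "p_curve P", OF _ p_deriv]
      by (simp add: o_def has_real_derivative_iff_has_vector_derivative[symmetric] DERIV_cmult_Id)
    show "continuous_on UNIV (\<lambda>u. (2 * pi * \<omega> (2 * pi * u)) *\<^sub>R e_th (2 * pi * u))"
      unfolding e_th_def complex_eq by (intro continuous_intros continuous_on_compose2[OF a_cont(4)[of UNIV]]) auto
    show "det2 (p_curve P (2 * pi * u) - 0) ((2 * pi * \<omega> (2 * pi * u)) *\<^sub>R e_th (2 * pi * u)) \<ge> 0" for u
      using a_pos[of "2 * pi * u"] \<omega>_pos[of "2 * pi * u"] by (simp add: det2_e_th p_inner)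
  qed
  also have "(\<lambda>u. det2 (p_curve P (2 * pi * u) - 0) ((2 * pi * \<omega> (2 * pi * u)) *\<^sub>R e_th (2 * pi * u)))
     = (\<lambda>u. 2 * pi * (a (2 * pi * u) * \<omega> (2 * pi * u)))"
    by (simp add: det2_e_th p_inner fun_eq_iff)
  also have "integral {0..1} \<dots> = integral {0..2*pi} (\<lambda>x. a x * \<omega> x)"
  proof -
    obtain F where F: "\<And>x. (F has_real_derivative a x * \<omega> x) (at x)"
      using antiderivative_exists[OF continuous_on_mult[OF a_cont(1) a_cont(4)]] by blast
    have "((\<lambda>u. F (2 * pi * u)) has_real_derivative 2 * pi * (a (2 * pi * u) * \<omega> (2 * pi * u))) (at u)" for u
      using DERIV_chain'[OF DERIV_cmult_Id[of "2*pi"] F[of "2 * pi * u"]] by (simp add: mult.commute)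
    then have "((\<lambda>u. 2 * pi * (a (2 * pi * u) * \<omega> (2 * pi * u))) has_integral (F (2 * pi * 1) - F (2 * pi * 0))) {0..1}"
      by (intro real_ftc) auto
    moreover have "((\<lambda>x. a x * \<omega> x) has_integral (F (2 * pi) - F 0)) {0..2*pi}"
      by (rule real_ftc) (auto intro: F)
    ultimately show ?thesis by (metis (no_types, lifting) integral_unique mult.right_neutral mult_zero_right)
  qed
  finally have "integral {0..2*pi} (\<lambda>x. a x * \<omega> x) = 2 * measure lebesgue P" by simp
  moreover have "(\<lambda>x. a x * \<omega> x) integrable_on {0..2*pi}"
    by (intro integrable_continuous_real continuous_intros a_cont)
  ultimately show ?thesis using integrable_integral[of "\<lambda>x. a x * \<omega> x" "{0..2*pi}"] by (simp only:)
qed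

end

context minkowski_plane
begin

lemma \<omega>_shift_2pi: "\<omega> (\<theta> + 2 * pi) = \<omega> \<theta>"
proof -
  have "a'' (\<theta> + 2 * pi) = a'' \<theta>"
    using DERIV_unique[OF a'_deriv[of \<theta>]] DERIV_shift[THEN iffD1, OF a'_deriv[of "\<theta> + 2*pi"]]
    by (simp add: a'_shift_2pi)
  then show ?thesis by (simp add: \<omega>_def a_shift_2pi)
qed

end

section \<open>Strictly convex loops parametrised by the normal angle\<close>

lemma e_th_eq_imp:
  assumes "e_th x = e_th y"
  obtains k :: int where "x = y + 2 * pi * of_int k"
proof -
  have "sin x = sin y \<and> cos x = cos y" using assms by (simp add: e_th_def)
  then obtain n where "x = y + 2 * pi * of_int n" using sin_cos_eq_iff[of x y] by auto
  then show ?thesis by (rule that)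
qed

lemma perp_e_th:
  assumes "n \<bullet> e_th \<phi> = 0"
  shows "n = (n \<bullet> e_r \<phi>) *\<^sub>R e_r \<phi>"
proof -
  have "n = (n \<bullet> e_r \<phi>) *\<^sub>R e_r \<phi> + (n \<bullet> e_th \<phi>) *\<^sub>R e_th \<phi>"
  proof (rule complex_eqI)
    have s: "(sin \<phi>)\<^sup>2 + (cos \<phi>)\<^sup>2 = 1" by simp
    show "Re n = Re ((n \<bullet> e_r \<phi>) *\<^sub>R e_r \<phi> + (n \<bullet> e_th \<phi>) *\<^sub>R e_th \<phi>)"
      unfolding inner_e_r inner_e_th unfolding e_r_def e_th_def plus_complex.sel scaleR_complex.sel complex.sel
      using s by algebra
    show "Im n = Im ((n \<bullet> e_r \<phi>) *\<^sub>R e_r \<phi> + (n \<bullet> e_th \<phi>) *\<^sub>R e_th \<phi>)"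
      unfolding inner_e_r inner_e_th unfolding e_r_def e_th_def plus_complex.sel scaleR_complex.sel complex.sel
      using s by algebra
  qed
  then show ?thesis using assms by simp
qed

text \<open>
A simple closed curve that bounds a strictly convex region, with speed \<open>n\<close> and a tangent angle
\<open>\<theta> + \<pi>/2\<close> that increases.
\<close>
locale convex_loop =
  fixes c :: "real \<Rightarrow> complex" and n \<theta> \<theta>' :: "real \<Rightarrow> real"
  assumes period: "c (u + 1) = c u"
    and tangent: "(c has_vector_derivative n u *\<^sub>R e_th (\<theta> u)) (at u)"
    and speed: "n u > 0" "continuous_on UNIV n"
    and angle: "(\<theta> has_real_derivative \<theta>' u) (at u)" "\<theta>' u > 0"
    and simple: "simple_path c"
    and strictly_convex: "strictly_convex_curve c"
begin

definition "K = path_image c \<union> inside (path_image c)"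

lemma c_cont: "continuous_on A c"
  by (rule continuous_at_imp_continuous_on, rule ballI, rule has_vector_derivative_continuous, rule tangent)

lemma \<theta>_cont: "continuous_on A \<theta>"
  by (rule deriv_continuous_on) (rule angle(1))

lemma \<theta>_mono: "u < v \<Longrightarrow> \<theta> u < \<theta> v"
  by (rule DERIV_pos_imp_increasing_open[of u v \<theta>], assumption, intro exI conjI, rule angle(1), rule angle(2), rule \<theta>_cont)

lemma closed: "pathfinish c = pathstart c"
  using period[of 0] by (simp add: pathfinish_def pathstart_def)

lemma jordan: "inside (path_image c) \<noteq> {}" "open (inside (path_image c))" "bounded (inside (path_image c))"
  "frontier (outside (path_image c)) = path_image c"
  using Jordan_inside_outside[OF simple closed] by blast+

text \<open>
By the Jordan curve theorem every point of the curve is a limit of points outside.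
\<close>
lemma interior_K: "interior K = inside (path_image c)"
proof -
  have "- K = outside (path_image c)" unfolding K_def by (simp add: union_with_inside)
  then have "interior K = - closure (outside (path_image c))"
    by (metis closure_complement double_complement)
  also have "\<dots> = - (outside (path_image c) \<union> path_image c)"
    by (metis jordan(4) closure_Un_frontier)
  also have "\<dots> = inside (path_image c)"
    by (metis inside_outside sup_commute)
  finally show ?thesis .
qed

lemma K_compact: "compact K"
proof -
  have "path c" using simple by (rule simple_path_imp_path)
  then have "closed K" unfolding K_def by (rule closed_path_image_Un_inside)
  moreover have "bounded K" unfolding K_def
    using jordan(3) bounded_simple_path_image[OF simple] by simp
  ultimately show ?thesis by (simp add: compact_eq_bounded_closed)
qed

lemma K_strictly_convex: "Defs.strictly_convex K"
  using strictly_convex unfolding strictly_convex_curve_def K_def .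

lemma K_convex: "convex K"
  by (rule strictly_convex_imp_convex[OF K_strictly_convex])

lemma frontier_K: "frontier K = path_image c"
proof -
  have "frontier K = K - interior K"
    using K_compact by (simp add: frontier_def compact_imp_closed)
  moreover have "path_image c \<inter> inside (path_image c) = {}" by (subst Int_commute) (rule inside_no_overlap)
  ultimately show ?thesis unfolding interior_K unfolding K_def by blast
qed

lemma c_shift_int: "c (u + of_int k) = c u"
proof -
  interpret periodic_fun_simple' c by unfold_locales (rule period)
  show ?thesis by (rule plus_of_int)
qed

lemma c_frac: "c (frac u) = c u"
  using c_shift_int[of "frac u" "\<lfloor>u\<rfloor>"] by (simp add: frac_def)

lemma c_inj: "inj_on c {0..<1}"
proof (rule inj_onI)
  fix u v :: real assume uv: "u \<in> {0..<1}" "v \<in> {0..<1}" "c u = c v"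
  have "loop_free c" using simple by (simp add: simple_path_def)
  then have "\<forall>x\<in>{0..1}. \<forall>y\<in>{0..1}. c x = c y \<longrightarrow> x = y \<or> x = 0 \<and> y = 1 \<or> x = 1 \<and> y = 0"
    by (simp add: loop_free_def)
  from bspec[OF bspec[OF this, of u], of v] uv show "u = v" by auto
qed

lemma c_image: "c ` {0..<1} = frontier K"
proof -
  have "c ` {0..1} \<subseteq> c ` {0..<1}"
  proof (rule image_subsetI)
    fix u :: real
    show "c u \<in> c ` {0..<1}" by (rule image_eqI[of _ _ "frac u"]) (simp_all add: c_frac frac_lt_1)
  qed
  moreover have "c ` {0..<1} \<subseteq> c ` {0..1}" by (rule image_mono) auto
  ultimately show ?thesis unfolding frontier_K path_image_def by simp
qed

lemma c_frontier: "c u \<in> frontier K"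
proof -
  have "c (frac u) \<in> c ` {0..<1}" by (rule imageI) (simp add: frac_lt_1)
  then show ?thesis unfolding c_image c_frac .
qed

lemma c_in_K: "c u \<in> K"
  using frontier_subset_closed[OF compact_imp_closed[OF K_compact]] c_frontier by (rule subsetD)

lemma inner_deriv: "((\<lambda>w. n0 \<bullet> c w) has_real_derivative n w * (n0 \<bullet> e_th (\<theta> w))) (at w)"
proof -
  have "((\<lambda>w. n0 \<bullet> c w) has_vector_derivative n0 \<bullet> (n w *\<^sub>R e_th (\<theta> w))) (at w)"
    by (rule bounded_linear.has_vector_derivative[OF bounded_linear_inner_right tangent])
  then show ?thesis by (simp add: has_real_derivative_iff_has_vector_derivative)
qed

text \<open>
At a frontier point the supporting line of the convex body is the tangent, so a normal vector of it
is a multiple of \<open>e_r (\<theta> u)\<close>.  Because \<open>\<theta>\<close> increases, the curve bends away from \<open>e_r (\<theta> u)\<close> just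
after the parameter \<open>u\<close>, which decides the sign.
\<close>
lemma support:
  assumes "x \<in> K" shows "x \<bullet> e_r (\<theta> u) \<le> c u \<bullet> e_r (\<theta> u)"
proof -
  have "interior K \<noteq> {}" using jordan interior_K by simp
  then have "c u \<notin> rel_interior K"
    using c_frontier[of u] by (simp add: frontier_def rel_interior_nonempty_interior)
  then obtain m where m: "m \<noteq> 0" "\<And>y. y \<in> K \<Longrightarrow> m \<bullet> c u \<le> m \<bullet> y"
    using supporting_hyperplane_rel_boundary[OF K_convex c_in_K] by metis
  have "n u * (m \<bullet> e_th (\<theta> u)) = 0"
    by (rule DERIV_local_min[OF inner_deriv[of m u], of 1]) (use m c_in_K in auto)
  then have "m \<bullet> e_th (\<theta> u) = 0" using speed(1)[of u] by simp
  then have meq: "m = (m \<bullet> e_r (\<theta> u)) *\<^sub>R e_r (\<theta> u)" by (rule perp_e_th)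
  define r where "r = m \<bullet> e_r (\<theta> u)"
  have mr: "m \<bullet> y = r * (y \<bullet> e_r (\<theta> u))" for y
    by (subst meq) (simp add: r_def inner_commute)
  have "\<not> r > 0"
  proof
    assume r: "r > 0"
    have "isCont \<theta> u" using angle(1) DERIV_isCont by blast
    then obtain d where d: "d > 0" "\<And>w. \<bar>w - u\<bar> < d \<Longrightarrow> \<bar>\<theta> w - \<theta> u\<bar> < pi"
      unfolding continuous_at_eps_delta using pi_gt_zero by (metis dist_real_def)
    have "e_r (\<theta> u) \<bullet> c (u + d/2) < e_r (\<theta> u) \<bullet> c u"
    proof (rule DERIV_neg_imp_decreasing_open[where f = "\<lambda>w. e_r (\<theta> u) \<bullet> c w"])
      show "u < u + d/2" using d by simp
      fix w assume w: "u < w" "w < u + d/2"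
      have "\<theta> u < \<theta> w" "\<theta> w - \<theta> u < pi" using \<theta>_mono[OF w(1)] d(2)[of w] w by auto
      then have "sin (\<theta> w - \<theta> u) > 0" by (intro sin_gt_zero) auto
      moreover have "e_r (\<theta> u) \<bullet> e_th (\<theta> w) = - sin (\<theta> w - \<theta> u)"
        by (simp add: inner_e_th e_r_def sin_diff)
      ultimately have "n w * (e_r (\<theta> u) \<bullet> e_th (\<theta> w)) < 0"
        using speed(1)[of w] by (simp add: mult_less_0_iff)
      then show "\<exists>y. ((\<lambda>w. e_r (\<theta> u) \<bullet> c w) has_real_derivative y) (at w) \<and> y < 0"
        using inner_deriv by blast
    qed (intro continuous_intros c_cont)
    moreover have "m \<bullet> c u \<le> m \<bullet> c (u + d/2)" by (rule m(2)[OF c_in_K])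
    then have "c u \<bullet> e_r (\<theta> u) \<le> c (u + d/2) \<bullet> e_r (\<theta> u)" using r by (simp add: mr)
    ultimately show False by (simp add: inner_commute)
  qed
  moreover have "r \<noteq> 0" using meq m(1) unfolding r_def by auto
  ultimately have "r < 0" by simp
  then show ?thesis using m(2)[OF assms] by (simp add: mr)
qed

lemma support_less:
  "z \<in> interior K \<Longrightarrow> z \<bullet> e_r (\<theta> u) < c u \<bullet> e_r (\<theta> u)"
  by (rule interior_inner_less[OF _ support])

text \<open>
A linear functional has only one maximum point on a strictly convex body.
\<close>
lemma same_normal:
  assumes "e_r (\<theta> u) = e_r (\<theta> w)" shows "c u = c w"
proof (rule ccontr)
  assume ne: "c u \<noteq> c w"
  have "c u \<bullet> e_r (\<theta> u) = c w \<bullet> e_r (\<theta> u)"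
    using support[OF c_in_K, of w u] support[OF c_in_K, of u w] assms by simp
  moreover have "midpoint (c u) (c w) \<in> interior K"
    using K_strictly_convex[unfolded strictly_convex_def, rule_format, OF c_in_K c_in_K ne] ne by auto
  from support_less[OF this, of u] have "midpoint (c u) (c w) \<bullet> e_r (\<theta> u) < c u \<bullet> e_r (\<theta> u)" .
  ultimately show False by (simp add: midpoint_def inner_add_left)
qed

text \<open>
The total rotation is a positive multiple of \<open>2\<pi>\<close>.  If it were more than \<open>2\<pi>\<close>, the normal would
recur within one period, and by \<open>same_normal\<close> the curve would not be simple.
\<close>
lemma \<theta>_shift: "\<theta> (u + 1) = \<theta> u + 2 * pi"
proof -
  have "((\<lambda>w. c (w + 1)) has_vector_derivative n (u + 1) *\<^sub>R e_th (\<theta> (u + 1))) (at u)"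
  proof -
    have "((\<lambda>w. w + 1) has_real_derivative 1) (at u)" by (auto intro!: derivative_eq_intros)
    then have "((\<lambda>w. w + 1) has_vector_derivative 1) (at u)"
      by (simp only: has_real_derivative_iff_has_vector_derivative)
    from vector_diff_chain_at[OF this tangent[of "u + 1"]] show ?thesis by (simp add: o_def)
  qed
  then have "n (u + 1) *\<^sub>R e_th (\<theta> (u + 1)) = n u *\<^sub>R e_th (\<theta> u)"
    using vector_derivative_unique_at[OF tangent[of u]] by (simp add: period)
  moreover from this have "norm (n (u + 1) *\<^sub>R e_th (\<theta> (u + 1))) = norm (n u *\<^sub>R e_th (\<theta> u))" by simp
  then have "n (u + 1) = n u" using speed(1)[of u] speed(1)[of "u + 1"] by simp
  ultimately have "e_th (\<theta> (u + 1)) = e_th (\<theta> u)" using speed(1)[of u] by simp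
  then obtain k where k: "\<theta> (u + 1) = \<theta> u + 2 * pi * of_int k" by (rule e_th_eq_imp)
  have "2 * pi * real_of_int k > 0" using k \<theta>_mono[of u "u + 1"] by simp
  then have k1: "k \<ge> 1" by (simp add: zero_less_mult_iff)
  moreover have "k < 2"
  proof (rule ccontr)
    assume "\<not> k < 2"
    then have "real_of_int k \<ge> 2" by simp
    then have "2 * pi * 2 \<le> 2 * pi * real_of_int k" by (intro mult_left_mono) auto
    then have "\<theta> u + 2 * pi < \<theta> (u + 1)" using k pi_gt_zero by linarith
    then obtain w where w: "u \<le> w" "w \<le> u + 1" "\<theta> w = \<theta> u + 2 * pi"
      using IVT'[of \<theta> u "\<theta> u + 2 * pi" "u + 1"] \<theta>_cont by force
    then have "w \<noteq> u" "w \<noteq> u + 1" using \<open>\<theta> u + 2 * pi < \<theta> (u + 1)\<close> by auto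
    with w have uw: "u < w" "w < u + 1" by auto
    have "c u = c w" by (rule same_normal) (simp add: w frame_shift)
    then have "c (frac u) = c (frac w)" by (simp add: c_frac)
    then have "frac u = frac w" using c_inj by (auto simp: inj_on_def frac_lt_1)
    then have "w - u = of_int (\<lfloor>w\<rfloor> - \<lfloor>u\<rfloor>)" by (simp add: frac_def)
    moreover from this have "0 < \<lfloor>w\<rfloor> - \<lfloor>u\<rfloor>" "\<lfloor>w\<rfloor> - \<lfloor>u\<rfloor> < 1" using uw by linarith+
    ultimately show False by simp
  qed
  ultimately have "k = 1" by simp
  then show ?thesis using k by simp
qed

lemma area: "enclosed_area c = integral {0..1} (\<lambda>u. det2 (c u) (n u *\<^sub>R e_th (\<theta> u))) / 2"
proof -
  obtain z where z: "z \<in> interior K" using jordan(1) interior_K by auto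
  have ct: "continuous_on A (\<lambda>u. n u *\<^sub>R e_th (\<theta> u))" for A
    unfolding e_th_def complex_eq by (intro continuous_intros \<theta>_cont continuous_on_subset[OF speed(2) subset_UNIV])
  have "enclosed_area c = measure lebesgue K"
    unfolding enclosed_area_def interior_K[symmetric]
    by (rule measure_interior[OF compact_imp_bounded[OF K_compact] negligible_convex_frontier[OF K_convex]])
  also have "\<dots> = integral {0..1} (\<lambda>u. det2 (c u - z) (n u *\<^sub>R e_th (\<theta> u))) / 2"
  proof (rule area_of_convex_body[OF K_compact K_convex z tangent ct c_inj c_image])
    show "det2 (c u - z) (n u *\<^sub>R e_th (\<theta> u)) \<ge> 0" for u
      using support_less[OF z, of u] speed(1)[of u] by (simp add: det2_e_th inner_diff_left)
  qed
  also have "integral {0..1} (\<lambda>u. det2 (c u - z) (n u *\<^sub>R e_th (\<theta> u)))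
    = integral {0..1} (\<lambda>u. det2 (c u) (n u *\<^sub>R e_th (\<theta> u)))"
  proof -
    have "((\<lambda>u. n u *\<^sub>R e_th (\<theta> u)) has_integral (c 1 - c 0)) {0..1}"
      by (rule fundamental_theorem_of_calculus) (auto intro: has_vector_derivative_at_within tangent)
    then have 0: "((\<lambda>u. n u *\<^sub>R e_th (\<theta> u)) has_integral 0) {0..1}" using period[of 0] by simp
    have "bounded_linear (det2 z)"
      by (intro linear_conv_bounded_linear[THEN iffD1] linearI) (simp_all add: det2_def algebra_simps)
    from has_integral_linear[OF 0 this]
    have "((\<lambda>u. det2 z (n u *\<^sub>R e_th (\<theta> u))) has_integral 0) {0..1}" by (simp add: o_def det2_def)
    moreover have "((\<lambda>u. det2 (c u) (n u *\<^sub>R e_th (\<theta> u))) has_integral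
       integral {0..1} (\<lambda>u. det2 (c u) (n u *\<^sub>R e_th (\<theta> u)))) {0..1}"
      unfolding det2_def by (intro integrable_integral integrable_continuous_real continuous_intros c_cont ct)
    ultimately have "((\<lambda>u. det2 (c u) (n u *\<^sub>R e_th (\<theta> u)) - det2 z (n u *\<^sub>R e_th (\<theta> u))) has_integral
       integral {0..1} (\<lambda>u. det2 (c u) (n u *\<^sub>R e_th (\<theta> u))) - 0) {0..1}"
      by (intro has_integral_diff)
    then show ?thesis by (intro integral_unique) (simp add: det2_def algebra_simps)
  qed
  finally show ?thesis .
qed

lemma area_pos: "enclosed_area c > 0"
proof -
  have "\<not> negligible (inside (path_image c))" using open_not_negligible jordan(1,2) by blast
  moreover have "inside (path_image c) \<in> lmeasurable" using jordan(2,3) by (rule lmeasurable_open[rotated])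
  ultimately show ?thesis unfolding enclosed_area_def
    by (metis negligible_iff_measure measure_nonneg order_le_less)
qed

end

locale convex_loop_C2 = convex_loop +
  assumes \<theta>'_cont: "continuous_on UNIV \<theta>'"
begin

text \<open>
The parameter at which the curve has a given normal angle.
\<close>
definition U where "U = inv \<theta>"

lemma \<theta>_shift_int: "\<theta> (u + of_int k) = \<theta> u + 2 * pi * of_int k"
proof -
  interpret periodic_fun_simple' "\<lambda>u. \<theta> u - 2 * pi * u"
    by unfold_locales (simp add: \<theta>_shift distrib_left)
  show ?thesis using plus_of_int[of u k] by (simp add: distrib_left)
qed

lemma \<theta>_inj: "inj \<theta>"
  by (rule injI) (metis \<theta>_mono linorder_neqE_linordered_idom order_less_irrefl)

lemma \<theta>_surj: "surj \<theta>"
proof -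
  have "\<exists>u. \<theta> u = y" for y
  proof -
    define k where "k = \<lfloor>(y - \<theta> 0) / (2 * pi)\<rfloor>"
    have "real_of_int k \<le> (y - \<theta> 0) / (2 * pi)" "(y - \<theta> 0) / (2 * pi) \<le> real_of_int (k + 1)"
      unfolding k_def by linarith+
    then have "\<theta> (0 + of_int k) \<le> y" "y \<le> \<theta> (0 + of_int (k + 1))"
      unfolding \<theta>_shift_int by (simp_all add: field_simps)
    then show ?thesis
      using IVT'[of \<theta> "0 + of_int k" y "0 + of_int (k + 1)"] \<theta>_cont by auto
  qed
  then show ?thesis by (metis surjI)
qed

lemma \<theta>_U: "\<theta> (U y) = y"
  unfolding U_def by (rule surj_f_inv_f[OF \<theta>_surj])

lemma U_\<theta>: "U (\<theta> u) = u"
  unfolding U_def by (rule inv_f_f[OF \<theta>_inj])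

lemma U_shift: "U (y + 2 * pi) = U y + 1"
proof -
  have "\<theta> (U y + 1) = y + 2 * pi" by (simp add: \<theta>_shift \<theta>_U)
  then show ?thesis using U_\<theta>[of "U y + 1"] by simp
qed

lemma U_deriv: "(U has_real_derivative 1 / \<theta>' (U y)) (at y)"
proof -
  have "isCont U (\<theta> (U y))"
    by (rule isCont_inverse_function[of 1]) (auto simp: U_\<theta> intro: DERIV_isCont angle(1))
  then have "isCont U y" by (simp add: \<theta>_U)
  then have "(U has_real_derivative inverse (\<theta>' (U y))) (at y)"
    using angle[of "U y"] by (intro DERIV_inverse_function[where f = \<theta> and g = U and a = "y - 1" and b = "y + 1"]) (auto simp: \<theta>_U)
  then show ?thesis by (simp add: inverse_eq_divide)
qed

lemma U_cont: "continuous_on A U"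
  by (rule deriv_continuous_on) (rule U_deriv)

definition h where "h y = c (U y) \<bullet> e_r y"
definition h' where "h' y = c (U y) \<bullet> e_th y"
definition \<rho> where "\<rho> y = n (U y) / \<theta>' (U y)"

lemma \<rho>_pos: "\<rho> y > 0"
  unfolding \<rho>_def using speed(1)[of "U y"] angle(2)[of "U y"] by simp

lemma cU_deriv: "((\<lambda>y. c (U y)) has_vector_derivative \<rho> y *\<^sub>R e_th y) (at y)"
proof -
  have "(U has_vector_derivative 1 / \<theta>' (U y)) (at y)"
    using U_deriv by (simp only: has_real_derivative_iff_has_vector_derivative)
  from vector_diff_chain_at[OF this tangent[of "U y"]] show ?thesis
    by (simp add: o_def \<theta>_U \<rho>_def)
qed

lemma h_deriv: "(h has_real_derivative h' y) (at y)"
proof -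
  have "((\<lambda>y. c (U y) \<bullet> e_r y) has_vector_derivative c (U y) \<bullet> e_th y + (\<rho> y *\<^sub>R e_th y) \<bullet> e_r y) (at y)"
    using bounded_bilinear.has_vector_derivative[OF bounded_bilinear_inner cU_deriv e_r_deriv] .
  then show ?thesis by (simp add: has_real_derivative_iff_has_vector_derivative h_def[abs_def] h'_def)
qed

lemma h'_deriv: "(h' has_real_derivative \<rho> y - h y) (at y)"
proof -
  have "((\<lambda>y. c (U y) \<bullet> e_th y) has_vector_derivative c (U y) \<bullet> (- e_r y) + (\<rho> y *\<^sub>R e_th y) \<bullet> e_th y) (at y)"
    using bounded_bilinear.has_vector_derivative[OF bounded_bilinear_inner cU_deriv e_th_deriv] .
  then show ?thesis by (simp add: has_real_derivative_iff_has_vector_derivative h_def h'_def[abs_def])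
qed

lemma h_shift: "h (y + 2 * pi) = h y" and \<rho>_shift: "\<rho> (y + 2 * pi) = \<rho> y"
proof -
  show "h (y + 2 * pi) = h y" by (simp add: h_def U_shift period frame_shift)
  have "h' (y + 2 * pi) = h' y" for y by (simp add: h'_def U_shift period frame_shift)
  then have "((\<lambda>y. h' (y + 2 * pi)) has_real_derivative \<rho> y - h y) (at y)" using h'_deriv by simp
  moreover have "((\<lambda>y. h' (y + 2 * pi)) has_real_derivative \<rho> (y + 2 * pi) - h (y + 2 * pi)) (at y)"
    using h'_deriv[of "y + 2 * pi"] by (simp only: DERIV_shift)
  ultimately have "\<rho> y - h y = \<rho> (y + 2 * pi) - h (y + 2 * pi)" by (rule DERIV_unique)
  then show "\<rho> (y + 2 * pi) = \<rho> y" by (simp add: \<open>h (y + 2 * pi) = h y\<close>)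
qed

lemma \<rho>_cont: "continuous_on A \<rho>"
  unfolding \<rho>_def[abs_def]
  by (intro continuous_intros continuous_on_compose2[OF speed(2) U_cont] continuous_on_compose2[OF \<theta>'_cont U_cont])
    (use angle(2) in \<open>auto simp: less_le\<close>)

lemma h_cont: "continuous_on A h"
  by (rule deriv_continuous_on) (rule h_deriv)

text \<open>
Substitution of the normal angle for the parameter; by periodicity the interval can be moved to
start at \<open>0\<close>.
\<close>
lemma integral_angle:
  assumes F: "continuous_on UNIV F" "\<And>y. F (y + 2 * pi) = F y"
  shows "((\<lambda>u. F (\<theta> u) * \<theta>' u) has_integral integral {0..2*pi} F) {0..1}"
proof -
  obtain G where G: "\<And>y. (G has_real_derivative F y) (at y)" using antiderivative_exists[OF F(1)] by blast
  have "((\<lambda>u. G (\<theta> u)) has_real_derivative F (\<theta> u) * \<theta>' u) (at u)" for u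
    using DERIV_chain2[OF G angle(1)] by simp
  then have "((\<lambda>u. F (\<theta> u) * \<theta>' u) has_integral G (\<theta> 1) - G (\<theta> 0)) {0..1}"
    by (intro real_ftc) auto
  moreover have "(F has_integral G (\<theta> 1) - G (\<theta> 0)) {\<theta> 0..\<theta> 1}"
    by (rule real_ftc) (use G \<theta>_mono[of 0 1] in auto)
  then have "integral {\<theta> 0..\<theta> 0 + 2 * pi} F = G (\<theta> 1) - G (\<theta> 0)"
    using \<theta>_shift[of 0] by (simp add: integral_unique)
  then have "integral {0..2*pi} F = G (\<theta> 1) - G (\<theta> 0)"
    using integral_period_shift[OF F, of "\<theta> 0"] by simp
  ultimately show ?thesis by simp
qed

lemma \<rho>_\<theta>: "\<rho> (\<theta> u) * \<theta>' u = n u"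
  using angle(2)[of u] by (simp add: \<rho>_def U_\<theta>)

lemma area_angle: "((\<lambda>y. h y * \<rho> y) has_integral 2 * enclosed_area c) {0..2*pi}"
proof -
  have "((\<lambda>u. (h (\<theta> u) * \<rho> (\<theta> u)) * \<theta>' u) has_integral integral {0..2*pi} (\<lambda>y. h y * \<rho> y)) {0..1}"
    by (rule integral_angle) (auto intro!: continuous_intros h_cont \<rho>_cont simp: h_shift \<rho>_shift)
  moreover have "(h (\<theta> u) * \<rho> (\<theta> u)) * \<theta>' u = det2 (c u) (n u *\<^sub>R e_th (\<theta> u))" for u
    by (simp add: mult.assoc \<rho>_\<theta> det2_e_th h_def U_\<theta>)
  ultimately have "integral {0..2*pi} (\<lambda>y. h y * \<rho> y) = 2 * enclosed_area c"
    by (simp add: area integral_unique)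
  moreover have "(\<lambda>y. h y * \<rho> y) integrable_on {0..2*pi}"
    by (intro integrable_continuous_real continuous_intros h_cont \<rho>_cont)
  ultimately show ?thesis by (simp add: has_integral_iff)
qed

end

context minkowski_plane
begin

text \<open>
The inequality of Gage with remainder in terms of a general parameter.  The number \<open>L\<close> is the length,
and \<open>K\<close> is the integral of the squared curvature: with \<open>\<rho> = n / \<theta>'\<close> for the Euclidean radius of
curvature the integrand is \<open>a \<omega>\<^sup>2 / \<rho> \<cdot> \<theta>'\<close>.
\<close>
lemma gage_loop:
  shows "\<exists>\<kappa>>0. \<forall>c n \<theta> \<theta>' L K A. convex_loop_C2 c n \<theta> \<theta>' \<longrightarrow>
    ((\<lambda>u. a (\<theta> u) * n u) has_integral L) {0..1} \<longrightarrow>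
    ((\<lambda>u. a (\<theta> u) * (\<omega> (\<theta> u) * \<theta>' u)\<^sup>2 / n u) has_integral K) {0..1} \<longrightarrow> A = enclosed_area c \<longrightarrow>
    L > 0 \<and> 4 * measure lebesgue P * A \<le> L\<^sup>2 \<and>
    \<kappa> * ((L\<^sup>2 - 4 * measure lebesgue P * A) / (L * A)) \<le> K - measure lebesgue P * L / A"
proof (rule gage_stability[OF a_deriv a'_deriv a''_cont a_shift_pi a_pos \<omega>_pos[unfolded \<omega>_def], where p = "measure lebesgue P"])
  fix \<kappa> :: real
  assume \<kappa>: "\<kappa> > 0" and gage:
    "\<And>h h' h'' S l. \<lbrakk>\<And>x. (h has_real_derivative h' x) (at x); \<And>x. (h' has_real_derivative h'' x) (at x);
       continuous_on UNIV h''; \<And>x. h (x + 2 * pi) = h x; \<And>x. h x + h'' x > 0;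
       ((\<lambda>x. h x * (h x + h'' x)) has_integral 2 * S) {0..2*pi}; S > 0;
       ((\<lambda>x. h x * (a x + a'' x)) has_integral l) {0..2*pi};
       ((\<lambda>x. a x * (a x + a'' x)) has_integral 2 * measure lebesgue P) {0..2*pi}\<rbrakk> \<Longrightarrow>
      l > 0 \<and> 4 * measure lebesgue P * S \<le> l\<^sup>2 \<and>
      \<kappa> * ((l\<^sup>2 - 4 * measure lebesgue P * S) / (l * S)) \<le>
        integral {0..2*pi} (\<lambda>x. a x * (a x + a'' x)\<^sup>2 / (h x + h'' x)) - measure lebesgue P * l / S"
  show ?thesis
  proof (intro exI[of _ \<kappa>] conjI allI impI, rule \<kappa>)
    fix c n \<theta> \<theta>' L K A
    assume loop: "convex_loop_C2 c n \<theta> \<theta>'" and L: "((\<lambda>u. a (\<theta> u) * n u) has_integral L) {0..1}"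
      and K: "((\<lambda>u. a (\<theta> u) * (\<omega> (\<theta> u) * \<theta>' u)\<^sup>2 / n u) has_integral K) {0..1}"
      and A: "A = enclosed_area c"
    interpret convex_loop_C2 c n \<theta> \<theta>' by (rule loop)
    have "((\<lambda>u. (a (\<theta> u) * \<rho> (\<theta> u)) * \<theta>' u) has_integral integral {0..2*pi} (\<lambda>y. a y * \<rho> y)) {0..1}"
      by (rule integral_angle) (auto intro!: continuous_intros a_cont \<rho>_cont simp: a_shift_2pi \<rho>_shift)
    then have Leq: "integral {0..2*pi} (\<lambda>y. a y * \<rho> y) = L"
      using L by (simp add: mult.assoc \<rho>_\<theta> has_integral_unique)
    have Lh: "((\<lambda>x. h x * (a x + a'' x)) has_integral L) {0..2*pi}"
    proof -
      have 1: "((\<lambda>y. a y * \<rho> y) has_integral L) {0..2*pi}"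
        unfolding Leq[symmetric] by (intro integrable_integral integrable_continuous_real continuous_intros a_cont \<rho>_cont)
      have e: "h (2*pi) = h 0" "a (2*pi) = a 0" "a' (2*pi) = a' 0" "h' (2*pi) = h' 0"
        using h_shift[of 0] a_shift_2pi[of 0] a'_shift_2pi[of 0] by (simp_all add: h'_def U_shift[of 0, simplified] period frame_shift[of 0, simplified])
      have 2: "((\<lambda>x. a x * (h x + (\<rho> x - h x)) - (a x * h x - a' x * h' x)) has_integral 0) {0..2*pi}"
        by (rule integral_by_parts_period[OF a_deriv h'_deriv]) (use e in auto)
      have 3: "((\<lambda>x. h x * (a x + a'' x) - (h x * a x - h' x * a' x)) has_integral 0) {0..2*pi}"
        by (rule integral_by_parts_period[OF h_deriv a'_deriv]) (use e in auto)
      from has_integral_add[OF 1 has_integral_diff[OF 3 2]] show ?thesis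
        by (simp add: algebra_simps)
    qed
    have "((\<lambda>u. (a (\<theta> u) * (\<omega> (\<theta> u))\<^sup>2 / \<rho> (\<theta> u)) * \<theta>' u) has_integral integral {0..2*pi} (\<lambda>y. a y * (\<omega> y)\<^sup>2 / \<rho> y)) {0..1}"
      by (rule integral_angle) (use \<rho>_pos in \<open>auto intro!: continuous_intros a_cont \<rho>_cont simp: a_shift_2pi \<rho>_shift \<omega>_shift_2pi less_le\<close>)
    moreover have "(a (\<theta> u) * (\<omega> (\<theta> u))\<^sup>2 / \<rho> (\<theta> u)) * \<theta>' u = a (\<theta> u) * (\<omega> (\<theta> u) * \<theta>' u)\<^sup>2 / n u" for u
      using angle(2)[of u] speed(1)[of u] by (simp add: \<rho>_\<theta>[symmetric] power2_eq_square)
    ultimately have Keq: "integral {0..2*pi} (\<lambda>y. a y * (\<omega> y)\<^sup>2 / \<rho> y) = K"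
      using K by (simp add: has_integral_unique)
    have "L > 0 \<and> 4 * measure lebesgue P * A \<le> L\<^sup>2 \<and>
      \<kappa> * ((L\<^sup>2 - 4 * measure lebesgue P * A) / (L * A)) \<le>
        integral {0..2*pi} (\<lambda>x. a x * (a x + a'' x)\<^sup>2 / (h x + (\<rho> x - h x))) - measure lebesgue P * L / A"
    proof (rule gage[OF h_deriv h'_deriv _ h_shift _ _ _ Lh])
      show "continuous_on UNIV (\<lambda>x. \<rho> x - h x)" by (intro continuous_intros \<rho>_cont h_cont)
      show "h x + (\<rho> x - h x) > 0" for x using \<rho>_pos by simp
      show "((\<lambda>x. h x * (h x + (\<rho> x - h x))) has_integral 2 * A) {0..2*pi}" using area_angle A by simp
      show "A > 0" using A area_pos by simp
      show "((\<lambda>x. a x * (a x + a'' x)) has_integral 2 * measure lebesgue P) {0..2*pi}"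
        using area_P by (simp add: \<omega>_def)
    qed
    then show "L > 0" "4 * measure lebesgue P * A \<le> L\<^sup>2"
      "\<kappa> * ((L\<^sup>2 - 4 * measure lebesgue P * A) / (L * A)) \<le> K - measure lebesgue P * L / A"
      using Keq by (simp_all add: \<omega>_def)
  qed
qed

end

section \<open>Smooth functions on a strip\<close>

lemma continuous_on_slices:
  fixes g :: "real \<Rightarrow> real \<Rightarrow> 'b::topological_space"
  assumes "continuous_on (UNIV \<times> J) (\<lambda>(u, t). g u t)"
  shows "A \<subseteq> J \<Longrightarrow> continuous_on A (g u)" "t \<in> J \<Longrightarrow> continuous_on B (\<lambda>u. g u t)"
    "continuous_on (J \<times> B) (\<lambda>(t, u). g u t)"
proof -
  have "continuous_on A (\<lambda>t. case (u, t) of (u, t) \<Rightarrow> g u t)" if "A \<subseteq> J"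
    by (rule continuous_on_compose2[OF assms]) (use that in \<open>auto intro!: continuous_intros\<close>)
  then show "A \<subseteq> J \<Longrightarrow> continuous_on A (g u)" by simp
  have "continuous_on B (\<lambda>u. case (u, t) of (u, t) \<Rightarrow> g u t)" if "t \<in> J"
    by (rule continuous_on_compose2[OF assms]) (use that in \<open>auto intro!: continuous_intros\<close>)
  then show "t \<in> J \<Longrightarrow> continuous_on B (\<lambda>u. g u t)" by simp
  have "continuous_on (J \<times> B) (\<lambda>z. case (snd z, fst z) of (u, t) \<Rightarrow> g u t)"
    by (rule continuous_on_compose2[OF assms]) (auto intro!: continuous_intros)
  then show "continuous_on (J \<times> B) (\<lambda>(t, u). g u t)" by (simp add: case_prod_beta')
qed

text \<open>
The \<open>u\<close>-derivative of \<open>f u \<tau> - f u s = \<integral> ft u\<close> is taken under the integral sign, and the resulting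
formula for \<open>fu u \<tau> - fu u s\<close> is differentiated in \<open>\<tau>\<close>.
\<close>
lemma mixed_partials_commute:
  fixes f fu ft g1 g2 :: "real \<Rightarrow> real \<Rightarrow> 'b::euclidean_space"
  assumes fu: "\<And>u t. t \<in> {0<..<T} \<Longrightarrow> ((\<lambda>w. f w t) has_vector_derivative fu u t) (at u)"
    and ft: "\<And>u t. t \<in> {0<..<T} \<Longrightarrow> ((\<lambda>\<tau>. f u \<tau>) has_vector_derivative ft u t) (at t)"
    and fut: "\<And>u t. t \<in> {0<..<T} \<Longrightarrow> ((\<lambda>\<tau>. fu u \<tau>) has_vector_derivative g1 u t) (at t)"
    and ftu: "\<And>u t. t \<in> {0<..<T} \<Longrightarrow> ((\<lambda>w. ft w t) has_vector_derivative g2 u t) (at u)"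
    and cont: "continuous_on (UNIV \<times> {0<..<T}) (\<lambda>(u, t). g2 u t)"
      "continuous_on (UNIV \<times> {0<..<T}) (\<lambda>(u, t). ft u t)"
    and t: "t \<in> {0<..<T}"
  shows "g1 u t = g2 u t"
proof -
  \<comment> \<open>Any \<open>s < t < r\<close> inside the interval would do.\<close>
  define s where "s = t / 2"
  define r where "r = (t + T) / 2"
  have s: "0 < s" "s < t" "t < r" "r < T" using t by (auto simp: s_def r_def)
  have sub: "{s..\<tau>} \<subseteq> {0<..<T}" if "\<tau> < T" for \<tau> using s that by auto
  have c_ft: "continuous_on {s..\<tau>} (ft w)" if "\<tau> < T" for w \<tau>
    by (rule continuous_on_slices(1)[OF cont(2) sub[OF that]])
  have c_g2: "continuous_on {s..\<tau>} (g2 w)" if "\<tau> < T" for w \<tau>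
    by (rule continuous_on_slices(1)[OF cont(1) sub[OF that]])
  have eq: "fu u \<tau> - fu u s = integral {s..\<tau>} (g2 u)" if \<tau>: "s \<le> \<tau>" "\<tau> < T" for \<tau>
  proof -
    have "((\<lambda>w. integral (cbox s \<tau>) (ft w)) has_vector_derivative integral (cbox s \<tau>) (g2 u)) (at u within UNIV)"
    proof (rule leibniz_rule_vector_derivative)
      show "((\<lambda>x. ft x t) has_vector_derivative g2 x t) (at x within UNIV)" if "t \<in> cbox s \<tau>" for x t
        using ftu[of t x] that s \<tau> by auto
      show "ft x integrable_on cbox s \<tau>" for x
        using c_ft[OF \<tau>(2)] by (simp add: integrable_continuous_real)
      show "continuous_on (UNIV \<times> cbox s \<tau>) (\<lambda>(x, t). g2 x t)"
        by (rule continuous_on_subset[OF cont(1)]) (use s \<tau> in auto)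
    qed auto
    moreover have "integral (cbox s \<tau>) (ft w) = f w \<tau> - f w s" for w
      unfolding box_real
      by (rule integral_unique, rule fundamental_theorem_of_calculus[OF \<tau>(1)])
        (use s \<tau> in \<open>auto intro!: has_vector_derivative_at_within ft\<close>)
    ultimately have 1: "((\<lambda>w. f w \<tau> - f w s) has_vector_derivative integral {s..\<tau>} (g2 u)) (at u)" by simp
    have 2: "((\<lambda>w. f w \<tau> - f w s) has_vector_derivative fu u \<tau> - fu u s) (at u)"
      by (intro has_vector_derivative_diff fu) (use s \<tau> in auto)
    show ?thesis by (rule vector_derivative_unique_at[OF 2 1])
  qed
  have "((\<lambda>\<tau>. integral {s..\<tau>} (g2 u)) has_vector_derivative g2 u t) (at t within {s..r})"
    by (rule integral_has_vector_derivative[OF c_g2]) (use s in auto)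
  then have 3: "((\<lambda>\<tau>. integral {s..\<tau>} (g2 u)) has_vector_derivative g2 u t) (at t)"
    using s by (simp add: at_within_Icc_at)
  have 4: "((\<lambda>\<tau>. integral {s..\<tau>} (g2 u)) has_vector_derivative g1 u t) (at t)"
  proof (rule has_vector_derivative_transform_within_open)
    show "((\<lambda>\<tau>. fu u \<tau> - fu u s) has_vector_derivative g1 u t) (at t)"
      using has_vector_derivative_diff[OF fut[OF t, of u] has_vector_derivative_const[of "fu u s"]] by simp
    show "open {s<..<r}" "t \<in> {s<..<r}" using s by auto
    show "fu u \<tau> - fu u s = integral {s..\<tau>} (g2 u)" if "\<tau> \<in> {s<..<r}" for \<tau>
      using eq[of \<tau>] that s by auto
  qed
  show ?thesis by (rule vector_derivative_unique_at[OF 4 3])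
qed

lemma smooth_strip_partials:
  fixes f :: "real \<Rightarrow> real \<Rightarrow> 'b::euclidean_space"
  assumes "smooth_on (\<lambda>(u, t). f u t) (UNIV \<times> {0..<T})"
  shows "\<exists>fu ft g.
    continuous_on (UNIV \<times> {0<..<T}) (\<lambda>(u, t). fu u t) \<and>
    continuous_on (UNIV \<times> {0<..<T}) (\<lambda>(u, t). ft u t) \<and>
    continuous_on (UNIV \<times> {0<..<T}) (\<lambda>(u, t). g u t) \<and>
    (\<forall>u. \<forall>t\<in>{0<..<T}.
      ((\<lambda>w. f w t) has_vector_derivative fu u t) (at u) \<and>
      ((\<lambda>\<tau>. f u \<tau>) has_vector_derivative ft u t) (at t) \<and>
      ((\<lambda>\<tau>. fu u \<tau>) has_vector_derivative g u t) (at t) \<and>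
      ((\<lambda>w. ft w t) has_vector_derivative g u t) (at u))"
proof -
  let ?S = "UNIV \<times> {0..<T} :: (real \<times> real) set" and ?O = "UNIV \<times> {0<..<T} :: (real \<times> real) set"
  have O: "open ?O" "?O \<subseteq> ?S" by (auto intro: open_Times)
  have at: "(F has_derivative F') (at x)" if "(F has_derivative F') (at x within ?S)" "x \<in> ?O"
    for F :: "real \<times> real \<Rightarrow> 'b" and F' x
    using has_derivative_subset[OF that(1) O(2)] at_within_open[OF that(2) O(1)] by simp
  have part_u: "((\<lambda>w. F (w, t)) has_vector_derivative F' (1, 0)) (at u)"
    if "(F has_derivative F') (at (u, t))" for F :: "real \<times> real \<Rightarrow> 'b" and F' u t
  proof -
    have 1: "((\<lambda>w. (w, t)) has_vector_derivative (1, 0)) (at u)"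
      unfolding has_vector_derivative_def by (auto intro!: derivative_eq_intros)
    have 2: "(F has_derivative F') (at ((\<lambda>w. (w, t)) u) within range (\<lambda>w. (w, t)))"
      by (rule has_derivative_at_withinI) (rule that)
    show ?thesis by (rule vector_derivative_diff_chain_within[OF 1 2, unfolded o_def])
  qed
  have part_t: "((\<lambda>w. F (u, w)) has_vector_derivative F' (0, 1)) (at t)"
    if "(F has_derivative F') (at (u, t))" for F :: "real \<times> real \<Rightarrow> 'b" and F' u t
  proof -
    have 1: "((\<lambda>w. (u, w)) has_vector_derivative (0, 1)) (at t)"
      unfolding has_vector_derivative_def by (auto intro!: derivative_eq_intros)
    have 2: "(F has_derivative F') (at ((\<lambda>w. (u, w)) t) within range (\<lambda>w. (u, w)))"
      by (rule has_derivative_at_withinI) (rule that)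
    show ?thesis by (rule vector_derivative_diff_chain_within[OF 1 2, unfolded o_def])
  qed
  have "Ck_on (Suc (Suc 0)) (\<lambda>(u, t). f u t) ?S" using assms unfolding smooth_on_def by blast
  from Ck_on.simps(2)[THEN iffD1, OF this]
  obtain F' where F': "\<And>x. x \<in> ?S \<Longrightarrow> ((\<lambda>(u, t). f u t) has_derivative F' x) (at x within ?S)"
    and F'1: "\<And>h. Ck_on (Suc 0) (\<lambda>x. F' x h) ?S" by blast
  from Ck_on.simps(2)[THEN iffD1, OF F'1[of "(1, 0)"]]
  obtain G where G: "\<And>x. x \<in> ?S \<Longrightarrow> ((\<lambda>x. F' x (1, 0)) has_derivative G x) (at x within ?S)"
    and Gc: "\<And>h. continuous_on ?S (\<lambda>x. G x h)" unfolding Ck_on.simps(1) by blast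
  from Ck_on.simps(2)[THEN iffD1, OF F'1[of "(0, 1)"]]
  obtain H where H: "\<And>x. x \<in> ?S \<Longrightarrow> ((\<lambda>x. F' x (0, 1)) has_derivative H x) (at x within ?S)"
    and Hc: "\<And>h. continuous_on ?S (\<lambda>x. H x h)" unfolding Ck_on.simps(1) by blast
  define fu ft g1 g2 where "fu = (\<lambda>u t. F' (u, t) (1, 0))" and "ft = (\<lambda>u t. F' (u, t) (0, 1))"
    and "g1 = (\<lambda>u t. G (u, t) (0, 1))" and "g2 = (\<lambda>u t. H (u, t) (1, 0))"
  have inO: "(u, t) \<in> ?S" "(u, t) \<in> ?O" if "t \<in> {0<..<T}" for u t using that by auto
  have d: "((\<lambda>w. f w t) has_vector_derivative fu u t) (at u)" "((\<lambda>\<tau>. f u \<tau>) has_vector_derivative ft u t) (at t)"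
    "((\<lambda>\<tau>. fu u \<tau>) has_vector_derivative g1 u t) (at t)" "((\<lambda>w. ft w t) has_vector_derivative g2 u t) (at u)"
    if t: "t \<in> {0<..<T}" for u t
    using part_u[OF at[OF F'[OF inO(1)[OF t]] inO(2)[OF t]]] part_t[OF at[OF F'[OF inO(1)[OF t]] inO(2)[OF t]]]
      part_t[OF at[OF G[OF inO(1)[OF t]] inO(2)[OF t]]] part_u[OF at[OF H[OF inO(1)[OF t]] inO(2)[OF t]]]
    unfolding fu_def ft_def g1_def g2_def prod.case by this+
  have cG: "continuous_on ?S (\<lambda>x. F' x (1, 0))" and cH: "continuous_on ?S (\<lambda>x. F' x (0, 1))"
    by (rule has_derivative_continuous_on, erule G, rule has_derivative_continuous_on, erule H)
  have c: "continuous_on ?O (\<lambda>(u, t). fu u t)" "continuous_on ?O (\<lambda>(u, t). ft u t)"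
    "continuous_on ?O (\<lambda>(u, t). g2 u t)"
    unfolding fu_def ft_def g2_def
    using continuous_on_subset[OF cG O(2)] continuous_on_subset[OF cH O(2)] continuous_on_subset[OF Hc[of "(1,0)"] O(2)]
    by (simp_all add: split_def)
  have g: "g1 u t = g2 u t" if "t \<in> {0<..<T}" for u t
    by (rule mixed_partials_commute[OF d c(3,2) that])
  show ?thesis
  proof (rule exI[of _ fu], rule exI[of _ ft], rule exI[of _ g2], intro conjI allI ballI)
    fix u t assume t: "t \<in> {0<..<T}"
    show "((\<lambda>\<tau>. fu u \<tau>) has_vector_derivative g2 u t) (at t)"
      using d(3)[OF t, of u] unfolding g[OF t, of u] .
    show "((\<lambda>w. f w t) has_vector_derivative fu u t) (at u)" by (rule d(1)[OF t])
    show "((\<lambda>\<tau>. f u \<tau>) has_vector_derivative ft u t) (at t)" by (rule d(2)[OF t])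
    show "((\<lambda>w. ft w t) has_vector_derivative g2 u t) (at u)" by (rule d(4)[OF t])
  qed (rule c)+
qed

lemma integral_param_deriv:
  fixes F Ft :: "real \<Rightarrow> real \<Rightarrow> real"
  assumes d: "\<And>u \<tau>. \<tau> \<in> {0<..<T} \<Longrightarrow> ((\<lambda>\<tau>. F u \<tau>) has_real_derivative Ft u \<tau>) (at \<tau>)"
    and c: "\<And>\<tau>. \<tau> \<in> {0<..<T} \<Longrightarrow> continuous_on {0..1} (\<lambda>u. F u \<tau>)"
    and ct: "continuous_on (UNIV \<times> {0<..<T}) (\<lambda>(u, t). Ft u t)"
    and t: "t \<in> {0<..<T}"
  shows "((\<lambda>\<tau>. integral {0..1} (\<lambda>u. F u \<tau>)) has_real_derivative integral {0..1} (\<lambda>u. Ft u t)) (at t)"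
proof -
  have "((\<lambda>\<tau>. integral (cbox 0 1) (\<lambda>u. F u \<tau>)) has_field_derivative integral (cbox 0 1) (\<lambda>u. Ft u t)) (at t within {0<..<T})"
  proof (rule leibniz_rule_field_derivative)
    show "((\<lambda>\<tau>. F u \<tau>) has_field_derivative Ft u \<tau>) (at \<tau> within {0<..<T})" if "\<tau> \<in> {0<..<T}" for \<tau> u
      using d[OF that] by (rule has_field_derivative_at_within)
    show "(\<lambda>u. F u \<tau>) integrable_on cbox 0 1" if "\<tau> \<in> {0<..<T}" for \<tau>
      using c[OF that] by (simp add: integrable_continuous_real)
    show "continuous_on ({0<..<T} \<times> cbox 0 1) (\<lambda>(\<tau>, u). Ft u \<tau>)"
      by (rule continuous_on_slices(3)[OF ct])
    show "t \<in> {0<..<T}" by (rule t)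
    show "convex {0<..<T}" by (rule convex_real_interval)
  qed
  then show ?thesis unfolding box_real at_within_open[OF t open_greaterThanLessThan] .
qed

section \<open>Evolution of length and area\<close>

lemma bounded_bilinear_det2: "bounded_bilinear det2"
proof (rule bounded_bilinear.intro)
  show "\<exists>K. \<forall>x y. norm (det2 x y) \<le> norm x * norm y * K"
  proof (intro exI allI)
    fix x y
    have "det2 x y = Im (cnj x * y)" by (simp add: det2_def)
    then show "norm (det2 x y) \<le> norm x * norm y * 1"
      using abs_Im_le_cmod[of "cnj x * y"] by (simp add: norm_mult)
  qed
qed (simp_all add: det2_def algebra_simps)

lemma det2_deriv:
  assumes "(f has_vector_derivative f') (at x)" "(g has_vector_derivative g') (at x)"
  shows "((\<lambda>x. det2 (f x) (g x)) has_real_derivative det2 (f x) g' + det2 f' (g x)) (at x)"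
  using bounded_bilinear.has_vector_derivative[OF bounded_bilinear_det2 assms]
  by (simp only: has_real_derivative_iff_has_vector_derivative)

lemmas continuous_on_det2 = bounded_bilinear.continuous_on[OF bounded_bilinear_det2]

lemma smooth_on_continuous: "smooth_on f S \<Longrightarrow> continuous_on S f"
  unfolding smooth_on_def by (metis Ck_on.simps(1))

lemma (in minkowski_plane) p_cont: "continuous_on A (p_curve P)"
  by (rule continuous_at_imp_continuous_on, rule ballI, rule has_vector_derivative_continuous, rule p_deriv)

lemma (in minkowski_plane) area_P_pos: "measure lebesgue P > 0"
proof -
  have "interior P \<noteq> {}" using zero_in_interior by blast
  then have "\<not> negligible (interior P)" using open_not_negligible open_interior by blast
  then have "\<not> negligible P" using negligible_subset interior_subset by blast
  moreover have "P \<in> lmeasurable" by (rule lmeasurable_compact[OF P_compact])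
  ultimately have "measure lebesgue P \<noteq> 0" by (simp add: negligible_iff_measure)
  then show ?thesis using measure_nonneg[of lebesgue P] by linarith
qed

locale minkowski_flow = minkowski_plane +
  fixes T :: real and \<gamma> :: "real \<Rightarrow> real \<Rightarrow> complex" and v \<theta> :: "real \<Rightarrow> real \<Rightarrow> real"
  assumes flow: "minkowski_curvature_flow P T \<gamma> v \<theta>"
    and simple: "\<And>t. t \<in> {0..<T} \<Longrightarrow> simple_path (\<lambda>u. \<gamma> u t)"
    and strictly_convex: "\<And>t. t \<in> {0..<T} \<Longrightarrow> strictly_convex_curve (\<lambda>u. \<gamma> u t)"
    and curvature_pos: "\<And>u t. t \<in> {0..<T} \<Longrightarrow> mink_curvature P v \<theta> u t > 0"
begin

definition L where "L t = Q_length v t"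
definition A where "A t = enclosed_area (\<lambda>u. \<gamma> u t)"

lemma flow_facts:
  assumes "t \<in> {0..<T}"
  shows "\<gamma> (u + 1) t = \<gamma> u t" "v u t > 0"
    "((\<lambda>w. \<gamma> w t) has_vector_derivative v u t *\<^sub>R q_curve P (\<theta> u t)) (at u)"
    "((\<lambda>\<tau>. \<gamma> u \<tau>) has_vector_derivative - (mink_curvature P v \<theta> u t *\<^sub>R p_curve P (\<theta> u t))) (at t within {0..<T})"
  using flow assms unfolding minkowski_curvature_flow_def by blast+

lemma flow_smooth: "smooth_on (\<lambda>(u, t). \<gamma> u t) (UNIV \<times> {0..<T})" "smooth_on (\<lambda>(u, t). \<theta> u t) (UNIV \<times> {0..<T})"
  using flow unfolding minkowski_curvature_flow_def by blast+

text \<open>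
Since \<open>v = det2 p \<gamma>\<^sub>u\<close>, both the length and twice the area are integrals of a determinant that
contains \<open>\<gamma>\<^sub>u\<close>.  After differentiation in time the term with \<open>\<gamma>\<^sub>u\<^sub>t = \<gamma>\<^sub>t\<^sub>u\<close> is integrated by parts
over the closed curve, and \<open>\<gamma>\<^sub>t = - k p\<close> is inserted.  For the length this leaves \<open>- \<integral> k\<^sup>2 v\<close>, for the
area \<open>- \<integral> k v = - \<integral> a \<omega> d\<theta>\<close>, which does not depend on the curve.
\<close>
lemma evolution:
  assumes t: "t \<in> {0<..<T}"
  shows "\<exists>n \<theta>' K. convex_loop_C2 (\<lambda>u. \<gamma> u t) n (\<lambda>u. \<theta> u t) \<theta>' \<and>
    ((\<lambda>u. a (\<theta> u t) * n u) has_integral L t) {0..1} \<and>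
    ((\<lambda>u. a (\<theta> u t) * (\<omega> (\<theta> u t) * \<theta>' u)\<^sup>2 / n u) has_integral K) {0..1} \<and>
    (A has_real_derivative - 2 * measure lebesgue P) (at t) \<and>
    (L has_real_derivative - K) (at t)"
proof -
  let ?O = "UNIV \<times> {0<..<T} :: (real \<times> real) set"
  obtain \<gamma>u \<gamma>t \<gamma>ut where c\<gamma>: "continuous_on ?O (\<lambda>(u, t). \<gamma>u u t)" "continuous_on ?O (\<lambda>(u, t). \<gamma>t u t)"
      "continuous_on ?O (\<lambda>(u, t). \<gamma>ut u t)"
    and "\<forall>u. \<forall>t\<in>{0<..<T}.
      ((\<lambda>w. \<gamma> w t) has_vector_derivative \<gamma>u u t) (at u) \<and>
      ((\<lambda>\<tau>. \<gamma> u \<tau>) has_vector_derivative \<gamma>t u t) (at t) \<and>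
      ((\<lambda>\<tau>. \<gamma>u u \<tau>) has_vector_derivative \<gamma>ut u t) (at t) \<and>
      ((\<lambda>w. \<gamma>t w t) has_vector_derivative \<gamma>ut u t) (at u)"
    using smooth_strip_partials[OF flow_smooth(1)] by (elim exE conjE) rule
  then have \<gamma>u: "((\<lambda>w. \<gamma> w t) has_vector_derivative \<gamma>u u t) (at u)"
    and \<gamma>t: "((\<lambda>\<tau>. \<gamma> u \<tau>) has_vector_derivative \<gamma>t u t) (at t)"
    and \<gamma>ut: "((\<lambda>\<tau>. \<gamma>u u \<tau>) has_vector_derivative \<gamma>ut u t) (at t)"
    and \<gamma>tu: "((\<lambda>w. \<gamma>t w t) has_vector_derivative \<gamma>ut u t) (at u)" if "t \<in> {0<..<T}" for u t
    using that by simp_all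
  obtain \<theta>u \<theta>t \<theta>ut where c\<theta>: "continuous_on ?O (\<lambda>(u, t). \<theta>u u t)" "continuous_on ?O (\<lambda>(u, t). \<theta>t u t)"
      "continuous_on ?O (\<lambda>(u, t). \<theta>ut u t)"
    and "\<forall>u. \<forall>t\<in>{0<..<T}.
      ((\<lambda>w. \<theta> w t) has_vector_derivative \<theta>u u t) (at u) \<and>
      ((\<lambda>\<tau>. \<theta> u \<tau>) has_vector_derivative \<theta>t u t) (at t) \<and>
      ((\<lambda>\<tau>. \<theta>u u \<tau>) has_vector_derivative \<theta>ut u t) (at t) \<and>
      ((\<lambda>w. \<theta>t w t) has_vector_derivative \<theta>ut u t) (at u)"
    using smooth_strip_partials[OF flow_smooth(2)] by (elim exE conjE) rule
  then have \<theta>u: "((\<lambda>w. \<theta> w t) has_vector_derivative \<theta>u u t) (at u)"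
    and \<theta>t: "((\<lambda>\<tau>. \<theta> u \<tau>) has_vector_derivative \<theta>t u t) (at t)" if "t \<in> {0<..<T}" for u t
    using that by simp_all
  have in0: "t \<in> {0..<T}" if "t \<in> {0<..<T}" for t using that by simp
  have sub: "?O \<subseteq> UNIV \<times> {0..<T}" by auto
  note c0\<gamma> = continuous_on_subset[OF smooth_on_continuous[OF flow_smooth(1)] sub]
  note c0\<theta> = continuous_on_subset[OF smooth_on_continuous[OF flow_smooth(2)] sub]
  define n where "n = (\<lambda>u t. v u t / a (\<theta> u t))"
  have v_eq: "v u t = a (\<theta> u t) * n u t" for u t using a_pos[of "\<theta> u t"] by (simp add: n_def)
  have n_pos: "n u t > 0" if "t \<in> {0<..<T}" for u t
    using flow_facts(2)[OF in0[OF that], of u] a_pos[of "\<theta> u t"] by (simp add: n_def)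
  have \<gamma>u_eq: "\<gamma>u u t = n u t *\<^sub>R e_th (\<theta> u t)" if "t \<in> {0<..<T}" for u t
    using vector_derivative_unique_at[OF \<gamma>u[OF that] flow_facts(3)[OF in0[OF that]]]
    by (simp add: q_eq n_def)
  have n_eq: "n u t = \<gamma>u u t \<bullet> e_th (\<theta> u t)" if "t \<in> {0<..<T}" for u t
    by (simp add: \<gamma>u_eq[OF that])
  have \<theta>u_real: "((\<lambda>w. \<theta> w t) has_real_derivative \<theta>u u t) (at u)" if "t \<in> {0<..<T}" for u t
    using \<theta>u[OF that] by (simp only: has_real_derivative_iff_has_vector_derivative)
  have k_eq: "mink_curvature P v \<theta> u t = a (\<theta> u t) * \<omega> (\<theta> u t) * (\<theta>u u t / v u t)" if "t \<in> {0<..<T}" for u t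
    using DERIV_imp_deriv[OF \<theta>u_real[OF that, of u]] by (simp add: mink_curvature_def det_p)
  have \<theta>u_pos: "\<theta>u u t > 0" if "t \<in> {0<..<T}" for u t
  proof -
    have "0 < a (\<theta> u t) * \<omega> (\<theta> u t) * (\<theta>u u t / v u t)"
      using curvature_pos[OF in0[OF that], of u] unfolding k_eq[OF that] .
    moreover have "0 < a (\<theta> u t) * \<omega> (\<theta> u t)" using a_pos \<omega>_pos by (rule mult_pos_pos)
    ultimately have "0 < \<theta>u u t / v u t" by (rule zero_less_mult_pos)
    then show ?thesis using flow_facts(2)[OF in0[OF that], of u] by (simp add: zero_less_divide_iff)
  qed
  have \<gamma>t_eq: "\<gamma>t u t = - ((\<omega> (\<theta> u t) * \<theta>u u t / n u t) *\<^sub>R p_curve P (\<theta> u t))" if t: "t \<in> {0<..<T}" for u t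
  proof -
    have "((\<lambda>\<tau>. \<gamma> u \<tau>) has_vector_derivative - (mink_curvature P v \<theta> u t *\<^sub>R p_curve P (\<theta> u t))) (at t within {0<..<T})"
      by (rule has_vector_derivative_within_subset[OF flow_facts(4)[OF in0[OF t]]]) auto
    then have "((\<lambda>\<tau>. \<gamma> u \<tau>) has_vector_derivative - (mink_curvature P v \<theta> u t *\<^sub>R p_curve P (\<theta> u t))) (at t)"
      unfolding at_within_open[OF t open_greaterThanLessThan] .
    from vector_derivative_unique_at[OF \<gamma>t[OF t] this]
    have "\<gamma>t u t = - (mink_curvature P v \<theta> u t *\<^sub>R p_curve P (\<theta> u t))" .
    moreover have "mink_curvature P v \<theta> u t = \<omega> (\<theta> u t) * \<theta>u u t / n u t"
      unfolding k_eq[OF t] v_eq using a_pos[of "\<theta> u t"] by simp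
    ultimately show ?thesis by simp
  qed
  have loop: "convex_loop_C2 (\<lambda>u. \<gamma> u t) (\<lambda>u. n u t) (\<lambda>u. \<theta> u t) (\<lambda>u. \<theta>u u t)" if t: "t \<in> {0<..<T}" for t
  proof
    show "\<gamma> (u + 1) t = \<gamma> u t" for u by (rule flow_facts(1)[OF in0[OF t]])
    show "((\<lambda>w. \<gamma> w t) has_vector_derivative n u t *\<^sub>R e_th (\<theta> u t)) (at u)" for u
      using \<gamma>u[OF t, of u] unfolding \<gamma>u_eq[OF t] .
    show "n u t > 0" for u by (rule n_pos[OF t])
    have "continuous_on UNIV (\<lambda>u. \<gamma>u u t \<bullet> e_th (\<theta> u t))"
      unfolding inner_e_th
      by (intro continuous_intros continuous_on_slices(2)[OF c\<gamma>(1) t] continuous_on_slices(2)[OF c0\<theta> t])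
    then show "continuous_on UNIV (\<lambda>u. n u t)" unfolding n_eq[OF t, symmetric] .
    show "((\<lambda>u. \<theta> u t) has_real_derivative \<theta>u u t) (at u)" "\<theta>u u t > 0" for u
      by (rule \<theta>u_real[OF t], rule \<theta>u_pos[OF t])
    show "simple_path (\<lambda>u. \<gamma> u t)" "strictly_convex_curve (\<lambda>u. \<gamma> u t)"
      by (rule simple[OF in0[OF t]], rule strictly_convex[OF in0[OF t]])
    show "continuous_on UNIV (\<lambda>u. \<theta>u u t)" by (rule continuous_on_slices(2)[OF c\<theta>(1) t])
  qed
  interpret convex_loop_C2 "\<lambda>u. \<gamma> u t" "\<lambda>u. n u t" "\<lambda>u. \<theta> u t" "\<lambda>u. \<theta>u u t" by (rule loop[OF t])
  have p\<theta>: "((\<lambda>w. p_curve P (f w)) has_vector_derivative f' *\<^sub>R (\<omega> (f x) *\<^sub>R e_th (f x))) (at x)"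
    if "(f has_vector_derivative f') (at x)" for f f' x
    using vector_diff_chain_at[OF that p_deriv] by (simp add: o_def)
  have cs: "continuous_on B (\<lambda>u. \<theta> u t)" "continuous_on B (\<lambda>u. \<gamma> u t)" "continuous_on B (\<lambda>u. \<gamma>u u t)"
    "continuous_on B (\<lambda>u. \<gamma>t u t)" "continuous_on B (\<lambda>u. \<gamma>ut u t)" "continuous_on B (\<lambda>u. \<theta>u u t)"
    if "t \<in> {0<..<T}" for t B
    by (rule continuous_on_slices(2)[OF c0\<theta> that] continuous_on_slices(2)[OF c0\<gamma> that] continuous_on_slices(2)[OF c\<gamma>(1) that]
      continuous_on_slices(2)[OF c\<gamma>(2) that] continuous_on_slices(2)[OF c\<gamma>(3) that] continuous_on_slices(2)[OF c\<theta>(1) that])+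
  have cp: "continuous_on B (\<lambda>u. p_curve P (\<theta> u t))" if "t \<in> {0<..<T}" for t B
    by (rule continuous_on_compose2[OF p_cont[of UNIV] cs(1)[OF that]]) simp
  note cO = c\<gamma>[unfolded split_def] c0\<gamma>[unfolded split_def] c0\<theta>[unfolded split_def]
  have cpO: "continuous_on ?O (\<lambda>z. p_curve P (\<theta> (fst z) (snd z)))"
    by (rule continuous_on_compose2[OF p_cont[of UNIV] cO(5)]) simp
  have ends: "\<gamma>t 1 t = \<gamma>t 0 t" "\<gamma> 1 t = \<gamma> 0 t" "p_curve P (\<theta> 1 t) = p_curve P (\<theta> 0 t)"
  proof -
    have per: "\<gamma> 1 \<tau> = \<gamma> 0 \<tau>" if "\<tau> \<in> {0<..<T}" for \<tau> using flow_facts(1)[OF in0[OF that], of 0] by simp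
    have "((\<lambda>\<tau>. \<gamma> 0 \<tau>) has_vector_derivative \<gamma>t 1 t) (at t)"
      by (rule has_vector_derivative_transform_within_open[OF \<gamma>t[OF t, of 1] open_greaterThanLessThan t]) (rule per)
    then show "\<gamma>t 1 t = \<gamma>t 0 t" by (rule vector_derivative_unique_at[OF _ \<gamma>t[OF t]])
    show "\<gamma> 1 t = \<gamma> 0 t" by (rule per[OF t])
    show "p_curve P (\<theta> 1 t) = p_curve P (\<theta> 0 t)" using \<theta>_shift[of 0] by (simp add: p_shift_2pi)
  qed
  have v_det: "v u t = det2 (p_curve P (\<theta> u t)) (\<gamma>u u t)" if "t \<in> {0<..<T}" for u t
    unfolding \<gamma>u_eq[OF that] v_eq by (simp add: det2_e_th p_inner)
  define K where "K = integral {0..1} (\<lambda>u. a (\<theta> u t) * (\<omega> (\<theta> u t) * \<theta>u u t)\<^sup>2 / n u t)"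
  have cn: "continuous_on {0..1} (\<lambda>u. n u t)" by (rule continuous_on_subset[OF speed(2) subset_UNIV])
  have ca\<theta>: "continuous_on {0..1} (\<lambda>u. a (\<theta> u t))" "continuous_on {0..1} (\<lambda>u. \<omega> (\<theta> u t))"
    by (rule continuous_on_compose2[OF a_cont(1)[of UNIV] cs(1)[OF t]], simp,
        rule continuous_on_compose2[OF a_cont(4)[of UNIV] cs(1)[OF t]], simp)
  have hK: "((\<lambda>u. a (\<theta> u t) * (\<omega> (\<theta> u t) * \<theta>u u t)\<^sup>2 / n u t) has_integral K) {0..1}"
    unfolding K_def
    by (intro integrable_integral integrable_continuous_real continuous_intros ca\<theta> cn cs[OF t])
      (use n_pos[OF t] in \<open>auto simp: less_le\<close>)
  have hL: "((\<lambda>u. a (\<theta> u t) * n u t) has_integral L t) {0..1}"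
  proof -
    have "L t = integral {0..1} (\<lambda>u. a (\<theta> u t) * n u t)" unfolding L_def Q_length_def v_eq ..
    then show ?thesis
      by (simp only:) (intro integrable_integral integrable_continuous_real continuous_intros ca\<theta> cn)
  qed
  have L_deriv: "(L has_real_derivative - K) (at t)"
  proof -
    have "((\<lambda>\<tau>. integral {0..1} (\<lambda>u. det2 (p_curve P (\<theta> u \<tau>)) (\<gamma>u u \<tau>))) has_real_derivative
        integral {0..1} (\<lambda>u. det2 (p_curve P (\<theta> u t)) (\<gamma>ut u t))) (at t)"
    proof (rule integral_param_deriv[OF _ _ _ t])
      fix u \<tau> assume \<tau>: "\<tau> \<in> {0<..<T}"
      \<comment> \<open>The derivative of \<open>p\<close> is parallel to \<open>\<gamma>\<^sub>u\<close>.\<close>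
      have "det2 (\<theta>t u \<tau> *\<^sub>R (\<omega> (\<theta> u \<tau>) *\<^sub>R e_th (\<theta> u \<tau>))) (\<gamma>u u \<tau>) = 0"
        unfolding \<gamma>u_eq[OF \<tau>] by (simp add: det2_def)
      then show "((\<lambda>\<tau>. det2 (p_curve P (\<theta> u \<tau>)) (\<gamma>u u \<tau>)) has_real_derivative det2 (p_curve P (\<theta> u \<tau>)) (\<gamma>ut u \<tau>)) (at \<tau>)"
        using det2_deriv[OF p\<theta>[OF \<theta>t[OF \<tau>, of u]] \<gamma>ut[OF \<tau>, of u]] by simp
      show "continuous_on {0..1} (\<lambda>u. det2 (p_curve P (\<theta> u \<tau>)) (\<gamma>u u \<tau>))"
        by (intro continuous_on_det2 cp[OF \<tau>] cs[OF \<tau>])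
    next
      show "continuous_on ?O (\<lambda>(u, \<tau>). det2 (p_curve P (\<theta> u \<tau>)) (\<gamma>ut u \<tau>))"
        unfolding split_def by (intro continuous_on_det2 cpO cO)
    qed
    moreover have "integral {0..1} (\<lambda>u. det2 (p_curve P (\<theta> u t)) (\<gamma>ut u t)) = - K"
    proof -
      have "((\<lambda>w. det2 (p_curve P (\<theta> w t)) (\<gamma>t w t)) has_real_derivative
         det2 (p_curve P (\<theta> u t)) (\<gamma>ut u t) + a (\<theta> u t) * (\<omega> (\<theta> u t) * \<theta>u u t)\<^sup>2 / n u t) (at u)" for u
      proof (rule DERIV_cong[OF det2_deriv[OF p\<theta>[OF \<theta>u[OF t, of u]] \<gamma>tu[OF t, of u]]])
        have e: "det2 (r *\<^sub>R (s *\<^sub>R e_th \<phi>)) (- (k *\<^sub>R x)) = r * s * k * (x \<bullet> e_r \<phi>)" for r s k x \<phi>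
          by (simp add: det2_def e_th_def inner_e_r algebra_simps)
        show "det2 (p_curve P (\<theta> u t)) (\<gamma>ut u t) + det2 (\<theta>u u t *\<^sub>R (\<omega> (\<theta> u t) *\<^sub>R e_th (\<theta> u t))) (\<gamma>t u t)
          = det2 (p_curve P (\<theta> u t)) (\<gamma>ut u t) + a (\<theta> u t) * (\<omega> (\<theta> u t) * \<theta>u u t)\<^sup>2 / n u t"
          unfolding \<gamma>t_eq[OF t] e p_inner by (simp add: power2_eq_square mult_ac)
      qed
      then have "((\<lambda>u. det2 (p_curve P (\<theta> u t)) (\<gamma>ut u t) + a (\<theta> u t) * (\<omega> (\<theta> u t) * \<theta>u u t)\<^sup>2 / n u t)
        has_integral det2 (p_curve P (\<theta> 1 t)) (\<gamma>t 1 t) - det2 (p_curve P (\<theta> 0 t)) (\<gamma>t 0 t)) {0..1}"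
        by (intro real_ftc) auto
      then have "((\<lambda>u. det2 (p_curve P (\<theta> u t)) (\<gamma>ut u t) + a (\<theta> u t) * (\<omega> (\<theta> u t) * \<theta>u u t)\<^sup>2 / n u t)
        has_integral 0) {0..1}" by (simp add: ends)
      from has_integral_diff[OF this hK] show ?thesis by (intro integral_unique) simp
    qed
    ultimately have D: "((\<lambda>\<tau>. integral {0..1} (\<lambda>u. det2 (p_curve P (\<theta> u \<tau>)) (\<gamma>u u \<tau>))) has_real_derivative - K) (at t)"
      by simp
    show ?thesis
    proof (rule has_field_derivative_transform_within_open[OF D open_greaterThanLessThan t])
      fix \<tau> assume \<tau>: "\<tau> \<in> {0<..<T}"
      show "integral {0..1} (\<lambda>u. det2 (p_curve P (\<theta> u \<tau>)) (\<gamma>u u \<tau>)) = L \<tau>"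
        unfolding L_def Q_length_def v_det[OF \<tau>] ..
    qed
  qed
  have A_deriv: "(A has_real_derivative - 2 * measure lebesgue P) (at t)"
  proof -
    have "((\<lambda>\<tau>. integral {0..1} (\<lambda>u. det2 (\<gamma> u \<tau>) (\<gamma>u u \<tau>))) has_real_derivative
        integral {0..1} (\<lambda>u. det2 (\<gamma> u t) (\<gamma>ut u t) + det2 (\<gamma>t u t) (\<gamma>u u t))) (at t)"
    proof (rule integral_param_deriv[OF _ _ _ t])
      fix u \<tau> assume \<tau>: "\<tau> \<in> {0<..<T}"
      show "((\<lambda>\<tau>. det2 (\<gamma> u \<tau>) (\<gamma>u u \<tau>)) has_real_derivative det2 (\<gamma> u \<tau>) (\<gamma>ut u \<tau>) + det2 (\<gamma>t u \<tau>) (\<gamma>u u \<tau>)) (at \<tau>)"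
        by (rule det2_deriv[OF \<gamma>t[OF \<tau>, of u] \<gamma>ut[OF \<tau>, of u]])
      show "continuous_on {0..1} (\<lambda>u. det2 (\<gamma> u \<tau>) (\<gamma>u u \<tau>))"
        by (intro continuous_on_det2 cs[OF \<tau>])
    next
      show "continuous_on ?O (\<lambda>(u, \<tau>). det2 (\<gamma> u \<tau>) (\<gamma>ut u \<tau>) + det2 (\<gamma>t u \<tau>) (\<gamma>u u \<tau>))"
        unfolding split_def by (intro continuous_on_add continuous_on_det2 cO)
    qed
    moreover have "integral {0..1} (\<lambda>u. det2 (\<gamma> u t) (\<gamma>ut u t) + det2 (\<gamma>t u t) (\<gamma>u u t)) = - 4 * measure lebesgue P"
    proof (rule integral_unique)
      have "((\<lambda>w. det2 (\<gamma> w t) (\<gamma>t w t)) has_real_derivative det2 (\<gamma> u t) (\<gamma>ut u t) + det2 (\<gamma>u u t) (\<gamma>t u t)) (at u)" for u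
        by (rule det2_deriv[OF \<gamma>u[OF t, of u] \<gamma>tu[OF t, of u]])
      then have "((\<lambda>u. det2 (\<gamma> u t) (\<gamma>ut u t) + det2 (\<gamma>u u t) (\<gamma>t u t)) has_integral
          det2 (\<gamma> 1 t) (\<gamma>t 1 t) - det2 (\<gamma> 0 t) (\<gamma>t 0 t)) {0..1}"
        by (intro real_ftc) auto
      then have 0: "((\<lambda>u. det2 (\<gamma> u t) (\<gamma>ut u t) + det2 (\<gamma>u u t) (\<gamma>t u t)) has_integral 0) {0..1}"
        by (simp add: ends)
      have "((\<lambda>u. (a (\<theta> u t) * \<omega> (\<theta> u t)) * \<theta>u u t) has_integral integral {0..2*pi} (\<lambda>x. a x * \<omega> x)) {0..1}"
        by (rule integral_angle) (intro continuous_intros a_cont, simp add: a_shift_2pi \<omega>_shift_2pi)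
      then have 1: "((\<lambda>u. (a (\<theta> u t) * \<omega> (\<theta> u t)) * \<theta>u u t) has_integral 2 * measure lebesgue P) {0..1}"
        unfolding integral_unique[OF area_P] .
      have det: "det2 (\<gamma>t u t) (\<gamma>u u t) = - ((a (\<theta> u t) * \<omega> (\<theta> u t)) * \<theta>u u t)" for u
      proof -
        have e: "det2 (- (k *\<^sub>R x)) (r *\<^sub>R e_th \<phi>) = - (k * r * (x \<bullet> e_r \<phi>))" for r k x \<phi>
          by (simp add: det2_def e_th_def inner_e_r algebra_simps)
        show ?thesis unfolding \<gamma>t_eq[OF t] \<gamma>u_eq[OF t] e p_inner using n_pos[OF t, of u] by simp
      qed
      have anti: "det2 (\<gamma>u u t) (\<gamma>t u t) = - det2 (\<gamma>t u t) (\<gamma>u u t)" for u by (simp add: det2_def)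
      from has_integral_diff[OF 0 has_integral_mult_right[OF 1, of 2]]
      show "((\<lambda>u. det2 (\<gamma> u t) (\<gamma>ut u t) + det2 (\<gamma>t u t) (\<gamma>u u t)) has_integral - 4 * measure lebesgue P) {0..1}"
        by (simp add: anti det mult_ac)
    qed
    ultimately have "((\<lambda>\<tau>. integral {0..1} (\<lambda>u. det2 (\<gamma> u \<tau>) (\<gamma>u u \<tau>))) has_real_derivative - 4 * measure lebesgue P) (at t)"
      by simp
    from DERIV_cdivide[OF this, of 2]
    have D: "((\<lambda>\<tau>. integral {0..1} (\<lambda>u. det2 (\<gamma> u \<tau>) (\<gamma>u u \<tau>)) / 2) has_real_derivative - 2 * measure lebesgue P) (at t)"
      by simp
    show ?thesis
    proof (rule has_field_derivative_transform_within_open[OF D open_greaterThanLessThan t])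
      fix \<tau> assume \<tau>: "\<tau> \<in> {0<..<T}"
      have "convex_loop (\<lambda>u. \<gamma> u \<tau>) (\<lambda>u. n u \<tau>) (\<lambda>u. \<theta> u \<tau>) (\<lambda>u. \<theta>u u \<tau>)"
        using loop[OF \<tau>] by (rule convex_loop_C2.axioms(1))
      from convex_loop.area[OF this]
      show "integral {0..1} (\<lambda>u. det2 (\<gamma> u \<tau>) (\<gamma>u u \<tau>)) / 2 = A \<tau>"
        unfolding A_def \<gamma>u_eq[OF \<tau>] by (rule sym)
    qed
  qed
  show ?thesis
    by (rule exI[of _ "\<lambda>u. n u t"], rule exI[of _ "\<lambda>u. \<theta>u u t"], rule exI[of _ K])
      (intro conjI loop[OF t] hL hK A_deriv L_deriv)
qed

text \<open>
For the deficit \<open>E = L\<^sup>2 / A - 4 p\<close> the evolution equations and Gage's inequality with remainder give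
\<open>E' \<le> - 2 \<kappa> E / A\<close>, and \<open>A' = - 2 p\<close>.
\<close>
lemma ratio_tendsto:
  assumes T: "T > 0" and A0: "(A \<longlongrightarrow> 0) (at_left T)"
  shows "((\<lambda>t. (L t)\<^sup>2 / A t) \<longlongrightarrow> 4 * measure lebesgue P) (at_left T)"
proof -
  define p where "p = measure lebesgue P"
  have p: "p > 0" unfolding p_def by (rule area_P_pos)
  obtain \<kappa> where \<kappa>: "\<kappa> > 0" and gage: "\<forall>c n \<theta> \<theta>' L K A. convex_loop_C2 c n \<theta> \<theta>' \<longrightarrow>
    ((\<lambda>u. a (\<theta> u) * n u) has_integral L) {0..1} \<longrightarrow>
    ((\<lambda>u. a (\<theta> u) * (\<omega> (\<theta> u) * \<theta>' u)\<^sup>2 / n u) has_integral K) {0..1} \<longrightarrow> A = enclosed_area c \<longrightarrow>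
    L > 0 \<and> 4 * p * A \<le> L\<^sup>2 \<and> \<kappa> * ((L\<^sup>2 - 4 * p * A) / (L * A)) \<le> K - p * L / A"
    using gage_loop unfolding p_def[symmetric] by (elim exE conjE) rule
  have step: "\<exists>K. (A has_real_derivative - 2 * p) (at t) \<and> (L has_real_derivative - K) (at t) \<and>
      A t > 0 \<and> L t > 0 \<and> 4 * p * A t \<le> (L t)\<^sup>2 \<and>
      \<kappa> * (((L t)\<^sup>2 - 4 * p * A t) / (L t * A t)) \<le> K - p * L t / A t" if t: "t \<in> {0<..<T}" for t
  proof -
    obtain n \<theta>' K where *: "convex_loop_C2 (\<lambda>u. \<gamma> u t) n (\<lambda>u. \<theta> u t) \<theta>'"
        "((\<lambda>u. a (\<theta> u t) * n u) has_integral L t) {0..1}"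
        "((\<lambda>u. a (\<theta> u t) * (\<omega> (\<theta> u t) * \<theta>' u)\<^sup>2 / n u) has_integral K) {0..1}"
        "(A has_real_derivative - 2 * p) (at t)" "(L has_real_derivative - K) (at t)"
      using evolution[OF t] unfolding p_def[symmetric] by (elim exE conjE) rule
    have "A t > 0" unfolding A_def by (rule convex_loop.area_pos[OF convex_loop_C2.axioms(1)[OF *(1)]])
    moreover note gage[rule_format, OF *(1-3) A_def]
    ultimately show ?thesis using *(4,5) by (intro exI[of _ K]) simp
  qed
  \<comment> \<open>The exponent for which the two terms in the derivative of \<open>E A powr (- \<beta>)\<close> balance.\<close>
  define \<beta> where "\<beta> = \<kappa> / p"
  have \<beta>: "\<beta> > 0" using \<kappa> p by (simp add: \<beta>_def)
  define E where "E = (\<lambda>t. (L t)\<^sup>2 / A t - 4 * p)"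
  define H where "H = (\<lambda>t. E t * A t powr (- \<beta>))"
  have A_pos: "A t > 0" if "t \<in> {0<..<T}" for t using step[OF that] by blast
  have E_nonneg: "E t \<ge> 0" if t: "t \<in> {0<..<T}" for t
  proof -
    have "4 * p * A t \<le> (L t)\<^sup>2" using step[OF t] by blast
    then show ?thesis using A_pos[OF t] by (simp add: E_def pos_le_divide_eq)
  qed
  have H_deriv: "\<exists>y. (H has_real_derivative y) (at t) \<and> y \<le> 0" if t: "t \<in> {0<..<T}" for t
  proof -
    obtain K where K: "(A has_real_derivative - 2 * p) (at t)" "(L has_real_derivative - K) (at t)"
      "A t > 0" "L t > 0" "\<kappa> * (((L t)\<^sup>2 - 4 * p * A t) / (L t * A t)) \<le> K - p * L t / A t"
      using step[OF t] by (elim exE conjE) rule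
    define e where "e = (2 * L t * (- K) * A t - (L t)\<^sup>2 * (- 2 * p)) / (A t)\<^sup>2"
    have "((\<lambda>t. (L t)\<^sup>2 / A t) has_real_derivative e) (at t)"
      unfolding e_def using K(3)
      by (intro DERIV_cong[OF DERIV_divide[OF DERIV_power[OF K(2), of 2] K(1)]]) (auto simp: power2_eq_square)
    from DERIV_diff[OF this DERIV_const] have Ed: "(E has_real_derivative e) (at t)"
      unfolding E_def by simp
    have Ad: "((\<lambda>t. A t powr (- \<beta>)) has_real_derivative 2 * p * \<beta> * A t powr (- \<beta>) / A t) (at t)"
      by (rule DERIV_cong[OF DERIV_fun_powr[OF K(1,3)]]) (use K(3) in \<open>simp add: powr_diff\<close>)
    have "e = - (2 * L t / A t) * (K - p * L t / A t)"
      using K(3) by (simp add: e_def power2_eq_square field_simps)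
    also have "\<dots> \<le> - (2 * L t / A t) * (\<kappa> * (((L t)\<^sup>2 - 4 * p * A t) / (L t * A t)))"
      using K(3-5) by (intro mult_left_mono_neg) auto
    also have "\<dots> = - (2 * \<kappa> / A t) * E t"
      using K(3,4) by (simp add: E_def field_simps)
    finally have e: "e \<le> - (2 * \<kappa> / A t) * E t" .
    have "(H has_real_derivative e * A t powr (- \<beta>) + 2 * p * \<beta> * A t powr (- \<beta>) / A t * E t) (at t)"
      unfolding H_def by (rule DERIV_mult[OF Ed Ad])
    moreover have "e * A t powr (- \<beta>) + 2 * p * \<beta> * A t powr (- \<beta>) / A t * E t \<le> 0"
    proof -
      have "e * A t powr (- \<beta>) \<le> - (2 * \<kappa> / A t) * E t * A t powr (- \<beta>)"
        using e by (intro mult_right_mono) auto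
      also have "\<dots> = - (2 * p * \<beta> * A t powr (- \<beta>) / A t * E t)" using p by (simp add: \<beta>_def)
      finally show ?thesis by linarith
    qed
    ultimately show ?thesis by blast
  qed
  have H_le: "H t \<le> H (T / 2)" if t: "t \<in> {T/2..<T}" for t
  proof (rule DERIV_nonpos_imp_nonincreasing[where f = H])
    show "T / 2 \<le> t" using t by simp
    show "\<exists>y. (H has_real_derivative y) (at x) \<and> y \<le> 0" if "T / 2 \<le> x" "x \<le> t" for x
      using H_deriv[of x] that t T by simp
  qed
  have near: "eventually (\<lambda>t. t \<in> {T/2..<T}) (at_left T)"
    using eventually_at_left_real[of "T/2" T] T by (auto elim!: eventually_mono)
  have "((\<lambda>t. H (T / 2) * A t powr \<beta>) \<longlongrightarrow> H (T / 2) * 0) (at_left T)"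
  proof (intro tendsto_mult tendsto_const tendsto_zero_powrI[OF A0 tendsto_const _ \<beta>])
    show "eventually (\<lambda>t. 0 \<le> A t) (at_left T)"
      using near by (rule eventually_mono) (use A_pos T in \<open>force intro: less_imp_le\<close>)
  qed
  then have bound: "((\<lambda>t. H (T / 2) * A t powr \<beta>) \<longlongrightarrow> 0) (at_left T)" by simp
  have "(E \<longlongrightarrow> 0) (at_left T)"
  proof (rule tendsto_sandwich[OF _ _ tendsto_const bound])
    show "eventually (\<lambda>t. 0 \<le> E t) (at_left T)"
      using near by (rule eventually_mono) (use E_nonneg T in auto)
    show "eventually (\<lambda>t. E t \<le> H (T / 2) * A t powr \<beta>) (at_left T)"
      using near
    proof (rule eventually_mono)
      fix t assume t: "t \<in> {T/2..<T}"
      then have "A t > 0" using A_pos[of t] T by simp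
      then have "E t = H t * A t powr \<beta>" by (simp add: H_def powr_minus)
      also have "\<dots> \<le> H (T / 2) * A t powr \<beta>" using H_le[OF t] by (intro mult_right_mono) auto
      finally show "E t \<le> H (T / 2) * A t powr \<beta>" .
    qed
  qed
  from tendsto_add[OF this tendsto_const[of "4 * p"]] show ?thesis by (simp add: E_def p_def)
qed

end

theorem theorem5p1:
  fixes P :: "complex set" and T :: real
    and \<gamma> :: "real \<Rightarrow> real \<Rightarrow> complex"
    and v \<theta> :: "real \<Rightarrow> real \<Rightarrow> real"
  assumes "minkowski_ball P"
    and "T > 0"
    and "minkowski_curvature_flow P T \<gamma> v \<theta>"
    and "\<And>t. t \<in> {0..<T} \<Longrightarrow> simple_path (\<lambda>u. \<gamma> u t)"
    and "\<And>t. t \<in> {0..<T} \<Longrightarrow> strictly_convex_curve (\<lambda>u. \<gamma> u t)"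
    and "\<And>t. t \<in> {0..<T} \<Longrightarrow> counterclockwise (\<lambda>u. \<gamma> u t)"
    and "\<And>u t. t \<in> {0..<T} \<Longrightarrow> mink_curvature P v \<theta> u t > 0"
    and "((\<lambda>t. enclosed_area (\<lambda>u. \<gamma> u t)) \<longlongrightarrow> 0) (at_left T)"
  shows "((\<lambda>t. (Q_length v t)\<^sup>2 / enclosed_area (\<lambda>u. \<gamma> u t)) \<longlongrightarrow> 4 * measure lebesgue P) (at_left T)"
proof -
  interpret minkowski_flow P T \<gamma> v \<theta>
    by unfold_locales (rule assms(1), rule assms(3), erule assms(4), erule assms(5), erule assms(7))
  show ?thesis
    using ratio_tendsto[OF assms(2)] assms(8) unfolding A_def[abs_def] L_def[abs_def] by simp
qed

end
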